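(* Let $M^2$ be a closed real analytic surface in $\mathbb{R}^3$ with induced metric $g$. Suppose there is a point $Q\in M$ such that the Green function of $g$ has the form $G(P,Q)=-\frac1{2\pi}\log\|P-Q\|+C$ for any $P\in M$ and some $C\in\mathbb{R}$. Assume additionally that the surface is $\mathbb{S}^1$-invariant about $Q$. Then $M$ is a round sphere.
   Context: $\|P-Q\|$ is the Euclidean distance in $\mathbb{R}^3$. The Green function of $g$ with pole $Q$ is the Green function of the Laplacian: $-\Delta_gG(\cdot,Q)=\delta_Q-\frac1V$ in the distribution sense on $M$, where $\Delta_g$ is the (nonpositive) Laplace–Beltrami operator and $V$ is the area of $(M,g)$. "$\mathbb{S}^1$-invariant about $Q$" means invariant under all rotations of $\mathbb{R}^3$ about the normal line to $M$ at $Q$; in particular, when $Q=0$ and $M$ is locally near $Q$ the graph of a function $f$ over the tangent plane at $Q$, $f(x)$ depends only on $|x|^2$. *)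

theory Defs
  imports "HOL-Analysis.Analysis"
begin

section \<open>Real analytic and smooth functions of two variables\<close>

definition real_analytic_on :: "(real^2 \<Rightarrow> 'b::real_normed_vector) \<Rightarrow> (real^2) set \<Rightarrow> bool" where
  "real_analytic_on f U \<longleftrightarrow>
     (\<forall>u\<in>U. \<exists>a :: nat \<times> nat \<Rightarrow> 'b. \<exists>r>0. \<forall>w\<in>ball u r.
        ((\<lambda>(i, j). ((w $ 1 - u $ 1) ^ i * (w $ 2 - u $ 2) ^ j) *\<^sub>R a (i, j)) has_sum f w) UNIV)"

definition pd :: "2 \<Rightarrow> (real^2 \<Rightarrow> 'b::real_normed_vector) \<Rightarrow> real^2 \<Rightarrow> 'b" where
  "pd i f u = frechet_derivative f (at u) (axis i 1)"

text \<open>The following predicates are intended for open sets only.\<close>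

fun Ck_on :: "nat \<Rightarrow> (real^2 \<Rightarrow> 'b::real_normed_vector) \<Rightarrow> (real^2) set \<Rightarrow> bool" where
  "Ck_on 0 f U \<longleftrightarrow> continuous_on U f"
| "Ck_on (Suc k) f U \<longleftrightarrow> f differentiable_on U \<and> (\<forall>i. Ck_on k (pd i f) U)"

definition smooth_on :: "(real^2 \<Rightarrow> 'b::real_normed_vector) \<Rightarrow> (real^2) set \<Rightarrow> bool" where
  "smooth_on f U \<longleftrightarrow> (\<forall>k. Ck_on k f U)"


section \<open>Real analytic surfaces in three-space\<close>

text \<open>Surfaces are embedded, so they are represented as subsets of \<^typ>\<open>real^3\<close>. A local
  parametrization is the inverse of a chart belonging to the real analytic structure that \<open>M\<close>
  inherits from the ambient space.\<close>

definition local_param :: "(real^3) set \<Rightarrow> (real^2) set \<Rightarrow> (real^2 \<Rightarrow> real^3) \<Rightarrow> bool" where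
  "local_param M U X \<longleftrightarrow>
     open U \<and> real_analytic_on X U \<and>
     (\<forall>u\<in>U. inj (frechet_derivative X (at u))) \<and>
     openin (top_of_set M) (X ` U) \<and>
     (\<exists>Y. homeomorphism U (X ` U) X Y)"

definition analytic_surface :: "(real^3) set \<Rightarrow> bool" where
  "analytic_surface M \<longleftrightarrow> (\<forall>P\<in>M. \<exists>U X. local_param M U X \<and> P \<in> X ` U)"

text \<open>Being modelled on open subsets of the plane, such a surface has no boundary. Connectedness
  is not required.\<close>

definition closed_analytic_surface :: "(real^3) set \<Rightarrow> bool" where
  "closed_analytic_surface M \<longleftrightarrow> compact M \<and> analytic_surface M"


section \<open>Induced metric, area and Laplace--Beltrami operator\<close>

definition induced_metric :: "(real^2 \<Rightarrow> real^3) \<Rightarrow> real^2 \<Rightarrow> real^2^2" where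
  "induced_metric X u = (\<chi> i j. pd i X u \<bullet> pd j X u)"

definition area_density :: "(real^2 \<Rightarrow> real^3) \<Rightarrow> real^2 \<Rightarrow> real" where
  "area_density X u = sqrt (det (induced_metric X u))"

text \<open>The following condition determines \<open>\<sigma>\<close> uniquely, because a surface is covered by countably
  many parametrized patches.\<close>

definition area_measure :: "(real^3) set \<Rightarrow> (real^3) measure \<Rightarrow> bool" where
  "area_measure M \<sigma> \<longleftrightarrow>
     space \<sigma> = M \<and> sets \<sigma> = sets (restrict_space borel M) \<and>
     (\<forall>U X B. local_param M U X \<and> B \<in> sets borel \<and> B \<subseteq> U \<longrightarrow>
        emeasure \<sigma> (X ` B) = (\<integral>\<^sup>+u\<in>B. ennreal (area_density X u) \<partial>lborel))"

text \<open>Laplace--Beltrami operator in coordinates: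
  \<open>(1 / \<surd>det g) \<Sum>\<^sub>i \<partial>\<^sub>i (\<surd>det g \<Sum>\<^sub>j g\<^sup>i\<^sup>j \<partial>\<^sub>j v)\<close>, the nonpositive sign convention.\<close>

definition LB :: "(real^2 \<Rightarrow> real^3) \<Rightarrow> (real^2 \<Rightarrow> real) \<Rightarrow> real^2 \<Rightarrow> real" where
  "LB X v u =
     (\<Sum>i\<in>UNIV. pd i (\<lambda>w. area_density X w *
                           (\<Sum>j\<in>UNIV. matrix_inv (induced_metric X w) $ i $ j * pd j v w)) u)
     / area_density X u"

definition smooth_on_surface :: "(real^3) set \<Rightarrow> (real^3 \<Rightarrow> real) \<Rightarrow> bool" where
  "smooth_on_surface M \<phi> \<longleftrightarrow> (\<forall>U X. local_param M U X \<longrightarrow> smooth_on (\<phi> \<circ> X) U)"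

text \<open>\<open>\<psi> = \<Delta>\<^sub>g \<phi>\<close> on \<open>M\<close>, for smooth \<open>\<phi>\<close>. As the coordinate expression at a point does not depend
  on the local parametrization around it, \<open>\<psi>\<close> is determined on \<open>M\<close> by any choice of them.\<close>

definition has_laplace_beltrami :: "(real^3) set \<Rightarrow> (real^3 \<Rightarrow> real) \<Rightarrow> (real^3 \<Rightarrow> real) \<Rightarrow> bool" where
  "has_laplace_beltrami M \<phi> \<psi> \<longleftrightarrow>
     (\<forall>P\<in>M. \<exists>U X u. local_param M U X \<and> u \<in> U \<and> X u = P \<and> \<psi> P = LB X (\<phi> \<circ> X) u)"

text \<open>\<open>-\<Delta>\<^sub>g G = \<delta>\<^sub>Q - 1 / V\<close> in the sense of distributions on \<open>M\<close>, where \<open>V\<close> is the total area.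
  All smooth functions are admissible tests, since the surfaces considered are compact.\<close>

definition green_function ::
  "(real^3) set \<Rightarrow> (real^3) measure \<Rightarrow> real^3 \<Rightarrow> (real^3 \<Rightarrow> real) \<Rightarrow> bool" where
  "green_function M \<sigma> Q G \<longleftrightarrow>
     integrable \<sigma> G \<and>
     (\<forall>\<phi> \<psi>. smooth_on_surface M \<phi> \<and> has_laplace_beltrami M \<phi> \<psi> \<longrightarrow>
        - (\<integral>P. G P * \<psi> P \<partial>\<sigma>) = \<phi> Q - (1 / measure \<sigma> M) * (\<integral>P. \<phi> P \<partial>\<sigma>))"


section \<open>Rotational invariance and round spheres\<close>

definition tangent_space :: "(real^3) set \<Rightarrow> real^3 \<Rightarrow> (real^3) set" where
  "tangent_space M P =
     {v. \<exists>U X u h. local_param M U X \<and> u \<in> U \<and> X u = P \<and> v = frechet_derivative X (at u) h}"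

text \<open>A rotation about the line \<open>Q + \<real> n\<close> is \<open>P \<mapsto> Q + R (P - Q)\<close> with \<open>R\<close> in \<open>SO(3)\<close> fixing \<open>n\<close>.\<close>

definition S1_invariant :: "(real^3) set \<Rightarrow> real^3 \<Rightarrow> bool" where
  "S1_invariant M Q \<longleftrightarrow>
     (\<exists>n. norm n = 1 \<and> (\<forall>v\<in>tangent_space M Q. n \<bullet> v = 0) \<and>
        (\<forall>R :: real^3^3. rotation_matrix R \<and> R *v n = n \<longrightarrow>
           (\<lambda>P. Q + R *v (P - Q)) ` M = M))"

definition round_sphere :: "(real^3) set \<Rightarrow> bool" where
  "round_sphere M \<longleftrightarrow> (\<exists>c r. r > 0 \<and> M = sphere c r)"

end

theory Submission
  imports Defs "HOL-Complex_Analysis.Conformal_Mappings"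
begin

text \<open>
  Near \<open>Q\<close> the surface is a graph \<open>x \<mapsto> f(\<bar>x\<bar>\<^sup>2)\<close> over its tangent plane. Testing the equation of the
  Green function against functions of \<open>t = \<bar>x\<bar>\<^sup>2\<close> that are constant near \<open>Q\<close>, and integrating by parts
  once, gives with \<open>S = \<surd>(1 + 4 t f'\<^sup>2)\<close>, \<open>W(t) = \<integral>\<^sub>0\<^sup>t S\<close> and \<open>\<kappa> = \<pi> / V\<close> the integro-differential equation
  \<open>t (1 + 2 f f') = (1 - \<kappa> W) (t + f\<^sup>2) S\<close>. Letting \<open>t \<rightarrow> 0\<close> shows \<open>f'(0)\<^sup>2 = \<kappa>\<close>. Two solutions with the same
  \<open>f'(0) \<noteq> 0\<close> coincide near \<open>0\<close>: linearised at \<open>t = 0\<close> the equation controls \<open>f'(0) \<delta>f'\<close> by terms that are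
  \<open>o(1)\<close> times the supremum of \<open>\<bar>\<delta>f'\<bar>\<close>. A sphere of radius \<open>1 / (2 \<bar>f'(0)\<bar>)\<close> is a solution, so \<open>M\<close> agrees with it
  near \<open>Q\<close>. By analyticity the set where \<open>M\<close> locally agrees with the sphere is relatively clopen, and
  testing with its indicator function shows that it has full measure, hence is all of \<open>M\<close>. Finally a
  nonempty compact surface contained in a sphere is the sphere, by invariance of domain.
\<close>

section \<open>Functions of class \<open>C\<^sup>k\<close>\<close>

text \<open>Two obstacles shape the proof. The first is that the equation degenerates at t = 0:
  after division by t, the derivative f' still carries a factor t, so Picard-Lindeloef does not
  apply at the initial point. Uniqueness rests on a cancellation instead: in the linearisation the
  coefficient of the variation of f / t tends to 2 a - 2 a = 0, where a = f'(0), while that of the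
  variation of f' tends to 2 a. The latter is nonzero because a^2 = \<kappa> = pi / V > 0. The
  radius 1 / (2 \<bar>a\<bar>) is the one for which 4 pi R^2 = V. The second obstacle is the choice
  of coordinates: a local parametrization must be real analytic, so the graph over the tangent plane
  would qualify only after a proof that the inverse of the projection is analytic. All calculations
  therefore stay in a given parametrization and pass to the graph by a change of variables. Likewise
  the profile f involves a square root at t = 0 and is handled only through f' on t > 0 and its
  limit at 0.\<close>

lemma pd_eqI: "(f has_derivative D) (at u) \<Longrightarrow> pd i f u = D (axis i 1)"
  unfolding pd_def using frechet_derivative_at by metis

lemma pd_cong_open:
  assumes "open U" "u \<in> U" "\<And>w. w \<in> U \<Longrightarrow> f w = g w"
  shows "pd i f u = pd i g u"
proof -
  \<comment> \<open>\<open>frechet_derivative\<close> is a choice among the derivatives, so equal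
    sets of derivatives give equal values of \<open>pd\<close> even where no derivative
    exists.\<close>
  have "(f has_derivative D) (at u) \<longleftrightarrow> (g has_derivative D) (at u)" for D
    using has_derivative_transform_within_open[OF _ assms(1,2)] assms(3) by metis
  then show ?thesis unfolding pd_def frechet_derivative_def by simp
qed

lemma Ck_on_Suc_open:
  assumes "open U"
  shows "Ck_on (Suc k) f U \<longleftrightarrow> (\<forall>u\<in>U. f differentiable (at u)) \<and> (\<forall>i. Ck_on k (pd i f) U)"
  using assms by (simp add: differentiable_on_eq_differentiable_at)

lemma Ck_on_cong:
  assumes "open U" "\<And>w. w \<in> U \<Longrightarrow> f w = g w"
  shows "Ck_on k f U \<longleftrightarrow> Ck_on k g U"
  using assms(2)
proof (induction k arbitrary: f g)
  case 0
  then show ?case by (simp cong: continuous_on_cong)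
next
  case (Suc k)
  have "f differentiable (at u) \<longleftrightarrow> g differentiable (at u)" if "u \<in> U" for u
    using has_derivative_transform_within_open[OF _ assms(1) that] Suc.prems
    unfolding differentiable_def by metis
  moreover have "Ck_on k (pd i f) U \<longleftrightarrow> Ck_on k (pd i g) U" for i
    by (rule Suc.IH) (use pd_cong_open[OF assms(1)] Suc.prems in metis)
  ultimately show ?case unfolding Ck_on_Suc_open[OF assms(1)] by simp
qed

lemma Ck_on_subset:
  assumes "open U" "open V" "V \<subseteq> U" "Ck_on k f U"
  shows "Ck_on k f V"
  using assms(4)
proof (induction k arbitrary: f)
  case 0
  then show ?case using assms(3) continuous_on_subset by auto
next
  case (Suc k)
  then show ?case
    using assms(3) unfolding Ck_on_Suc_open[OF assms(1)] Ck_on_Suc_open[OF assms(2)] by blast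
qed

text \<open>Continuity and differentiability are local, and the partial derivatives inherit this by
  induction. It serves functions given by different formulas on open pieces, such as a test function
  extended by zero.\<close>

lemma Ck_on_local:
  assumes "open U" "\<And>u. u \<in> U \<Longrightarrow> \<exists>V. open V \<and> u \<in> V \<and> Ck_on k f V"
  shows "Ck_on k f U"
  using assms(2)
proof (induction k arbitrary: f)
  case 0
  have "isCont f u" if u: "u \<in> U" for u
    using 0[OF u] by (auto simp: continuous_on_eq_continuous_at)
  then show ?case by (simp add: continuous_at_imp_continuous_on)
next
  case (Suc k)
  have d: "f differentiable (at u)" if u: "u \<in> U" for u
    using Suc.prems[OF u] by (metis Ck_on_Suc_open)
  have "Ck_on k (pd i f) U" for i
  proof (rule Suc.IH)
    fix u assume "u \<in> U"
    then obtain V where "open V" "u \<in> V" "Ck_on (Suc k) f V" using Suc.prems by blast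
    then show "\<exists>V. open V \<and> u \<in> V \<and> Ck_on k (pd i f) V"
      by (intro exI[of _ V]) simp
  qed
  with d show ?case unfolding Ck_on_Suc_open[OF assms(1)] by blast
qed

lemma Ck_on_imp_continuous_on: "open U \<Longrightarrow> Ck_on k f U \<Longrightarrow> continuous_on U f"
  by (cases k) (auto intro: differentiable_imp_continuous_on)

lemma Ck_on_SucD: "open U \<Longrightarrow> Ck_on (Suc k) f U \<Longrightarrow> Ck_on k f U"
proof (induction k arbitrary: f)
  case 0
  then show ?case using Ck_on_imp_continuous_on by fastforce
next
  case (Suc k)
  then show ?case unfolding Ck_on_Suc_open[OF Suc.prems(1)] by metis
qed

lemma pd_const: "pd i (\<lambda>_. c) u = 0"
  by (subst pd_eqI[OF has_derivative_const]) simp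

lemma Ck_on_const: "Ck_on k (\<lambda>_. c) U"
proof (induction k arbitrary: c)
  case (Suc k)
  have "pd i (\<lambda>_. c) = (\<lambda>_. 0)" for i :: 2 by (simp add: fun_eq_iff pd_const)
  with Suc show ?case by simp
qed simp

lemma pd_add:
  assumes "f differentiable (at u)" "g differentiable (at u)"
  shows "pd i (\<lambda>w. f w + g w) u = pd i f u + pd i g u"
  using has_derivative_add[OF assms[unfolded frechet_derivative_works]]
  by (subst pd_eqI) (auto simp: pd_def)

lemma Ck_on_add:
  assumes "open U" "Ck_on k f U" "Ck_on k g U"
  shows "Ck_on k (\<lambda>w. f w + g w) U"
  using assms(2,3)
proof (induction k arbitrary: f g)
  case 0 then show ?case by (auto intro: continuous_intros)
next
  case (Suc k)
  have "Ck_on k (pd i (\<lambda>w. f w + g w)) U" for i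
  proof -
    have "Ck_on k (\<lambda>w. pd i f w + pd i g w) U"
      using Suc by simp
    then show ?thesis
      by (rule Ck_on_cong[OF assms(1), THEN iffD1, rotated])
         (use Suc.prems in \<open>simp add: pd_add Ck_on_Suc_open[OF assms(1)] del: Ck_on.simps\<close>)
  qed
  then show ?case using Suc.prems unfolding Ck_on_Suc_open[OF assms(1)]
    by (auto intro: differentiable_add)
qed

lemma pd_linear:
  assumes "bounded_linear L" "f differentiable (at u)"
  shows "pd i (\<lambda>w. L (f w)) u = L (pd i f u)"
  using bounded_linear.has_derivative[OF assms(1) assms(2)[unfolded frechet_derivative_works]]
  by (subst pd_eqI) (auto simp: pd_def)

lemma Ck_on_linear:
  fixes f :: "real^2 \<Rightarrow> 'b::real_normed_vector" and L :: "'b \<Rightarrow> 'c::real_normed_vector"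
  assumes "open U" "bounded_linear L" "Ck_on k f U"
  shows "Ck_on k (\<lambda>w. L (f w)) U"
  using assms(3)
proof (induction k arbitrary: f)
  case 0 then show ?case by (simp add: bounded_linear.continuous_on[OF assms(2)])
next
  case (Suc k)
  have "Ck_on k (pd i (\<lambda>w. L (f w))) U" for i
  proof -
    have "Ck_on k (\<lambda>w. L (pd i f w)) U"
      using Suc by simp
    then show ?thesis
      by (rule Ck_on_cong[OF assms(1), THEN iffD1, rotated])
         (use Suc.prems in \<open>simp add: pd_linear[OF assms(2)] Ck_on_Suc_open[OF assms(1)] del: Ck_on.simps\<close>)
  qed
  moreover have "(\<lambda>w. L (f w)) differentiable (at u)" if "u \<in> U" for u
    using Suc.prems that bounded_linear.has_derivative[OF assms(2)]
    unfolding Ck_on_Suc_open[OF assms(1)] differentiable_def by blast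
  ultimately show ?case unfolding Ck_on_Suc_open[OF assms(1)] by auto
qed

lemma pd_mult:
  fixes f g :: "real^2 \<Rightarrow> real"
  assumes "f differentiable (at u)" "g differentiable (at u)"
  shows "pd i (\<lambda>w. f w * g w) u = pd i f u * g u + f u * pd i g u"
  using has_derivative_mult[OF assms[unfolded frechet_derivative_works]]
  by (subst pd_eqI) (auto simp: pd_def algebra_simps)

lemma Ck_on_mult:
  fixes f g :: "real^2 \<Rightarrow> real"
  assumes "open U" "Ck_on k f U" "Ck_on k g U"
  shows "Ck_on k (\<lambda>w. f w * g w) U"
  using assms(2,3)
proof (induction k arbitrary: f g)
  case 0 then show ?case by (auto intro: continuous_intros)
next
  case (Suc k)
  have "Ck_on k (pd i (\<lambda>w. f w * g w)) U" for i
  proof -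
    have "Ck_on k (\<lambda>w. pd i f w * g w + f w * pd i g w) U"
      using Suc Ck_on_SucD[OF assms(1)] by (intro Ck_on_add assms(1) Suc.IH) auto
    then show ?thesis
      by (rule Ck_on_cong[OF assms(1), THEN iffD1, rotated])
         (use Suc.prems in \<open>simp add: pd_mult Ck_on_Suc_open[OF assms(1)] del: Ck_on.simps\<close>)
  qed
  then show ?case using Suc.prems unfolding Ck_on_Suc_open[OF assms(1)]
    by (auto intro: differentiable_mult)
qed

lemma Ck_on_sum:
  assumes "open U" "finite I" "\<And>i. i \<in> I \<Longrightarrow> Ck_on k (f i) U"
  shows "Ck_on k (\<lambda>w. \<Sum>i\<in>I. f i w) U"
  using assms(2,3) by (induction) (auto simp: Ck_on_const intro!: Ck_on_add assms(1))

lemma Ck_on_minus: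
  "open U \<Longrightarrow> Ck_on k f U \<Longrightarrow> Ck_on k (\<lambda>w. - f w) U"
  by (rule Ck_on_linear[OF _ bounded_linear_minus[OF bounded_linear_ident]])

lemma Ck_on_diff:
  "open U \<Longrightarrow> Ck_on k f U \<Longrightarrow> Ck_on k g U \<Longrightarrow> Ck_on k (\<lambda>w. f w - g w) U"
  using Ck_on_add[of U k f "\<lambda>w. - g w"] Ck_on_minus[of U k g] by simp

lemma Ck_on_inner:
  fixes f g :: "real^2 \<Rightarrow> 'b::euclidean_space"
  assumes "open U" "Ck_on k f U" "Ck_on k g U"
  shows "Ck_on k (\<lambda>w. f w \<bullet> g w) U"
proof -
  have *: "Ck_on k (\<lambda>w. f w \<bullet> b) U" if "Ck_on k f U" for f and b :: 'b
    using Ck_on_linear[OF assms(1) bounded_linear_inner_left that] .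
  have "(\<lambda>w. f w \<bullet> g w) = (\<lambda>w. \<Sum>b\<in>Basis. (f w \<bullet> b) * (g w \<bullet> b))"
    by (intro ext) (rule euclidean_inner)
  moreover have "Ck_on k (\<lambda>w. \<Sum>b\<in>Basis. (f w \<bullet> b) * (g w \<bullet> b)) U"
    using assms by (intro Ck_on_sum Ck_on_mult *) auto
  ultimately show ?thesis by (simp only:)
qed

section \<open>Functions of class C^k of one real variable, composition, and bump functions\<close>

fun Ck_real :: "nat \<Rightarrow> (real \<Rightarrow> real) \<Rightarrow> real set \<Rightarrow> bool" where
  "Ck_real 0 h T \<longleftrightarrow> continuous_on T h"
| "Ck_real (Suc k) h T \<longleftrightarrow> (\<exists>h'. (\<forall>t\<in>T. (h has_real_derivative h' t) (at t)) \<and> Ck_real k h' T)"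

lemma Ck_real_SucI:
  "(\<And>t. t \<in> T \<Longrightarrow> (h has_real_derivative h' t) (at t)) \<Longrightarrow> Ck_real k h' T \<Longrightarrow> Ck_real (Suc k) h T"
  unfolding Ck_real.simps(2) by (intro exI[of _ h'] conjI ballI)

lemma pd_compose_real:
  fixes s :: "real^2 \<Rightarrow> real"
  assumes "(h has_real_derivative h') (at (s u))" "s differentiable (at u)"
  shows "pd i (\<lambda>w. h (s w)) u = h' * pd i s u"
    and "(\<lambda>w. h (s w)) differentiable (at u)"
proof -
  have "((\<lambda>w. h (s w)) has_derivative (\<lambda>x. h' * frechet_derivative s (at u) x)) (at u)"
    using diff_chain_at[OF assms(2)[unfolded frechet_derivative_works]
        assms(1)[unfolded has_field_derivative_def]] by (simp add: o_def)
  then show "pd i (\<lambda>w. h (s w)) u = h' * pd i s u" "(\<lambda>w. h (s w)) differentiable (at u)"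
    by (auto simp: pd_eqI differentiable_def pd_def[of i s])
qed

lemma Ck_real_imp_continuous_on: "Ck_real k h T \<Longrightarrow> continuous_on T h"
proof (cases k)
  case (Suc m)
  then show "Ck_real k h T \<Longrightarrow> continuous_on T h"
    using DERIV_isCont continuous_at_imp_continuous_on by (metis Ck_real.simps(2))
qed simp

lemma Ck_real_SucD: "Ck_real (Suc k) h T \<Longrightarrow> Ck_real k h T"
proof (induction k arbitrary: h)
  case 0
  then show ?case unfolding Ck_real.simps(1) by (rule Ck_real_imp_continuous_on)
next
  case (Suc k)
  obtain h' where "\<And>t. t \<in> T \<Longrightarrow> (h has_real_derivative h' t) (at t)" "Ck_real (Suc k) h' T"
    using Suc.prems unfolding Ck_real.simps(2)[of "Suc k"] by blast
  then show ?case using Suc.IH by (blast intro: Ck_real_SucI)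
qed

lemma Ck_on_compose_real:
  fixes s :: "real^2 \<Rightarrow> real"
  assumes "open U" "Ck_on k s U" "s ` U \<subseteq> T" "Ck_real k h T"
  shows "Ck_on k (\<lambda>w. h (s w)) U"
  using assms(2,4)
proof (induction k arbitrary: h)
  case 0
  then show ?case using assms(3) continuous_on_compose2[of T h U s] by simp
next
  case (Suc k)
  obtain h' where h': "\<And>t. t \<in> T \<Longrightarrow> (h has_real_derivative h' t) (at t)" "Ck_real k h' T"
    using Suc.prems by auto
  have d: "s differentiable (at u)" if "u \<in> U" for u
    using Suc.prems(1) that unfolding Ck_on_Suc_open[OF assms(1)] by blast
  have "Ck_on k (pd i (\<lambda>w. h (s w))) U" for i
  proof -
    have "Ck_on k (\<lambda>w. h' (s w) * pd i s w) U"
      using Suc h' Ck_on_SucD[OF assms(1)] Ck_on_Suc_open[OF assms(1)]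
      by (intro Ck_on_mult assms(1)) blast+
    then show ?thesis
      by (rule Ck_on_cong[OF assms(1), THEN iffD1, rotated])
         (simp add: pd_compose_real(1)[OF h'(1) d] subsetD[OF assms(3)])
  qed
  moreover have "(\<lambda>w. h (s w)) differentiable (at u)" if "u \<in> U" for u
    using pd_compose_real(2)[of h _ s u] h' d that assms(3) by blast
  ultimately show ?case unfolding Ck_on_Suc_open[OF assms(1)] by blast
qed

lemma Ck_real_add: "Ck_real k g T \<Longrightarrow> Ck_real k h T \<Longrightarrow> Ck_real k (\<lambda>t. g t + h t) T"
proof (induction k arbitrary: g h)
  case 0 then show ?case by (auto intro: continuous_intros)
next
  case (Suc k)
  obtain g' where g': "\<And>t. t \<in> T \<Longrightarrow> (g has_real_derivative g' t) (at t)" "Ck_real k g' T"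
    using Suc.prems(1) by auto
  obtain h' where h': "\<And>t. t \<in> T \<Longrightarrow> (h has_real_derivative h' t) (at t)" "Ck_real k h' T"
    using Suc.prems(2) by auto
  have "((\<lambda>t. g t + h t) has_real_derivative g' t + h' t) (at t)" if "t \<in> T" for t
    by (rule DERIV_add[OF g'(1) h'(1)]) (use that in auto)
  then show ?case using Suc.IH[OF g'(2) h'(2)] by (rule Ck_real_SucI)
qed

lemma Ck_real_mult: "Ck_real k g T \<Longrightarrow> Ck_real k h T \<Longrightarrow> Ck_real k (\<lambda>t. g t * h t) T"
proof (induction k arbitrary: g h)
  case 0 then show ?case by (auto intro: continuous_intros)
next
  case (Suc k)
  obtain g' where g': "\<And>t. t \<in> T \<Longrightarrow> (g has_real_derivative g' t) (at t)" "Ck_real k g' T"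
    using Suc.prems(1) by auto
  obtain h' where h': "\<And>t. t \<in> T \<Longrightarrow> (h has_real_derivative h' t) (at t)" "Ck_real k h' T"
    using Suc.prems(2) by auto
  have "((\<lambda>t. g t * h t) has_real_derivative g' t * h t + h' t * g t) (at t)" if "t \<in> T" for t
    by (rule DERIV_mult[OF g'(1) h'(1)]) (use that in auto)
  moreover have "Ck_real k (\<lambda>t. g' t * h t + h' t * g t) T"
    using Suc.prems[THEN Ck_real_SucD] by (intro Ck_real_add Suc.IH g' h')
  ultimately show ?case by (rule Ck_real_SucI)
qed

lemma Ck_real_const: "Ck_real k (\<lambda>_. c) T"
proof (induction k arbitrary: c)
  case (Suc k)
  have "((\<lambda>_. c) has_real_derivative 0) (at t)" for t :: real by simp
  then show ?case using Suc[of 0] by (rule Ck_real_SucI)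
qed simp

lemma Ck_real_affine: "Ck_real k h UNIV \<Longrightarrow> Ck_real k (\<lambda>t. h (a * t + b)) UNIV"
proof (induction k arbitrary: h)
  case 0
  then show ?case by (auto intro!: continuous_intros continuous_on_compose2[of UNIV h])
next
  case (Suc k)
  then obtain h' where h': "\<And>t. (h has_real_derivative h' t) (at t)" "Ck_real k h' UNIV"
    by auto
  have "((\<lambda>t. h (a * t + b)) has_real_derivative a * h' (a * t + b)) (at t)" for t
    by (rule DERIV_cong[OF DERIV_chain2[OF h'(1)]]) (rule derivative_eq_intros | simp)+
  moreover have "Ck_real k (\<lambda>t. a * h' (a * t + b)) UNIV"
    by (intro Ck_real_mult Ck_real_const Suc.IH h')
  ultimately show ?case by (rule Ck_real_SucI)
qed

text \<open>The induction runs over the family \<open>p(1/x) exp(-1/x)\<close>, which is closed under differentiation.\<close>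

lemma Ck_real_flat_poly:
  "Ck_real k (\<lambda>x. if x > 0 then poly p (1/x) * exp (- (1/x)) else 0) UNIV"
proof (induction k arbitrary: p)
  have lim0: "((\<lambda>x. poly p (1/x) * exp (- (1/x))) \<longlongrightarrow> 0) (at_right 0)" for p :: "real poly"
  proof -
    have *: "((\<lambda>y::real. poly p y / exp y) \<longlongrightarrow> 0) at_top"
    proof -
      have "((\<lambda>y::real. \<Sum>i\<le>degree p. coeff p i * (y ^ i / exp y)) \<longlongrightarrow> (\<Sum>i\<le>degree p. coeff p i * 0)) at_top"
        by (intro tendsto_intros tendsto_power_div_exp_0)
      then show ?thesis
        by (simp add: poly_altdef sum_divide_distrib)
    qed
    have "((\<lambda>x. poly p (inverse x) / exp (inverse x)) \<longlongrightarrow> 0) (at_right (0::real))"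
      by (rule filterlim_compose[OF * filterlim_inverse_at_top_right])
    then show ?thesis by (simp add: exp_minus field_simps)
  qed
  let ?E = "\<lambda>p::real poly. \<lambda>x::real. if x > 0 then poly p (1/x) * exp (- (1/x)) else 0"
  have D: "\<exists>q. \<forall>x. (?E p has_real_derivative ?E q x) (at x)" for p
  proof -
    \<comment> \<open>The derivative of p(1/x) exp(-1/x) is x^(-2) (p(1/x) - p'(1/x)) exp(-1/x);
      \<open>monom 1 2\<close> is the factor x^(-2), read as a polynomial in 1/x.\<close>
    define q where "q = monom 1 2 * (p - pderiv p)"
    have "(?E p has_real_derivative ?E q x) (at x)" for x
    proof -
      consider "x > 0" | "x < 0" | "x = 0" by linarith
      then show ?thesis
      proof cases
        case 1
        have "((\<lambda>x. poly p (1/x) * exp (- (1/x))) has_real_derivative ?E q x) (at x)"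
          using 1 unfolding q_def
          by (auto intro!: derivative_eq_intros DERIV_chain'[where g="poly p"] poly_DERIV
              simp: poly_monom field_simps power2_eq_square)
        then show ?thesis
          by (rule has_field_derivative_transform_within_open[of _ _ _ "{0<..}"]) (use 1 in auto)
      next
        case 2
        have "((\<lambda>x. 0) has_real_derivative ?E q x) (at x)" using 2 by simp
        then show ?thesis
          by (rule has_field_derivative_transform_within_open[of _ _ _ "{..<0}"]) (use 2 in auto)
      next
        case 3
        have "((\<lambda>h. (?E p (0 + h) - ?E p 0) / h) \<longlongrightarrow> 0) (at 0)"
        proof -
          \<comment> \<open>The difference quotient at 0 contributes a further factor 1/h, which
            turns \<open>p\<close> into \<open>pCons 0 p\<close>.\<close>
          have r: "((\<lambda>h. (?E p (0 + h) - ?E p 0) / h) \<longlongrightarrow> 0) (at_right 0)"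
            by (rule Lim_transform_eventually[OF lim0[of "pCons 0 p"]])
               (auto simp: eventually_at_filter)
          have l: "((\<lambda>h. (?E p (0 + h) - ?E p 0) / h) \<longlongrightarrow> 0) (at_left 0)"
            by (rule tendsto_eventually) (auto simp: eventually_at_filter)
          from l r show ?thesis by (simp add: filterlim_split_at_real)
        qed
        then show ?thesis using 3 unfolding DERIV_def by (simp only: if_False less_irrefl)
      qed
    qed
    then show ?thesis by blast
  qed
  {
    case 0
    obtain q where "\<And>x. (?E p has_real_derivative ?E q x) (at x)" using D by blast
    then show ?case
      unfolding Ck_real.simps(1) by (blast intro: continuous_at_imp_continuous_on DERIV_isCont)
  next
    case (Suc k)
    obtain q where "\<And>x. (?E p has_real_derivative ?E q x) (at x)" using D by blast
    then show ?case
      using Suc[of q] by (rule Ck_real_SucI)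
  }
qed

lemma smooth_bump:
  fixes \<alpha> \<beta> :: real
  assumes "\<alpha> < \<beta>"
  obtains b where "\<And>k. Ck_real k b UNIV" "\<And>t. \<alpha> < t \<Longrightarrow> t < \<beta> \<Longrightarrow> b t > 0"
    "\<And>t. t \<le> \<alpha> \<or> \<beta> \<le> t \<Longrightarrow> b t = 0"
proof
  define E where "E x = (if x > 0 then poly 1 (1/x) * exp (- (1/x)) else 0)" for x :: real
  define b where "b t = E (1 * t + (-\<alpha>)) * E ((-1) * t + \<beta>)" for t
  show "Ck_real k b UNIV" for k
    unfolding b_def E_def by (intro Ck_real_mult Ck_real_affine Ck_real_flat_poly)
  show "\<And>t. \<alpha> < t \<Longrightarrow> t < \<beta> \<Longrightarrow> b t > 0" "\<And>t. t \<le> \<alpha> \<or> \<beta> \<le> t \<Longrightarrow> b t = 0"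
    by (auto simp: b_def E_def)
qed

section \<open>Real analytic functions\<close>

text \<open>Summability at the single point (s, s) bounds all the terms there, which is a Cauchy
  estimate for the coefficients.\<close>

lemma double_series_coeff_bound:
  fixes a :: "nat \<times> nat \<Rightarrow> 'b::real_normed_vector"
  assumes "((\<lambda>(i, j). (s ^ i * s ^ j) *\<^sub>R a (i, j)) has_sum S) UNIV" "s > 0"
  obtains B where "B \<ge> 0" "\<And>i j. norm (a (i, j)) \<le> B / s ^ (i + j)"
proof -
  let ?f = "\<lambda>(i, j). (s ^ i * s ^ j) *\<^sub>R a (i, j)"
  have "((\<lambda>n. ?f (prod_decode n)) has_sum S) UNIV"
    using assms(1) has_sum_reindex_bij_betw[OF bij_prod_decode, of ?f S] by simp
  then have "summable (\<lambda>n. ?f (prod_decode n))"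
    using has_sum_imp_sums sums_summable by blast
  then have "Bseq (\<lambda>n. ?f (prod_decode n))"
    using summable_LIMSEQ_zero convergent_imp_Bseq convergentI by blast
  then obtain B where B: "B > 0" "\<And>n. norm (?f (prod_decode n)) \<le> B" by (auto simp: Bseq_def)
  have "norm (a (i, j)) \<le> B / s ^ (i + j)" for i j
    using B(2)[of "prod_encode (i, j)"] assms(2) by (simp add: field_simps power_add abs_mult)
  with B(1) show ?thesis using that[of B] by simp
qed

lemma real_analytic_bounded_coefficients:
  fixes f :: "real^2 \<Rightarrow> 'b::real_normed_vector"
  assumes f: "real_analytic_on f U" and u: "u \<in> U"
  shows "\<exists>a s B. s > 0 \<and> B \<ge> 0 \<and>
    (\<forall>w\<in>ball u s.
       ((\<lambda>(i, j). ((w $ 1 - u $ 1) ^ i * (w $ 2 - u $ 2) ^ j) *\<^sub>R a (i, j)) has_sum f w) UNIV) \<and>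
    (\<forall>i j. norm (a (i, j)) \<le> B / s ^ (i + j))"
proof -
  obtain a r where r: "r > 0" and A: "\<And>w. w \<in> ball u r \<Longrightarrow>
     ((\<lambda>(i, j). ((w $ 1 - u $ 1) ^ i * (w $ 2 - u $ 2) ^ j) *\<^sub>R a (i, j)) has_sum f w) UNIV"
    using f u unfolding real_analytic_on_def by blast
  \<comment> \<open>The Cauchy estimate is read off at the corner u + (s, s), whose distance from u
    is sqrt 2 times r / 2, hence less than r.\<close>
  define s where "s = r / 2"
  have s: "s > 0" using r by (simp add: s_def)
  have "dist u (u + vector [s, s]) < r"
  proof -
    have "dist u (u + vector [s, s]) = sqrt (s\<^sup>2 + s\<^sup>2)"
      by (simp add: dist_norm norm_vec_def L2_set_def UNIV_2)
    also have "\<dots> < sqrt (r\<^sup>2)"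
      using r by (intro real_sqrt_less_mono) (simp add: s_def power_divide)
    finally show ?thesis using r by simp
  qed
  then have "((\<lambda>(i, j). (s ^ i * s ^ j) *\<^sub>R a (i, j)) has_sum f (u + vector [s, s])) UNIV"
    using A[of "u + vector [s, s]"] by simp
  then obtain B where B: "B \<ge> 0" "\<And>i j. norm (a (i, j)) \<le> B / s ^ (i + j)"
    using double_series_coeff_bound s by blast
  have "((\<lambda>(i, j). ((w $ 1 - u $ 1) ^ i * (w $ 2 - u $ 2) ^ j) *\<^sub>R a (i, j)) has_sum f w) UNIV"
    if "w \<in> ball u s" for w
    by (rule A) (use that subset_ball[of s r u] r in \<open>auto simp: s_def\<close>)
  then show ?thesis using s B by (intro exI[of _ a] exI[of _ s] exI[of _ B]) blast
qed

section \<open>Termwise differentiation of double power series\<close>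

lemma summable_prod_decode:
  fixes c d :: "nat \<Rightarrow> real"
  assumes "summable c" "summable d" "\<And>i. c i \<ge> 0" "\<And>j. d j \<ge> 0"
  shows "summable (\<lambda>n. case prod_decode n of (i, j) \<Rightarrow> c i * d j)"
proof -
  have d: "(d has_sum suminf d) UNIV"
    using assms by (intro sums_nonneg_imp_has_sum summable_sums) auto
  have c: "c summable_on UNIV"
    using assms by (intro has_sum_imp_summable[OF sums_nonneg_imp_has_sum] summable_sums) auto
  have "(\<lambda>(i, j). c i * d j) summable_on Sigma UNIV (\<lambda>_. UNIV)"
  proof (rule summable_on_SigmaI)
    show "((\<lambda>y. case (x, y) of (i, j) \<Rightarrow> c i * d j) has_sum c x * suminf d) UNIV" for x
      using has_sum_cmult_right[OF d, of "c x"] by simp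
    show "(\<lambda>x. c x * suminf d) summable_on UNIV" using c by (rule summable_on_cmult_left)
  qed (use assms in auto)
  then obtain S where "((\<lambda>(i, j). c i * d j) has_sum S) UNIV" by (auto simp: summable_on_def)
  then have "((\<lambda>n. case prod_decode n of (i, j) \<Rightarrow> c i * d j) has_sum S) UNIV"
    using has_sum_reindex_bij_betw[OF bij_prod_decode, of "\<lambda>(i, j). c i * d j" S] by simp
  then show ?thesis using has_sum_imp_sums sums_summable by blast
qed

lemma summable_nat_half: "summable (\<lambda>i. real i * (1/2) ^ (i - 1))"
  using sums_summable[OF geometric_deriv_sums[of "1/2::real"]]
  by (subst summable_Suc_iff[symmetric]) simp

text \<open>Enumerating the double series by \<open>prod_decode\<close> reduces termwise
  differentiation to a theorem on simple series; at half the radius of the coefficient bound the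
  differentiated terms have summable majorants. The expansion of \<open>pd k f\<close> makes
  analyticity pass to partial derivatives, and C^k follows by induction.\<close>

lemma real_analytic_derivative:
  fixes f :: "real^2 \<Rightarrow> 'b::banach"
  assumes f: "real_analytic_on f U" and u: "u \<in> U"
  shows "f differentiable (at u) \<and> (\<exists>b r. r > 0 \<and> (\<forall>w\<in>ball u r.
     ((\<lambda>(i, j). ((w $ 1 - u $ 1) ^ i * (w $ 2 - u $ 2) ^ j) *\<^sub>R b (i, j)) has_sum pd k f w) UNIV))"
proof -
  obtain a s B where s: "s > 0" and B: "B \<ge> 0" "\<And>i j. norm (a (i, j)) \<le> B / s ^ (i + j)"
    and A: "\<And>w. w \<in> ball u s \<Longrightarrow>
      ((\<lambda>(i, j). ((w $ 1 - u $ 1) ^ i * (w $ 2 - u $ 2) ^ j) *\<^sub>R a (i, j)) has_sum f w) UNIV"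
    using real_analytic_bounded_coefficients[OF f u] by blast
  define \<rho> where "\<rho> = s / 2"
  have \<rho>: "\<rho> > 0" "\<rho> < s" using s by (auto simp: \<rho>_def)
  define I where "I n = fst (prod_decode n)" for n
  define J where "J n = snd (prod_decode n)" for n
  define x where "x w = w $ 1 - u $ 1" for w :: "real^2"
  define y where "y w = w $ 2 - u $ 2" for w :: "real^2"
  have xy: "\<bar>x w\<bar> \<le> \<rho>" "\<bar>y w\<bar> \<le> \<rho>" if "w \<in> ball u \<rho>" for w
    using that component_le_norm_cart[of "w - u" 1] component_le_norm_cart[of "w - u" 2]
    by (auto simp: x_def y_def dist_norm norm_minus_commute)
  define F where "F n w = (x w ^ I n * y w ^ J n) *\<^sub>R a (I n, J n)" for n w
  \<comment> \<open>The truncated exponents at i = 0 or j = 0 are harmless, since the factor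
    \<open>real i\<close> or \<open>real j\<close> is then 0.\<close>
  define p where "p k i j w = (if k = (1::2) then real i * x w ^ (i - 1) * y w ^ j
      else x w ^ i * (real j * y w ^ (j - 1)))" for k i j w
  define D where "D k n w = p k (I n) (J n) w *\<^sub>R a (I n, J n)" for k n w
  define F' where "F' n w h = (\<Sum>k\<in>UNIV. (h $ k) *\<^sub>R D k n w)" for n w and h :: "real^2"
  have derF: "(F n has_derivative F' n w) (at w within ball u \<rho>)" for n w
  proof -
    have "((\<lambda>w. x w ^ I n * y w ^ J n) has_derivative
        (\<lambda>h. h $ 1 * p 1 (I n) (J n) w + h $ 2 * p 2 (I n) (J n) w)) (at w within ball u \<rho>)"
    proof -
      have "(x has_derivative (\<lambda>h. h $ 1)) (at w within ball u \<rho>)"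
        "(y has_derivative (\<lambda>h. h $ 2)) (at w within ball u \<rho>)"
        unfolding x_def[abs_def] y_def[abs_def]
        by (auto intro!: derivative_eq_intros bounded_linear_imp_has_derivative bounded_linear_vec_nth)
      then show ?thesis
        unfolding p_def by (auto intro!: derivative_eq_intros simp: algebra_simps fun_eq_iff)
    qed
    from has_derivative_scaleR_left[OF this, of "a (I n, J n)"]
    show ?thesis by (simp add: F_def[abs_def] F'_def[abs_def] D_def UNIV_2 scaleR_add_left)
  qed
  \<comment> \<open>With \<rho> = s / 2 the powers combine to \<rho>^(i - 1 + j) B / s^(i + j) = (B
    / s) (1/2)^(i - 1 + j) for k = 1, and symmetrically for k = 2.\<close>
  define M where "M k n = (case prod_decode n of (i, j) \<Rightarrow>
     (if k = (1::2) then (B / s) * (real i * (1/2)^(i-1)) * (1/2)^j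
      else (B / s) * (1/2)^i * (real j * (1/2)^(j-1))))" for k n
  have sumM: "summable (M k)" for k
  proof (cases "k = 1")
    case True
    show ?thesis unfolding M_def using True
        summable_prod_decode[of "\<lambda>i. (B / s) * (real i * (1/2)^(i-1))" "\<lambda>j. (1/2)^j"]
        summable_mult[OF summable_nat_half, of "B / s"] B s by simp
  next
    case False
    show ?thesis unfolding M_def using False
        summable_prod_decode[of "\<lambda>i. (B / s) * (1/2)^i" "\<lambda>j. real j * (1/2)^(j-1)"]
        summable_mult[OF summable_geometric[of "1/2::real"], of "B / s"] summable_nat_half B s by simp
  qed
  have key: "real i * \<rho> ^ (i - 1) * \<rho> ^ j * (B / s ^ (i + j)) = (B / s) * (real i * (1/2)^(i-1)) * (1/2)^j" for i j
    using s by (cases i) (auto simp: \<rho>_def power_divide power_add field_simps)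
  have DM: "norm (D k n w) \<le> M k n" if w: "w \<in> ball u \<rho>" for k n w
  proof -
    obtain i j where ij: "prod_decode n = (i, j)" by fastforce
    have "norm (D k n w) = \<bar>p k i j w\<bar> * norm (a (i, j))" by (simp add: D_def I_def J_def ij)
    also have "\<dots> \<le> M k n"
    proof (cases "k = 1")
      case True
      have "\<bar>p k i j w\<bar> = real i * \<bar>x w\<bar> ^ (i - 1) * \<bar>y w\<bar> ^ j"
        using True by (simp add: p_def abs_mult power_abs)
      also have "\<dots> \<le> real i * \<rho> ^ (i - 1) * \<rho> ^ j"
        using xy[OF w] \<rho> by (intro mult_mono power_mono) auto
      finally have "\<bar>p k i j w\<bar> * norm (a (i, j)) \<le> real i * \<rho> ^ (i - 1) * \<rho> ^ j * (B / s ^ (i + j))"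
        using B \<rho> by (intro mult_mono) auto
      then show ?thesis using True key[of i j] by (simp add: M_def ij)
    next
      case False
      have "\<bar>p k i j w\<bar> = \<bar>x w\<bar> ^ i * (real j * \<bar>y w\<bar> ^ (j - 1))"
        using False by (simp add: p_def abs_mult power_abs)
      also have "\<dots> \<le> \<rho> ^ i * (real j * \<rho> ^ (j - 1))"
        using xy[OF w] \<rho> by (intro mult_mono power_mono) auto
      finally have "\<bar>p k i j w\<bar> * norm (a (i, j)) \<le> \<rho> ^ i * (real j * \<rho> ^ (j - 1)) * (B / s ^ (i + j))"
        using B \<rho> by (intro mult_mono) auto
      then show ?thesis using False key[of j i] by (simp add: M_def ij mult_ac add.commute)
    qed
    finally show ?thesis .
  qed
  define P where "P k w = (\<Sum>n. D k n w)" for k w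
  have ulim: "uniform_limit (ball u \<rho>) (\<lambda>n w. \<Sum>i<n. D k i w) (P k) sequentially" for k
    unfolding P_def by (rule Weierstrass_m_test_ev[OF _ sumM[of k]]) (use DM in auto)
  define G' where "G' w h = (\<Sum>k\<in>UNIV. (h $ k) *\<^sub>R P k w)" for w and h :: "real^2"
  have Fsums: "(\<lambda>n. F n w) sums f w" if "w \<in> ball u \<rho>" for w
  proof -
    have "((\<lambda>n. F n w) has_sum f w) UNIV"
      using A[of w] that \<rho> has_sum_reindex_bij_betw[OF bij_prod_decode,
        of "\<lambda>(i, j). (x w ^ i * y w ^ j) *\<^sub>R a (i, j)" "f w"]
      by (simp add: F_def I_def J_def x_def y_def case_prod_beta)
    then show ?thesis by (rule has_sum_imp_sums)
  qed
  have uin: "u \<in> ball u \<rho>" using \<rho> by simp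
  have "\<exists>g. \<forall>w\<in>ball u \<rho>. (\<lambda>n. F n w) sums g w \<and> (g has_derivative G' w) (at w within ball u \<rho>)"
  proof (rule has_derivative_series[OF convex_ball derF _ uin Fsums[OF uin]])
    fix e :: real assume e: "e > 0"
    \<comment> \<open>Two partial derivatives, each within e / 2 of its limit, add up to the
      required e.\<close>
    have "eventually (\<lambda>n. \<forall>w\<in>ball u \<rho>. norm ((\<Sum>i<n. D k i w) - P k w) < e / 2) sequentially" for k
      using uniform_limitD[OF ulim[of k], of "e / 2"] e by (simp add: dist_norm)
    then have "eventually (\<lambda>n. \<forall>k. \<forall>w\<in>ball u \<rho>. norm ((\<Sum>i<n. D k i w) - P k w) < e / 2) sequentially"
      by (simp add: forall_2 eventually_conj_iff)
    then show "\<forall>\<^sub>F n in sequentially. \<forall>w\<in>ball u \<rho>. \<forall>h. norm ((\<Sum>i<n. F' i w h) - G' w h) \<le> e * norm h"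
    proof (eventually_elim, intro ballI allI)
      fix n w and h :: "real^2"
      assume *: "\<forall>k. \<forall>w\<in>ball u \<rho>. norm ((\<Sum>i<n. D k i w) - P k w) < e / 2" and w: "w \<in> ball u \<rho>"
      have "(\<Sum>i<n. F' i w h) = (\<Sum>k\<in>UNIV. (h $ k) *\<^sub>R (\<Sum>i<n. D k i w))"
        unfolding F'_def by (subst sum.swap) (simp add: scaleR_sum_right)
      then have "(\<Sum>i<n. F' i w h) - G' w h = (\<Sum>k\<in>UNIV. (h $ k) *\<^sub>R ((\<Sum>i<n. D k i w) - P k w))"
        by (simp add: G'_def sum_subtractf scaleR_diff_right)
      also have "norm \<dots> \<le> (\<Sum>k\<in>(UNIV::2 set). norm h * (e / 2))"
      proof (rule sum_norm_le)
        fix k :: 2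
        have "\<bar>h $ k\<bar> * norm ((\<Sum>i<n. D k i w) - P k w) \<le> norm h * (e / 2)"
          using * w by (intro mult_mono component_le_norm_cart) (auto intro: less_imp_le)
        then show "norm ((h $ k) *\<^sub>R ((\<Sum>i<n. D k i w) - P k w)) \<le> norm h * (e / 2)" by simp
      qed
      finally show "norm ((\<Sum>i<n. F' i w h) - G' w h) \<le> e * norm h" by (simp add: mult.commute)
    qed
  qed
  then obtain g where g: "\<And>w. w \<in> ball u \<rho> \<Longrightarrow> (\<lambda>n. F n w) sums g w"
    "\<And>w. w \<in> ball u \<rho> \<Longrightarrow> (g has_derivative G' w) (at w within ball u \<rho>)" by blast
  have gf: "g w = f w" if "w \<in> ball u \<rho>" for w
    using sums_unique2[OF g(1)[OF that] Fsums[OF that]] .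
  have derf: "(f has_derivative G' w) (at w)" if "w \<in> ball u \<rho>" for w
  proof (rule has_derivative_transform_within_open[of g _ _ _ "ball u \<rho>"])
    show "(g has_derivative G' w) (at w)" using g(2)[OF that] that at_within_open[of w "ball u \<rho>"] by simp
  qed (use that gf in auto)
  have pdf: "pd k f w = P k w" if "w \<in> ball u \<rho>" for w k
    unfolding pd_eqI[OF derf[OF that]] G'_def axis_def using exhaust_2[of k] by (auto simp: UNIV_2)
  have hs: "((\<lambda>(i, j). p k i j w *\<^sub>R a (i, j)) has_sum P k w) UNIV" if w: "w \<in> ball u \<rho>" for w k
  proof -
    have sn: "summable (\<lambda>n. norm (D k n w))"
      by (rule summable_comparison_test'[OF sumM[of k]]) (use DM w in auto)
    have "((\<lambda>n. D k n w) has_sum P k w) UNIV"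
      unfolding P_def
      by (rule norm_summable_imp_has_sum[OF sn summable_sums[OF summable_norm_cancel[OF sn]]])
    then show ?thesis
      using has_sum_reindex_bij_betw[OF bij_prod_decode, of "\<lambda>(i, j). p k i j w *\<^sub>R a (i, j)" "P k w"]
      by (simp add: D_def I_def J_def case_prod_beta)
  qed
  \<comment> \<open>Differentiation lowers one exponent. The terms with exponent 0 in that variable
    vanish, so the sum may be restricted to the image of the shift and then reindexed.\<close>
  define b where "b = (\<lambda>(i, j). if k = 1 then real (i + 1) *\<^sub>R a (i + 1, j) else real (j + 1) *\<^sub>R a (i, j + 1))"
  have "((\<lambda>(i, j). ((w $ 1 - u $ 1) ^ i * (w $ 2 - u $ 2) ^ j) *\<^sub>R b (i, j)) has_sum pd k f w) UNIV"
    if w: "w \<in> ball u \<rho>" for w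
  proof (cases "k = 1")
    case True
    have "((\<lambda>(i, j). p k i j w *\<^sub>R a (i, j)) has_sum P k w) ((\<lambda>(i, j). (Suc i, j)) ` UNIV)"
    proof (rule has_sum_cong_neutral[THEN iffD1, OF _ _ _ hs[OF w, of k]])
      fix z :: "nat \<times> nat" assume "z \<in> UNIV - (\<lambda>(i, j). (Suc i, j)) ` UNIV"
      then have "fst z = 0" by (cases z; cases "fst z") (auto simp: image_iff)
      then show "(case z of (i, j) \<Rightarrow> p k i j w *\<^sub>R a (i, j)) = 0"
        using True by (cases z) (simp add: p_def)
    qed auto
    moreover have "inj (\<lambda>(i::nat, j::nat). (Suc i, j))" by (auto simp: inj_def)
    ultimately show ?thesis
      by (subst (asm) has_sum_reindex)
         (auto simp: o_def p_def b_def True x_def y_def case_prod_unfold pdf[OF w] mult_ac)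
  next
    case False
    have "((\<lambda>(i, j). p k i j w *\<^sub>R a (i, j)) has_sum P k w) ((\<lambda>(i, j). (i, Suc j)) ` UNIV)"
    proof (rule has_sum_cong_neutral[THEN iffD1, OF _ _ _ hs[OF w, of k]])
      fix z :: "nat \<times> nat" assume "z \<in> UNIV - (\<lambda>(i, j). (i, Suc j)) ` UNIV"
      then have "snd z = 0" by (cases z; cases "snd z") (auto simp: image_iff)
      then show "(case z of (i, j) \<Rightarrow> p k i j w *\<^sub>R a (i, j)) = 0"
        using False by (cases z) (simp add: p_def)
    qed auto
    moreover have "inj (\<lambda>(i::nat, j::nat). (i, Suc j))" by (auto simp: inj_def)
    ultimately show ?thesis
      by (subst (asm) has_sum_reindex)
         (auto simp: o_def p_def b_def False x_def y_def case_prod_unfold pdf[OF w] mult_ac)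
  qed
  moreover have "f differentiable (at u)" using derf[of u] \<rho> differentiableI by force
  ultimately show ?thesis using \<rho>(1) by blast
qed

lemma real_analytic_imp_Ck_on:
  fixes f :: "real^2 \<Rightarrow> 'b::banach"
  assumes "open U" "real_analytic_on f U"
  shows "Ck_on k f U"
  using assms(2)
proof (induction k arbitrary: f)
  case 0
  then show ?case using real_analytic_derivative differentiable_imp_continuous_within
    by (metis Ck_on.simps(1) continuous_at_imp_continuous_on)
next
  case (Suc k)
  have "real_analytic_on (pd i f) U" for i
    unfolding real_analytic_on_def using real_analytic_derivative[OF Suc.prems] by blast
  then show ?case
    unfolding Ck_on_Suc_open[OF assms(1)] using Suc real_analytic_derivative by blast
qed

text \<open>The preimage of a polydisc about u under the complexified line through v and w. It is
  open and convex, so the identity theorem can start from a piece of the real segment.\<close>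

definition complex_line_domain :: "real^2 \<Rightarrow> real \<Rightarrow> real^2 \<Rightarrow> real^2 \<Rightarrow> complex set" where
  "complex_line_domain u \<rho> v w =
     {s. cmod (of_real (v $ 1 - u $ 1) + s * of_real (w $ 1 - v $ 1)) < \<rho> \<and>
         cmod (of_real (v $ 2 - u $ 2) + s * of_real (w $ 2 - v $ 2)) < \<rho>}"

text \<open>Near \<open>u\<close> the components of \<open>f\<close> extend holomorphically along every real line, not only along
  the lines through \<open>u\<close>: substitute a complex parameter into the double power series.\<close>

lemma real_analytic_extends_along_lines:
  fixes f :: "real^2 \<Rightarrow> real"
  assumes f: "real_analytic_on f U" and u: "u \<in> U"
  obtains \<rho> where "\<rho> > 0"
    "\<And>v w. v \<in> ball u \<rho> \<Longrightarrow> w \<in> ball u \<rho> \<Longrightarrow> \<exists>F. F holomorphic_on complex_line_domain u \<rho> v w \<and>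
       (\<forall>t\<in>{0..1}. F (of_real t) = of_real (f (v + t *\<^sub>R (w - v))))"
proof -
  obtain a s B where s: "s > 0" and B: "B \<ge> 0" "\<And>i j. norm (a (i, j)) \<le> B / s ^ (i + j)"
    and A: "\<And>w. w \<in> ball u s \<Longrightarrow>
      ((\<lambda>(i, j). ((w $ 1 - u $ 1) ^ i * (w $ 2 - u $ 2) ^ j) *\<^sub>R a (i, j)) has_sum f w) UNIV"
    using real_analytic_bounded_coefficients[OF f u] by blast
  define \<rho> where "\<rho> = s / 2"
  have \<rho>: "\<rho> > 0" "\<rho> < s" using s by (auto simp: \<rho>_def)
  have "\<exists>F. F holomorphic_on complex_line_domain u \<rho> v w \<and>
       (\<forall>t\<in>{0..1}. F (of_real t) = of_real (f (v + t *\<^sub>R (w - v))))"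
    if vw: "v \<in> ball u \<rho>" "w \<in> ball u \<rho>" for v w
  proof -
    define x :: "complex \<Rightarrow> complex" where "x s = of_real (v $ 1 - u $ 1) + s * of_real (w $ 1 - v $ 1)" for s
    define y :: "complex \<Rightarrow> complex" where "y s = of_real (v $ 2 - u $ 2) + s * of_real (w $ 2 - v $ 2)" for s
    let ?\<Omega> = "{s. cmod (x s) < \<rho> \<and> cmod (y s) < \<rho>}"
    define T where "T n s = (case prod_decode n of (i, j) \<Rightarrow> x s ^ i * y s ^ j * of_real (a (i, j)))" for n s
    define M where "M n = (case prod_decode n of (i, j) \<Rightarrow> (B * (1/2)^i) * (1/2)^j)" for n
    have sumM: "summable M"
      unfolding M_def using B summable_prod_decode[of "\<lambda>i. B * (1/2)^i" "\<lambda>j. (1/2)^j"]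
        summable_mult[OF summable_geometric[of "1/2::real"], of B] by simp
    have TM: "norm (T n z) \<le> M n" if z: "z \<in> ?\<Omega>" for n z
    proof -
      obtain i j where ij: "prod_decode n = (i, j)" by fastforce
      have "norm (T n z) = cmod (x z) ^ i * cmod (y z) ^ j * \<bar>a (i, j)\<bar>"
        by (simp add: T_def ij norm_mult norm_power)
      also have "\<dots> \<le> \<rho> ^ i * \<rho> ^ j * (B / s ^ (i + j))"
        using z \<rho> B(1) B(2)[of i j] by (intro mult_mono power_mono) auto
      also have "\<dots> = M n" using s by (simp add: M_def ij \<rho>_def power_divide power_add field_simps)
      finally show ?thesis .
    qed
    define F where "F z = (\<Sum>n. T n z)" for z
    have ulim: "uniform_limit ?\<Omega> (\<lambda>n z. \<Sum>i<n. T i z) F sequentially"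
      unfolding F_def by (rule Weierstrass_m_test_ev[OF _ sumM]) (use TM in auto)
    have op: "open ?\<Omega>"
      unfolding x_def y_def
      by (intro open_Collect_conj open_Collect_less continuous_intros)
    have "F holomorphic_on ?\<Omega>"
    proof (rule holomorphic_uniform_sequence[OF op])
      show "(\<lambda>z. \<Sum>i<n. T i z) holomorphic_on ?\<Omega>" for n
        unfolding T_def x_def y_def by (auto simp: case_prod_beta intro!: holomorphic_intros)
      fix z assume "z \<in> ?\<Omega>"
      then obtain d where d: "d > 0" "cball z d \<subseteq> ?\<Omega>" using op open_contains_cball by blast
      show "\<exists>d>0. cball z d \<subseteq> ?\<Omega> \<and> uniform_limit (cball z d) (\<lambda>n z. \<Sum>i<n. T i z) F sequentially"
        using d uniform_limit_on_subset[OF ulim d(2)] by blast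
    qed
    moreover have "F (of_real t) = of_real (f (v + t *\<^sub>R (w - v)))" if t: "t \<in> {0..1}" for t
    proof -
      let ?p = "v + t *\<^sub>R (w - v)"
      have "?p = (1 - t) *\<^sub>R v + t *\<^sub>R w" by (simp add: algebra_simps)
      then have p: "?p \<in> ball u \<rho>" using t vw convexD_alt[OF convex_ball, of v u \<rho> w t] by auto
      have "((\<lambda>(i, j). ((?p $ 1 - u $ 1) ^ i * (?p $ 2 - u $ 2) ^ j) *\<^sub>R a (i, j)) has_sum f ?p) UNIV"
        using A[of ?p] p \<rho> by auto
      from has_sum_of_real[OF this, where 'a=complex]
      have "((\<lambda>(i, j). x (of_real t) ^ i * y (of_real t) ^ j * of_real (a (i, j))) has_sum of_real (f ?p)) UNIV"
        by (simp add: x_def y_def case_prod_unfold algebra_simps)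
      then have "((\<lambda>n. T n (of_real t)) has_sum of_real (f ?p)) UNIV"
        using has_sum_reindex_bij_betw[OF bij_prod_decode,
          of "\<lambda>(i, j). x (of_real t) ^ i * y (of_real t) ^ j * of_real (a (i, j))" "of_real (f ?p)"]
        by (simp add: T_def)
      then show ?thesis unfolding F_def using has_sum_imp_sums sums_unique by metis
    qed
    ultimately show ?thesis unfolding x_def y_def complex_line_domain_def by blast
  qed
  with \<rho>(1) show ?thesis using that by blast
qed

lemma real_analytic_component:
  fixes X :: "real^2 \<Rightarrow> real^'n"
  assumes "real_analytic_on X U"
  shows "real_analytic_on (\<lambda>u. X u $ k) U"
  unfolding real_analytic_on_def
proof
  fix u assume "u \<in> U"
  then obtain a r where r: "r > 0" and A: "\<And>w. w \<in> ball u r \<Longrightarrow>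
     ((\<lambda>(i, j). ((w $ 1 - u $ 1) ^ i * (w $ 2 - u $ 2) ^ j) *\<^sub>R a (i, j)) has_sum X w) UNIV"
    using assms unfolding real_analytic_on_def by blast
  have "((\<lambda>(i, j). ((w $ 1 - u $ 1) ^ i * (w $ 2 - u $ 2) ^ j) *\<^sub>R (a (i, j) $ k)) has_sum X w $ k) UNIV"
    if "w \<in> ball u r" for w
    using has_sum_bounded_linear[OF bounded_linear_vec_nth A[OF that], of k]
    by (simp add: o_def case_prod_unfold)
  then show "\<exists>a r. r > 0 \<and> (\<forall>w\<in>ball u r.
      ((\<lambda>(i, j). ((w $ 1 - u $ 1) ^ i * (w $ 2 - u $ 2) ^ j) *\<^sub>R a (i, j)) has_sum X w $ k) UNIV)"
    using r by (intro exI[of _ "\<lambda>z. a z $ k"] exI[of _ r]) auto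
qed

text \<open>Restrict \<bar>X - c\<bar>^2 - R^2 to the segment from a point v of V to w. It extends
  holomorphically in the parameter and vanishes for small positive parameters, so it vanishes at
  parameter 1, that is, at w. Since V may meet the ball away from its centre, extensions along all
  segments are required and not only along rays from u.\<close>

lemma real_analytic_sphere_propagation:
  fixes X :: "real^2 \<Rightarrow> real^3"
  assumes X: "real_analytic_on X U" and u: "u \<in> U" and R: "R > 0"
  obtains \<rho> where "\<rho> > 0"
    "\<And>V. open V \<Longrightarrow> V \<inter> ball u \<rho> \<noteq> {} \<Longrightarrow> X ` V \<subseteq> sphere c R \<Longrightarrow> X ` ball u \<rho> \<subseteq> sphere c R"
proof -
  have "\<exists>\<rho>>0. \<forall>v\<in>ball u \<rho>. \<forall>w\<in>ball u \<rho>. \<exists>F. F holomorphic_on complex_line_domain u \<rho> v w \<and>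
       (\<forall>t\<in>{0..1}. F (of_real t) = of_real (X (v + t *\<^sub>R (w - v)) $ k))" for k
    by (rule real_analytic_extends_along_lines[OF real_analytic_component[OF X, of k] u]) blast
  then obtain \<rho>' where \<rho>': "\<And>k. \<rho>' k > 0" "\<And>k v w. v \<in> ball u (\<rho>' k) \<Longrightarrow> w \<in> ball u (\<rho>' k) \<Longrightarrow>
       \<exists>F. F holomorphic_on complex_line_domain u (\<rho>' k) v w \<and>
       (\<forall>t\<in>{0..1}. F (of_real t) = of_real (X (v + t *\<^sub>R (w - v)) $ k))" by metis
  \<comment> \<open>Each of the three components comes with its own radius; the smallest serves
    all.\<close>
  define \<rho> where "\<rho> = Min (range \<rho>')"
  have \<rho>: "\<rho> > 0" "\<And>k. \<rho> \<le> \<rho>' k" using \<rho>'(1) by (auto simp: \<rho>_def)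
  have "X w \<in> sphere c R" if V: "open V" "V \<inter> ball u \<rho> \<noteq> {}" "X ` V \<subseteq> sphere c R" and w: "w \<in> ball u \<rho>" for V w
  proof -
    obtain v where v: "v \<in> V" "v \<in> ball u \<rho>" using V by auto
    let ?\<Omega> = "complex_line_domain u \<rho> v w"
    have "\<exists>F. F holomorphic_on ?\<Omega> \<and> (\<forall>t\<in>{0..1}. F (of_real t) = of_real (X (v + t *\<^sub>R (w - v)) $ k))" for k
    proof -
      have "v \<in> ball u (\<rho>' k)" "w \<in> ball u (\<rho>' k)" using v w \<rho>(2)[of k] by auto
      from \<rho>'(2)[OF this] obtain F where F: "F holomorphic_on complex_line_domain u (\<rho>' k) v w"
        "\<forall>t\<in>{0..1}. F (of_real t) = of_real (X (v + t *\<^sub>R (w - v)) $ k)" by blast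
      have "F holomorphic_on ?\<Omega>"
        by (rule holomorphic_on_subset[OF F(1)]) (use \<rho>(2)[of k] in \<open>auto simp: complex_line_domain_def\<close>)
      with F(2) show ?thesis by blast
    qed
    then obtain F where F: "\<And>k. F k holomorphic_on ?\<Omega>"
      "\<And>k t. t \<in> {0..1} \<Longrightarrow> F k (of_real t) = of_real (X (v + t *\<^sub>R (w - v)) $ k)" by metis
    \<comment> \<open>Squares without conjugation keep p holomorphic; on real parameters p is the
      squared distance to c minus R^2.\<close>
    define p where "p z = (\<Sum>k\<in>UNIV. (F k z - of_real (c $ k))\<^sup>2) - of_real (R\<^sup>2)" for z
    have hol: "p holomorphic_on ?\<Omega>"
      unfolding p_def by (intro holomorphic_intros F)
    have op: "open ?\<Omega>"
      unfolding complex_line_domain_def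
      by (intro open_Collect_conj open_Collect_less continuous_intros)
    have conv: "convex ?\<Omega>"
    proof -
      have "convex ((\<lambda>z. of_real b + z * of_real d) -` ball (0::complex) \<rho>)" for b d
      proof (rule convexI)
        fix z1 z2 :: complex and s t :: real
        assume *: "z1 \<in> (\<lambda>z. of_real b + z * of_real d) -` ball 0 \<rho>"
          "z2 \<in> (\<lambda>z. of_real b + z * of_real d) -` ball 0 \<rho>" "0 \<le> s" "0 \<le> t" "s + t = 1"
        have "of_real b + (s *\<^sub>R z1 + t *\<^sub>R z2) * of_real d =
          s *\<^sub>R (of_real b + z1 * of_real d) + t *\<^sub>R (of_real b + z2 * of_real d)"
          using arg_cong[OF *(5), of complex_of_real]
          by (simp add: algebra_simps scaleR_conv_of_real flip: distrib_left distrib_right of_real_add)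
        with convexD[OF convex_ball *(1,2)[unfolded vimage_eq] *(3-5)]
        show "s *\<^sub>R z1 + t *\<^sub>R z2 \<in> (\<lambda>z. of_real b + z * of_real d) -` ball 0 \<rho>" by simp
      qed
      moreover have "?\<Omega> = (\<lambda>z. of_real (v $ 1 - u $ 1) + z * of_real (w $ 1 - v $ 1)) -` ball 0 \<rho> \<inter>
          (\<lambda>z. of_real (v $ 2 - u $ 2) + z * of_real (w $ 2 - v $ 2)) -` ball 0 \<rho>"
        by (auto simp: complex_line_domain_def)
      ultimately show ?thesis using convex_Int by metis
    qed
    have comp: "\<bar>z $ k - u $ k\<bar> < \<rho>" if "z \<in> ball u \<rho>" for z k
      using that component_le_norm_cart[of "z - u" k] by (auto simp: dist_norm norm_minus_commute)
    have preal: "p (of_real t) = of_real ((dist c (X (v + t *\<^sub>R (w - v))))\<^sup>2 - R\<^sup>2)" if "t \<in> {0..1}" for t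
      unfolding p_def using F(2)[OF that]
      by (simp add: dist_norm norm_vec_def L2_set_def sum_nonneg power2_commute[of "c $ _"])
    have inO: "of_real t \<in> ?\<Omega>" if "t \<in> {0..1}" for t
    proof -
      let ?p = "v + t *\<^sub>R (w - v)"
      have "?p = (1 - t) *\<^sub>R v + t *\<^sub>R w" by (simp add: algebra_simps)
      then have "?p \<in> ball u \<rho>" using that v w convexD_alt[OF convex_ball, of v u \<rho> w t] by auto
      from comp[OF this] have "\<bar>v $ k - u $ k + t * (w $ k - v $ k)\<bar> < \<rho>" for k
        by (simp add: algebra_simps)
      then have "cmod (of_real (v $ k - u $ k + t * (w $ k - v $ k))) < \<rho>" for k
        by (simp only: norm_of_real)
      then show ?thesis by (simp add: complex_line_domain_def del: norm_of_real)
    qed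
    have "((\<lambda>t. v + t *\<^sub>R (w - v)) \<longlongrightarrow> v + 0 *\<^sub>R (w - v)) (at_right (0::real))"
      by (intro tendsto_intros)
    then have "eventually (\<lambda>t. v + t *\<^sub>R (w - v) \<in> V) (at_right (0::real))"
      using V(1) v(1) by (auto dest: topological_tendstoD)
    then obtain e where e: "e > 0" "\<And>t. 0 < t \<Longrightarrow> t < e \<Longrightarrow> v + t *\<^sub>R (w - v) \<in> V"
      by (auto simp: eventually_at_right[of 0 1])
    \<comment> \<open>The cut at 1 keeps the parameters in [0, 1], where p is known to agree with
      the real function.\<close>
    define e' where "e' = min e 1"
    have "p 1 = 0"
    proof (rule analytic_continuation[OF hol op convex_connected[OF conv]])
      show "complex_of_real ` {0<..<e'} \<subseteq> ?\<Omega>" using inO by (force simp: e'_def)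
      show "0 \<in> ?\<Omega>" using inO[of 0] by simp
      show "1 \<in> ?\<Omega>" using inO[of 1] by simp
      show "0 islimpt complex_of_real ` {0<..<e'}"
      proof (rule islimptI)
        fix T assume "0 \<in> T" "open (T :: complex set)"
        then obtain d where d: "d > 0" "ball 0 d \<subseteq> T" using open_contains_ball by blast
        let ?t = "min (d / 2) (e' / 2)"
        have "complex_of_real ?t \<in> T" using d e by (intro subsetD[OF d(2)]) (auto simp: e'_def)
        moreover have "?t \<in> {0<..<e'}" using d e by (auto simp: e'_def)
        ultimately show "\<exists>y\<in>complex_of_real ` {0<..<e'}. y \<in> T \<and> y \<noteq> 0" by fastforce
      qed
      fix z assume "z \<in> complex_of_real ` {0<..<e'}"
      then obtain t where t: "z = of_real t" "0 < t" "t < e" "t < 1" by (auto simp: e'_def)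
      then have "X (v + t *\<^sub>R (w - v)) \<in> sphere c R" using V(3) e(2) by blast
      then show "p z = 0" using preal[of t] t by simp
    qed
    moreover have "p 1 = complex_of_real ((dist c (X w))\<^sup>2 - R\<^sup>2)" using preal[of 1] by simp
    ultimately have "(dist c (X w))\<^sup>2 - R\<^sup>2 = 0" by (simp only: of_real_eq_0_iff)
    then show ?thesis using R by (simp add: power2_eq_iff_nonneg)
  qed
  note main = this
  show ?thesis
  proof (rule that[OF \<rho>(1)])
    fix V assume "open V" "V \<inter> ball u \<rho> \<noteq> {}" "X ` V \<subseteq> sphere c R"
    from main[OF this] show "X ` ball u \<rho> \<subseteq> sphere c R" by blast
  qed
qed

section \<open>The profile equation\<close>

text \<open>The area element of the graph of f(\<bar>x\<bar>^2) over the plane: the gradient is 2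
  f'(\<bar>x\<bar>^2) x, of squared length 4 t f'^2 at t = \<bar>x\<bar>^2.\<close>

definition profile_speed :: "(real \<Rightarrow> real) \<Rightarrow> real \<Rightarrow> real" where
  "profile_speed f' t = sqrt (1 + 4 * t * (f' t)\<^sup>2)"

text \<open>Multiplied by pi, this is the area of the cap over \<bar>x\<bar>^2 \<le> t, because
  planar area becomes pi dt in the variable t.\<close>

definition profile_area :: "(real \<Rightarrow> real) \<Rightarrow> real \<Rightarrow> real" where
  "profile_area f' t = integral {0..t} (profile_speed f')"

text \<open>The pole is the endpoint t = 0 of the interval, so only one-sided limits are recorded
  there. The limit a of f' is half the principal curvature at the pole.\<close>

definition profile_curve :: "real \<Rightarrow> real \<Rightarrow> (real \<Rightarrow> real) \<Rightarrow> (real \<Rightarrow> real) \<Rightarrow> bool" where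
  "profile_curve a \<delta> f f' \<longleftrightarrow>
     \<delta> > 0 \<and> (\<forall>t\<in>{0<..<\<delta>}. (f has_real_derivative f' t) (at t)) \<and> continuous_on {0<..<\<delta>} f' \<and>
     (f \<longlongrightarrow> 0) (at_right 0) \<and> (f' \<longlongrightarrow> a) (at_right 0)"

text \<open>The divergence theorem on the cap over \<bar>x\<bar>^2 \<le> t: the flux of -grad G
  through the rim is t (1 + 2 f f') / ((t + f^2) S), and 1 - \<kappa> W is the unit mass at the pole
  minus the share of the cap in the total area. The form without denominators is stated.\<close>

definition profile_ode :: "real \<Rightarrow> real \<Rightarrow> (real \<Rightarrow> real) \<Rightarrow> (real \<Rightarrow> real) \<Rightarrow> bool" where
  "profile_ode \<kappa> \<delta> f f' \<longleftrightarrow> (\<forall>t\<in>{0<..<\<delta>}.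
     t * (1 + 2 * f t * f' t) =
       (1 - \<kappa> * profile_area f' t) * ((t + (f t)\<^sup>2) * profile_speed f' t))"

lemma profile_speed_ge_1: "t \<ge> 0 \<Longrightarrow> profile_speed f' t \<ge> 1"
  by (simp add: profile_speed_def)

lemma eventually_at_right_0_lt: "\<delta> > 0 \<Longrightarrow> eventually (\<lambda>t. 0 < t \<and> t < \<delta>) (at_right (0::real))"
  by (auto simp: eventually_at_right[of 0 "\<delta>"] intro!: exI[of _ \<delta>])

section \<open>Behaviour of a profile curve at the pole\<close>

context
  fixes a \<delta> f f' assumes pc: "profile_curve a \<delta> f f'"
begin

lemma profile_speed_tendsto: "(profile_speed f' \<longlongrightarrow> 1) (at_right 0)"
proof -
  have "((\<lambda>t. sqrt (1 + 4 * t * (f' t)\<^sup>2)) \<longlongrightarrow> sqrt (1 + 4 * 0 * a\<^sup>2)) (at_right 0)"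
    using pc unfolding profile_curve_def by (intro tendsto_intros) auto
  then show ?thesis by (simp add: profile_speed_def[abs_def])
qed

lemma continuous_on_profile_speed: "continuous_on {0..<\<delta>} (profile_speed f')"
proof -
  have "continuous (at t within {0..<\<delta>}) (profile_speed f')" if t: "t \<in> {0..<\<delta>}" for t
  proof (cases "t = 0")
    case True
    \<comment> \<open>Whatever \<open>f' 0\<close> is, the factor t makes
      \<open>profile_speed f' 0\<close> equal to 1, the limit.\<close>
    have "(profile_speed f' \<longlongrightarrow> profile_speed f' 0) (at_right 0)"
      using profile_speed_tendsto by (simp add: profile_speed_def)
    moreover have "eventually (\<lambda>s. s \<in> {0<..} \<longleftrightarrow> s \<in> {0..<\<delta>}) (at 0)"
      using pc by (auto simp: eventually_at profile_curve_def dist_real_def intro!: exI[of _ \<delta>])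
    ultimately have "(profile_speed f' \<longlongrightarrow> profile_speed f' 0) (at 0 within {0..<\<delta>})"
      by (rule Lim_transform_within_set)
    then show ?thesis using True by (simp add: continuous_within)
  next
    case False
    then have t': "t \<in> {0<..<\<delta>}" using t by auto
    have "continuous_on {0<..<\<delta>} (profile_speed f')"
      unfolding profile_speed_def using pc
      by (intro continuous_intros) (auto simp: profile_curve_def)
    then have "isCont (profile_speed f') t"
      using t' by (simp add: continuous_on_eq_continuous_at)
    then show ?thesis by (rule continuous_at_imp_continuous_at_within)
  qed
  then show ?thesis by (simp add: continuous_on_eq_continuous_within)
qed

lemma profile_speed_integrable: "t < \<delta> \<Longrightarrow> profile_speed f' integrable_on {0..t}"
  by (rule integrable_continuous_real, rule continuous_on_subset[OF continuous_on_profile_speed]) auto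

lemma profile_area_has_derivative:
  assumes "0 < t" "t < \<delta>"
  shows "(profile_area f' has_real_derivative profile_speed f' t) (at t)"
proof -
  define c where "c = (t + \<delta>) / 2"
  have c: "t < c" "c < \<delta>" using assms by (auto simp: c_def)
  have "(profile_area f' has_real_derivative profile_speed f' t) (at t within {0..c})"
    unfolding profile_area_def[abs_def]
    by (rule integral_has_real_derivative)
       (use assms c in \<open>auto intro: continuous_on_subset[OF continuous_on_profile_speed]\<close>)
  then show ?thesis
    using assms c at_within_Icc_at[of 0 t c] by simp
qed

lemma profile_area_0: "profile_area f' 0 = 0"
  by (simp add: profile_area_def)

lemma continuous_on_profile_area: "t < \<delta> \<Longrightarrow> continuous_on {0..t} (profile_area f')"
  unfolding profile_area_def[abs_def]
  by (rule indefinite_integral_continuous_1[OF profile_speed_integrable])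

lemma profile_area_ratio: "((\<lambda>t. profile_area f' t / t) \<longlongrightarrow> 1) (at_right 0)"
proof (rule lhopital_right_0[where f'="profile_speed f'" and g'="\<lambda>_. 1"])
  have d: "\<delta> > 0" using pc by (simp add: profile_curve_def)
  have "continuous_on {0..\<delta>/2} (profile_area f')"
    by (rule continuous_on_profile_area) (use d in auto)
  then have "(profile_area f' \<longlongrightarrow> profile_area f' 0) (at_right 0)"
    using d by (simp add: continuous_on_Icc_at_rightD)
  then show "(profile_area f' \<longlongrightarrow> 0) (at_right 0)" by (simp add: profile_area_0)
  show "eventually (\<lambda>x. (profile_area f' has_real_derivative profile_speed f' x) (at x)) (at_right 0)"
    using eventually_at_right_0_lt[OF d] by eventually_elim (auto intro: profile_area_has_derivative)
  show "((\<lambda>x. profile_speed f' x / 1) \<longlongrightarrow> 1) (at_right 0)" using profile_speed_tendsto by simp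
qed (auto simp: eventually_at_filter intro!: always_eventually)

lemma profile_height_ratio: "((\<lambda>t. f t / t) \<longlongrightarrow> a) (at_right 0)"
proof (rule lhopital_right_0[where f'=f' and g'="\<lambda>_. 1"])
  have d: "\<delta> > 0" using pc by (simp add: profile_curve_def)
  show "eventually (\<lambda>x. (f has_real_derivative f' x) (at x)) (at_right 0)"
    using eventually_at_right_0_lt[OF d] by eventually_elim (use pc in \<open>auto simp: profile_curve_def\<close>)
  show "(f \<longlongrightarrow> 0) (at_right 0)" "((\<lambda>x. f' x / 1) \<longlongrightarrow> a) (at_right 0)"
    using pc by (simp_all add: profile_curve_def)
qed (auto simp: eventually_at_filter intro!: always_eventually)

text \<open>Written with f / t, which tends to a, every term of the equation has a limit at 0, so
  the equation and differences of solutions can be expanded there.\<close>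

lemma profile_ode_normalized:
  assumes "profile_ode \<kappa> \<delta> f f'" "0 < t" "t < \<delta>"
  shows "1 + 2 * t * (f t / t) * f' t =
    (1 - \<kappa> * profile_area f' t) * (1 + t * (f t / t)\<^sup>2) * profile_speed f' t"
proof -
  have "t * (1 + 2 * f t * f' t) = (1 - \<kappa> * profile_area f' t) * ((t + (f t)\<^sup>2) * profile_speed f' t)"
    using assms unfolding profile_ode_def by auto
  also have "t + (f t)\<^sup>2 = t * (1 + t * (f t / t)\<^sup>2)"
    using assms by (simp add: field_simps power2_eq_square)
  finally have "t * (1 + 2 * f t * f' t) =
      t * ((1 - \<kappa> * profile_area f' t) * (1 + t * (f t / t)\<^sup>2) * profile_speed f' t)"
    by (simp add: mult_ac)
  then show ?thesis using assms by simp
qed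

text \<open>At t = 0 the normalized equation only says 1 = 1. Its next order in t reads \<kappa> =
  a^2 + 2 a^2 - 2 a^2, with contributions from t (f / t)^2, from S - 1 and from 2 t (f / t)
  f'.\<close>

lemma profile_ode_curvature:
  assumes "profile_ode \<kappa> \<delta> f f'"
  shows "\<kappa> = a\<^sup>2"
proof -
  let ?u = "\<lambda>t. f t / t" and ?S = "profile_speed f'" and ?W = "profile_area f'"
  have d: "\<delta> > 0" and v: "(f' \<longlongrightarrow> a) (at_right 0)"
    using pc by (simp_all add: profile_curve_def)
  have t0: "((\<lambda>t. t) \<longlongrightarrow> 0) (at_right (0::real))" by (rule tendsto_ident_at)
  have L: "((\<lambda>t. \<kappa> * (?W t / t) * (1 + t * (?u t)\<^sup>2) * ?S t) \<longlongrightarrow> \<kappa> * 1 * (1 + 0 * a\<^sup>2) * 1) (at_right 0)"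
    by (intro tendsto_intros profile_area_ratio profile_height_ratio profile_speed_tendsto t0)
  have R: "((\<lambda>t. (?u t)\<^sup>2 * ?S t + 4 * (f' t)\<^sup>2 / (?S t + 1) - 2 * ?u t * f' t) \<longlongrightarrow>
      a\<^sup>2 * 1 + 4 * a\<^sup>2 / (1 + 1) - 2 * a * a) (at_right 0)"
    by (intro tendsto_intros profile_height_ratio profile_speed_tendsto v) auto
  have "eventually (\<lambda>t. \<kappa> * (?W t / t) * (1 + t * (?u t)\<^sup>2) * ?S t =
      (?u t)\<^sup>2 * ?S t + 4 * (f' t)\<^sup>2 / (?S t + 1) - 2 * ?u t * f' t) (at_right 0)"
    using eventually_at_right_0_lt[OF d]
  proof eventually_elim
    case (elim t)
    have S1: "?S t \<ge> 1" using elim profile_speed_ge_1[of t f'] by simp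
    have S2: "(?S t)\<^sup>2 = 1 + 4 * t * (f' t)\<^sup>2" using elim by (simp add: profile_speed_def)
    \<comment> \<open>Rationalizing S - 1 exposes the factor t that is to be cancelled.\<close>
    have S3: "?S t - 1 = t * (4 * (f' t)\<^sup>2 / (?S t + 1))"
      using S1 S2 by (simp add: field_simps power2_eq_square)
    have e: "1 + 2 * t * ?u t * f' t = (1 - \<kappa> * ?W t) * (1 + t * (?u t)\<^sup>2) * ?S t"
      using profile_ode_normalized[OF assms] elim by simp
    have "t * (\<kappa> * (?W t / t) * (1 + t * (?u t)\<^sup>2) * ?S t) = \<kappa> * ?W t * (1 + t * (?u t)\<^sup>2) * ?S t"
      using elim by simp
    also have "\<dots> = (1 + t * (?u t)\<^sup>2) * ?S t - 1 - 2 * t * ?u t * f' t"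
      using e by (simp add: algebra_simps)
    also have "\<dots> = t * ((?u t)\<^sup>2 * ?S t) + (?S t - 1) - t * (2 * ?u t * f' t)"
      by (simp add: algebra_simps)
    also have "\<dots> = t * ((?u t)\<^sup>2 * ?S t + 4 * (f' t)\<^sup>2 / (?S t + 1) - 2 * ?u t * f' t)"
      unfolding S3 by (simp add: algebra_simps)
    finally show ?case using elim by simp
  qed
  from tendsto_cong[OF this] L R
  have "\<kappa> * 1 * (1 + 0 * a\<^sup>2) * 1 = a\<^sup>2 * 1 + 4 * a\<^sup>2 / (1 + 1) - 2 * a * a"
    using tendsto_unique[of "at_right (0::real)"] by (metis (no_types, lifting) trivial_limit_at_right_real)
  then show ?thesis by (simp add: power2_eq_square)
qed

end

text \<open>Put u = f / t and x = g / t. Subtracting the two normalized equations and dividing by t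
  gives (f' - g') cA = (u - x) cB + ((W - Y) / t) cC. A bound m for \<bar>f' - g'\<bar> also bounds
  \<bar>u - x\<bar> by m, without any gain, so it is decisive that cB tends to 0; the area term
  gains a factor t. As cA tends to 2 a > 0, on a small interval every bound for \<bar>f' - g'\<bar>
  may be halved, hence f' = g' there.\<close>

lemma profile_ode_unique:
  assumes f: "profile_curve a \<delta> f f'" "profile_ode \<kappa> \<delta> f f'"
    and g: "profile_curve a \<delta> g g'" "profile_ode \<kappa> \<delta> g g'"
    and a: "a > 0"
  shows "eventually (\<lambda>t. f t = g t) (at_right 0)"
proof -
  let ?u = "\<lambda>t. f t / t" and ?S = "profile_speed f'" and ?W = "profile_area f'"
  let ?x = "\<lambda>t. g t / t" and ?T = "profile_speed g'" and ?Y = "profile_area g'"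
  have d0: "\<delta> > 0" and v: "(f' \<longlongrightarrow> a) (at_right 0)" and y: "(g' \<longlongrightarrow> a) (at_right 0)"
    using f g by (simp_all add: profile_curve_def)
  have W0: "(?Y \<longlongrightarrow> 0) (at_right 0)"
  proof -
    have "((\<lambda>t. t * (?Y t / t)) \<longlongrightarrow> 0 * 1) (at_right 0)"
      by (intro tendsto_intros profile_area_ratio[OF g(1)] tendsto_ident_at)
    moreover have "eventually (\<lambda>t. t * (?Y t / t) = ?Y t) (at_right 0)"
      using eventually_at_right_0_lt[OF d0] by eventually_elim simp
    ultimately show ?thesis using Lim_transform_eventually by fastforce
  qed
  have t0: "((\<lambda>t. t) \<longlongrightarrow> 0) (at_right (0::real))" by (rule tendsto_ident_at)
  note lims = profile_height_ratio[OF f(1)] profile_height_ratio[OF g(1)]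
    profile_speed_tendsto[OF f(1)] profile_speed_tendsto[OF g(1)] W0 v y t0
  define cA where "cA t = (1 - \<kappa> * ?Y t) * (1 + t * (?x t)\<^sup>2) * (4 * (f' t + g' t) / (?S t + ?T t)) - 2 * ?u t" for t
  define cB where "cB t = 2 * g' t - (1 - \<kappa> * ?Y t) * ?S t * (?u t + ?x t)" for t
  define cC where "cC t = \<kappa> * (1 + t * (?u t)\<^sup>2) * ?S t" for t
  \<comment> \<open>The limit is 4 a - 2 a: the first part is the response of the speed to f', the
    second that of 2 t u f'.\<close>
  have A: "(cA \<longlongrightarrow> 2 * a) (at_right 0)"
  proof -
    have "(cA \<longlongrightarrow> (1 - \<kappa> * 0) * (1 + 0 * a\<^sup>2) * (4 * (a + a) / (1 + 1)) - 2 * a) (at_right 0)"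
      unfolding cA_def by (intro tendsto_intros lims) auto
    then show ?thesis by simp
  qed
  \<comment> \<open>The contribution 2 a of 2 t u f' cancels against the 2 a that comes from t
    u^2.\<close>
  have B: "(cB \<longlongrightarrow> 0) (at_right 0)"
  proof -
    have "(cB \<longlongrightarrow> 2 * a - (1 - \<kappa> * 0) * 1 * (a + a)) (at_right 0)"
      unfolding cB_def by (intro tendsto_intros lims)
    then show ?thesis by simp
  qed
  have C: "((\<lambda>t. cC t * (6 * a * t)) \<longlongrightarrow> 0) (at_right 0)"
  proof -
    have "((\<lambda>t. cC t * (6 * a * t)) \<longlongrightarrow> \<kappa> * (1 + 0 * a\<^sup>2) * 1 * (6 * a * 0)) (at_right 0)"
      unfolding cC_def by (intro tendsto_intros lims)
    then show ?thesis by simp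
  qed
  have S: "((\<lambda>t. f' t + g' t) \<longlongrightarrow> a + a) (at_right 0)" "((\<lambda>t. f' t - g' t) \<longlongrightarrow> a - a) (at_right 0)"
    by (intro tendsto_intros v y)+
  \<comment> \<open>With cA > a, two error terms of at most m a / 4 each yield the factor 1/2. The
    constant 6 a t is that of the estimate for (W - Y) / t below, and the bound 1 starts the
    iteration.\<close>
  have "eventually (\<lambda>t. a < cA t \<and> \<bar>cB t\<bar> < a / 4 \<and> \<bar>cC t * (6 * a * t)\<bar> < a / 4 \<and>
      0 < f' t + g' t \<and> f' t + g' t < 3 * a \<and> \<bar>f' t - g' t\<bar> < 1 \<and> 0 < t \<and> t < \<delta>) (at_right 0)"
    using order_tendstoD(1)[OF A, of a] tendsto_rabs_zero[OF B, THEN order_tendstoD(2), of "a/4"]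
      tendsto_rabs_zero[OF C, THEN order_tendstoD(2), of "a/4"]
      order_tendstoD(1)[OF S(1), of 0] order_tendstoD(2)[OF S(1), of "3*a"]
      tendsto_rabs[OF S(2), THEN order_tendstoD(2), of 1] eventually_at_right_0_lt[OF d0] a
    by (simp add: eventually_conj_iff)
  then obtain \<eta> where \<eta>: "\<eta> > 0" and E: "\<And>t. 0 < t \<Longrightarrow> t < \<eta> \<Longrightarrow> a < cA t \<and> \<bar>cB t\<bar> < a / 4 \<and>
      \<bar>cC t * (6 * a * t)\<bar> < a / 4 \<and>
      0 < f' t + g' t \<and> f' t + g' t < 3 * a \<and> \<bar>f' t - g' t\<bar> < 1 \<and> t < \<delta>"
    by (auto simp: eventually_at_right[of 0 1])
  have ediff: "\<bar>f t - g t\<bar> \<le> m * t" if m: "\<And>s. 0 < s \<Longrightarrow> s < \<eta> \<Longrightarrow> \<bar>f' s - g' s\<bar> \<le> m" and t: "0 < t" "t < \<eta>" for m t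
  proof -
    have m0: "m \<ge> 0" using m[OF t] by linarith
    have *: "\<bar>(f t - g t) - (f s - g s)\<bar> \<le> m * t" if s: "0 < s" "s < t" for s
    proof -
      have "norm ((f t - g t) - (f s - g s)) \<le> m * norm (t - s)"
      proof (rule field_differentiable_bound[where S="{s..t}" and f'="\<lambda>x. f' x - g' x"])
        fix x assume x: "x \<in> {s..t}"
        then have "x \<in> {0<..<\<delta>}" using s t E[of x] by auto
        then have "((\<lambda>x. f x - g x) has_real_derivative f' x - g' x) (at x)"
          using f g by (intro DERIV_diff) (auto simp: profile_curve_def)
        then show "((\<lambda>x. f x - g x) has_real_derivative f' x - g' x) (at x within {s..t})"
          by (rule has_field_derivative_at_within)
        show "norm (f' x - g' x) \<le> m" using m[of x] x s t by auto
      qed (use s in auto)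
      also have "\<dots> \<le> m * t" using m0 s by (intro mult_left_mono) auto
      finally show ?thesis by simp
    qed
    \<comment> \<open>The values of f and g at 0 are not controlled, only their limits, so the mean
      value estimate is used on [s, t] and then s tends to 0.\<close>
    have "((\<lambda>s. \<bar>(f t - g t) - (f s - g s)\<bar>) \<longlongrightarrow> \<bar>(f t - g t) - (0 - 0)\<bar>) (at_right 0)"
      using f g by (intro tendsto_intros) (auto simp: profile_curve_def)
    then have "\<bar>(f t - g t) - (0 - 0)\<bar> \<le> m * t"
      by (rule tendsto_upperbound)
         (use eventually_at_right_0_lt[OF t(1)] * in \<open>auto elim!: eventually_mono\<close>)
    then show ?thesis by simp
  qed
  have wdiff: "\<bar>?W t - ?Y t\<bar> \<le> (6 * a * t * m) * t" if m: "\<And>s. 0 < s \<Longrightarrow> s < \<eta> \<Longrightarrow> \<bar>f' s - g' s\<bar> \<le> m" and t: "0 < t" "t < \<eta>" for m t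
  proof -
    have m0: "m \<ge> 0" using m[OF t] by linarith
    have td: "t < \<delta>" using E t by auto
    have "?W t - ?Y t = integral {0..t} (\<lambda>s. ?S s - ?T s)"
      unfolding profile_area_def
      by (rule integral_diff[symmetric]) (use td f g profile_speed_integrable in auto)
    also have "norm \<dots> \<le> (6 * a * t * m) * (t - 0)"
    proof (rule integral_bound)
      show "continuous_on {0..t} (\<lambda>s. ?S s - ?T s)"
        by (intro continuous_intros continuous_on_subset[OF continuous_on_profile_speed[OF f(1)]]
            continuous_on_subset[OF continuous_on_profile_speed[OF g(1)]]) (use td in auto)
      fix s assume s: "s \<in> {0..t}"
      show "norm (?S s - ?T s) \<le> 6 * a * t * m"
      proof (cases "s = 0")
        case True
        then show ?thesis using a t m0 by (simp add: profile_speed_def)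
      next
        case False
        then have s0: "0 < s" "s < \<eta>" using s t by auto
        have S1: "?S s \<ge> 1" "?T s \<ge> 1" using s0 by (auto intro: profile_speed_ge_1)
        \<comment> \<open>S^2 - T^2 = 4 s (f'^2 - g'^2) together with S + T \<ge> 2 and f' + g' < 3
          a gives 4 t (3 a) m / 2 = 6 a t m.\<close>
        have "(?S s - ?T s) * (?S s + ?T s) = 4 * s * ((f' s + g' s) * (f' s - g' s))"
          using s0 by (simp add: profile_speed_def algebra_simps power2_eq_square
              flip: real_sqrt_mult)
        then have "\<bar>?S s - ?T s\<bar> * \<bar>?S s + ?T s\<bar> = 4 * s * ((f' s + g' s) * \<bar>f' s - g' s\<bar>)"
          using s0 E[OF s0] by (metis abs_mult abs_of_pos mult.assoc zero_less_mult_iff zero_less_numeral)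
        also have "\<dots> \<le> 4 * t * ((3 * a) * m)"
          using s0 E[OF s0] m[OF s0] s a m0 by (intro mult_mono) auto
        finally have 1: "\<bar>?S s - ?T s\<bar> * \<bar>?S s + ?T s\<bar> \<le> 12 * a * t * m" by (simp add: mult_ac)
        have "\<bar>?S s - ?T s\<bar> * 2 \<le> \<bar>?S s - ?T s\<bar> * \<bar>?S s + ?T s\<bar>"
          using S1 by (intro mult_left_mono) auto
        with 1 show ?thesis by simp
      qed
    qed (use t in auto)
    finally show ?thesis by simp
  qed
  have half: "\<bar>f' t - g' t\<bar> \<le> m / 2" if m: "\<And>s. 0 < s \<Longrightarrow> s < \<eta> \<Longrightarrow> \<bar>f' s - g' s\<bar> \<le> m" and t: "0 < t" "t < \<eta>" for m t
  proof -
    have m0: "m \<ge> 0" using m[OF t] by linarith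
    have td: "t < \<delta>" using E t by auto
    have ef: "1 + 2 * t * ?u t * f' t = (1 - \<kappa> * ?W t) * (1 + t * (?u t)\<^sup>2) * ?S t"
      using profile_ode_normalized[OF f] t td by simp
    have eg: "1 + 2 * t * ?x t * g' t = (1 - \<kappa> * ?Y t) * (1 + t * (?x t)\<^sup>2) * ?T t"
      using profile_ode_normalized[OF g] t td by simp
    have ST: "?S t + ?T t \<noteq> 0" using profile_speed_ge_1[of t f'] profile_speed_ge_1[of t g'] t by auto
    have "(?S t - ?T t) * (?S t + ?T t) = 4 * t * ((f' t + g' t) * (f' t - g' t))"
      using t by (simp add: profile_speed_def algebra_simps power2_eq_square flip: real_sqrt_mult)
    then have sd: "?S t - ?T t = t * ((f' t - g' t) * (4 * (f' t + g' t) / (?S t + ?T t)))"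
      using ST by (simp add: field_simps)
    have key: "t * ((f' t - g' t) * cA t) = t * ((?u t - ?x t) * cB t + ((?W t - ?Y t) / t) * cC t)"
    proof -
      have 1: "2 * t * (?u t * f' t - ?x t * g' t) =
         - \<kappa> * (?W t - ?Y t) * ((1 + t * (?u t)\<^sup>2) * ?S t)
         + (1 - \<kappa> * ?Y t) * ?S t * (t * ((?u t)\<^sup>2 - (?x t)\<^sup>2))
         + (1 - \<kappa> * ?Y t) * (1 + t * (?x t)\<^sup>2) * (?S t - ?T t)"
      proof -
        have "2 * t * (?u t * f' t - ?x t * g' t) = (1 - \<kappa> * ?W t) * (1 + t * (?u t)\<^sup>2) * ?S t
           - (1 - \<kappa> * ?Y t) * (1 + t * (?x t)\<^sup>2) * ?T t"
          unfolding ef[symmetric] eg[symmetric] by (simp add: algebra_simps)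
        then show ?thesis by (simp add: algebra_simps)
      qed
      have 2: "t * (((?W t - ?Y t) / t) * cC t) = \<kappa> * (?W t - ?Y t) * ((1 + t * (?u t)\<^sup>2) * ?S t)"
        using t by (simp add: cC_def)
      define K where "K = 4 * (f' t + g' t) / (?S t + ?T t)"
      define u where "u = ?u t"
      define x where "x = ?x t"
      define Z where "Z = 1 - \<kappa> * ?Y t"
      have sq: "u\<^sup>2 - x\<^sup>2 = (u - x) * (u + x)" by (simp add: power2_eq_square algebra_simps)
      show ?thesis
        using 1 2 unfolding cA_def cB_def distrib_left sd K_def[symmetric] u_def[symmetric] x_def[symmetric]
          Z_def[symmetric] sq
        by (simp add: algebra_simps)
    qed
    then have key': "(f' t - g' t) * cA t = (?u t - ?x t) * cB t + ((?W t - ?Y t) / t) * cC t"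
      using t by simp
    have "\<bar>f' t - g' t\<bar> * a \<le> \<bar>f' t - g' t\<bar> * cA t"
      using E[OF t] by (intro mult_left_mono) auto
    also have "\<dots> = \<bar>(f' t - g' t) * cA t\<bar>" using E[OF t] a by (simp add: abs_mult)
    also have "\<dots> \<le> \<bar>(?u t - ?x t) * cB t\<bar> + \<bar>((?W t - ?Y t) / t) * cC t\<bar>"
      unfolding key' by (rule abs_triangle_ineq)
    also have "\<bar>(?u t - ?x t) * cB t\<bar> \<le> m * (a / 4)"
    proof -
      have "?u t - ?x t = (f t - g t) / t" by (simp add: diff_divide_distrib)
      then have "\<bar>?u t - ?x t\<bar> \<le> m" using ediff[OF m t] t by (simp add: field_simps)
      then show ?thesis unfolding abs_mult using E[OF t] m0 by (intro mult_mono) auto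
    qed
    also have "\<bar>((?W t - ?Y t) / t) * cC t\<bar> \<le> m * (a / 4)"
    proof -
      have "\<bar>(?W t - ?Y t) / t\<bar> \<le> 6 * a * t * m" using wdiff[OF m t] t by (simp add: field_simps)
      then have "\<bar>((?W t - ?Y t) / t) * cC t\<bar> \<le> (6 * a * t * m) * \<bar>cC t\<bar>"
        unfolding abs_mult by (intro mult_right_mono) auto
      also have "\<dots> = m * \<bar>cC t * (6 * a * t)\<bar>" using a t by (simp add: abs_mult)
      also have "\<dots> \<le> m * (a / 4)" using E[OF t] m0 by (intro mult_left_mono) auto
      finally show ?thesis .
    qed
    finally show ?thesis using a by (simp add: field_simps)
  qed
  have pow: "\<bar>f' t - g' t\<bar> \<le> (1/2)^n" if "0 < t" "t < \<eta>" for n t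
    using that
  proof (induction n arbitrary: t)
    case 0 then show ?case using E[of t] by auto
  next
    case (Suc n)
    then show ?case using half[of "(1/2)^n" t] by simp
  qed
  have zero: "\<bar>f' t - g' t\<bar> \<le> 0" if "0 < t" "t < \<eta>" for t
    by (rule LIMSEQ_le_const[OF LIMSEQ_power_zero[of "1/2::real"]]) (use pow[OF that] in auto)
  have "f t = g t" if "0 < t" "t < \<eta>" for t
    using ediff[of 0 t] zero that by auto
  then show ?thesis using \<eta> by (auto simp: eventually_at_right[of 0 1])
qed

section \<open>Spherical caps as the solutions\<close>

lemma sphere_profile:
  assumes "R > 0"
  defines "f \<equiv> \<lambda>t. R - sqrt (R\<^sup>2 - t)" and "f' \<equiv> \<lambda>t. 1 / (2 * sqrt (R\<^sup>2 - t))"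
  shows "profile_curve (1 / (2 * R)) (R\<^sup>2) f f'" "profile_ode (1 / (4 * R\<^sup>2)) (R\<^sup>2) f f'"
proof -
  have D: "(f has_real_derivative f' t) (at t)" if "t < R\<^sup>2" for t
    unfolding f_def f'_def using that by (auto intro!: derivative_eq_intros simp: field_simps)
  have C: "continuous_on {..<R\<^sup>2} f'"
    unfolding f'_def by (auto intro!: continuous_intros)
  have c0: "isCont f 0" "isCont f' 0"
    using D[of 0] C assms(1) by (auto intro: DERIV_isCont simp: continuous_on_eq_continuous_at)
  have "f 0 = 0" "f' 0 = 1 / (2 * R)" using assms(1) by (auto simp: f_def f'_def)
  with c0 have "(f \<longlongrightarrow> 0) (at_right 0)" "(f' \<longlongrightarrow> 1 / (2 * R)) (at_right 0)"
    by (auto simp: isCont_def intro: tendsto_within_subset)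
  moreover have C': "continuous_on {0<..<R\<^sup>2} f'"
    by (rule continuous_on_subset[OF C]) auto
  ultimately show "profile_curve (1 / (2 * R)) (R\<^sup>2) f f'"
    unfolding profile_curve_def using assms(1) D C' by auto
  show "profile_ode (1 / (4 * R\<^sup>2)) (R\<^sup>2) f f'"
    unfolding profile_ode_def
  proof
    fix t assume t: "t \<in> {0<..<R\<^sup>2}"
    have S: "profile_speed f' s = R / sqrt (R\<^sup>2 - s)" if "s \<in> {0..t}" for s
    proof -
      have "1 + 4 * s * (f' s)\<^sup>2 = R\<^sup>2 / (R\<^sup>2 - s)"
        using that t by (simp add: f'_def power_divide power_mult_distrib field_simps)
      then show ?thesis using assms(1) by (simp add: profile_speed_def real_sqrt_divide)
    qed
    \<comment> \<open>Archimedes: the area pi W of a cap is 2 pi R times its height f.\<close>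
    have "((\<lambda>s. R / sqrt (R\<^sup>2 - s)) has_integral (2 * R * f t - 2 * R * f 0)) {0..t}"
    proof (rule fundamental_theorem_of_calculus)
      fix s assume "s \<in> {0..t}"
      then have "((\<lambda>s. 2 * R * f s) has_real_derivative 2 * R * f' s) (at s within {0..t})"
        using t D[of s] by (auto intro!: has_field_derivative_at_within[OF DERIV_cmult])
      then show "((\<lambda>s. 2 * R * f s) has_vector_derivative R / sqrt (R\<^sup>2 - s)) (at s within {0..t})"
        by (simp add: has_real_derivative_iff_has_vector_derivative f'_def)
    qed (use t in auto)
    then have "((profile_speed f') has_integral (2 * R * f t)) {0..t}"
      using has_integral_cong[of "{0..t}" "profile_speed f'" "\<lambda>s. R / sqrt (R\<^sup>2 - s)"] S assms(1)
      by (simp add: \<open>f 0 = 0\<close>)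
    then have W: "profile_area f' t = 2 * R * f t" unfolding profile_area_def by (rule integral_unique)
    \<comment> \<open>In terms of q both sides are rational; the essential relation is t + f^2 = 2 R
      (R - q) = 2 R f.\<close>
    define q where "q = sqrt (R\<^sup>2 - t)"
    have q: "q > 0" "t = R\<^sup>2 - q\<^sup>2" using t by (auto simp: q_def)
    have ft: "f t = R - q" "f' t = 1 / (2 * q)" "profile_speed f' t = R / q"
      using S[of t] t by (auto simp: f_def f'_def q_def)
    show "t * (1 + 2 * f t * f' t) = (1 - 1 / (4 * R\<^sup>2) * profile_area f' t) *
        ((t + (f t)\<^sup>2) * profile_speed f' t)"
      unfolding W ft unfolding q(2) using q(1) assms(1)
      by (simp add: field_simps power2_eq_square)
  qed
qed

text \<open>The relation t + f^2 = f / a places the points (x, f(\<bar>x\<bar>^2)) on the sphere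
  through the origin with centre (0, 0, 1 / (2 a)). For a < 0 the surface is reflected: the equation
  is invariant under changing the sign of f.\<close>

lemma profile_ode_sphere:
  assumes f: "profile_curve a \<delta> f f'" "profile_ode \<kappa> \<delta> f f'" and "\<kappa> > 0"
  shows "a \<noteq> 0" "eventually (\<lambda>t. t + (f t)\<^sup>2 = f t / a) (at_right 0)"
proof -
  have ka: "\<kappa> = a\<^sup>2" using profile_ode_curvature[OF f] .
  with \<open>\<kappa> > 0\<close> show a0: "a \<noteq> 0" by auto
  have pos: "eventually (\<lambda>t. t + (f t)\<^sup>2 = f t / a) (at_right 0)"
    if f: "profile_curve a \<delta> f f'" "profile_ode \<kappa> \<delta> f f'" and a: "a > 0" and ka: "\<kappa> = a\<^sup>2" for f f' a
  proof -
    \<comment> \<open>The cap of radius R has slope 1 / (2 R) at t = 0 and constant pi / (4 pi R^2),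
      so this R matches both a and \<kappa> = a^2.\<close>
    define R where "R = 1 / (2 * a)"
    have R: "R > 0" "a = 1 / (2 * R)" "\<kappa> = 1 / (4 * R\<^sup>2)" using a ka
      by (auto simp: R_def power_divide power_mult_distrib)
    let ?g = "\<lambda>t. R - sqrt (R\<^sup>2 - t)" and ?g' = "\<lambda>t. 1 / (2 * sqrt (R\<^sup>2 - t))"
    let ?d = "min \<delta> (R\<^sup>2)"
    have d0: "\<delta> > 0" using f by (simp add: profile_curve_def)
    have "profile_curve a ?d f f'" "profile_ode \<kappa> ?d f f'"
      using f R unfolding profile_curve_def profile_ode_def
      by (auto elim!: continuous_on_subset)
    moreover have "profile_curve a ?d ?g ?g'" "profile_ode \<kappa> ?d ?g ?g'"
      using sphere_profile[OF R(1)] d0 unfolding profile_curve_def profile_ode_def R(2,3)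
      by (auto elim!: continuous_on_subset)
    ultimately have "eventually (\<lambda>t. f t = ?g t) (at_right 0)"
      using a by (rule profile_ode_unique)
    moreover have "eventually (\<lambda>t. 0 < t \<and> t < R\<^sup>2) (at_right 0)"
      using R(1) by (intro eventually_at_right_0_lt) auto
    ultimately show ?thesis
    proof (eventually_elim)
      case (elim t)
      then have "t < R\<^sup>2" by auto
      then have "t + (R - sqrt (R\<^sup>2 - t))\<^sup>2 = (R - sqrt (R\<^sup>2 - t)) / a"
        using R by (simp add: power2_eq_square algebra_simps)
      with elim show ?case by simp
    qed
  qed
  show "eventually (\<lambda>t. t + (f t)\<^sup>2 = f t / a) (at_right 0)"
  proof (cases "a > 0")
    case True
    then show ?thesis using pos f ka by blast
  next
    case False
    have "profile_curve (- a) \<delta> (\<lambda>t. - f t) (\<lambda>t. - f' t)"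
      using f(1) unfolding profile_curve_def
      by (auto intro!: continuous_intros DERIV_minus tendsto_minus tendsto_minus[where a=0, simplified])
    moreover have "profile_ode \<kappa> \<delta> (\<lambda>t. - f t) (\<lambda>t. - f' t)"
      using f(2) unfolding profile_ode_def profile_area_def profile_speed_def by simp
    ultimately show ?thesis using pos[of "- a" "\<lambda>t. - f t" "\<lambda>t. - f' t"] False a0 ka by simp
  qed
qed

section \<open>Integration in the plane\<close>

lemma lborel_integral_translation:
  fixes F :: "'a::euclidean_space \<Rightarrow> real"
  shows "(LINT u|lborel. F (c + u)) = (LINT u|lborel. F u)"
proof (cases "F \<in> borel_measurable borel")
  case True
  have "(LINT u|lborel. F u) = (LINT u|distr lborel borel ((+) c). F u)"
    by (simp add: lborel_distr_plus)
  also have "\<dots> = (LINT u|lborel. F (c + u))"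
    by (rule integral_distr) (use True in auto)
  finally show ?thesis by simp
next
  case False
  \<comment> \<open>Both integrals are 0 by convention, since translation preserves the failure of
    measurability.\<close>
  have "\<not> integrable lborel F"
    using False by (auto dest: borel_measurable_integrable)
  moreover have "\<not> integrable lborel (\<lambda>u. F (c + u))"
  proof
    assume "integrable lborel (\<lambda>u. F (c + u))"
    then have "(\<lambda>u. F (c + u)) \<in> borel_measurable borel" by (auto dest: borel_measurable_integrable)
    then have "(\<lambda>u. F (c + (- c + u))) \<in> borel_measurable borel" by (rule measurable_compose_rev) auto
    then show False using False by simp
  qed
  ultimately show ?thesis by (simp add: not_integrable_integral_eq)
qed

text \<open>Translation invariance makes the integral of every difference quotient 0, and compact
  support with bounded derivative permits dominated convergence. It is the divergence theorem
  without boundary term, one coordinate at a time.\<close>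

lemma integral_pd_compact_support:
  fixes F :: "real^2 \<Rightarrow> real"
  assumes K: "compact K" "\<And>u. u \<notin> K \<Longrightarrow> F u = 0"
    and F: "Ck_on 1 F UNIV"
  shows "integrable lborel (pd i F)" "(LINT u|lborel. pd i F u) = 0"
proof -
  have dF: "F differentiable (at u)" for u
    using F Ck_on_Suc_open[of UNIV 0 F] by simp
  have cF: "continuous_on UNIV F"
    using F Ck_on_imp_continuous_on open_UNIV by blast
  have cpd: "continuous_on UNIV (pd i F)"
    using F by simp
  have pd0: "pd i F u = 0" if "u \<notin> K" for u
  proof -
    have "pd i F u = pd i (\<lambda>_. 0) u"
      by (rule pd_cong_open[of "- K"]) (use that K compact_imp_closed in \<open>auto simp: open_Compl\<close>)
    then show ?thesis by (simp add: pd_const)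
  qed
  have "bounded (pd i F ` K)"
    by (intro compact_imp_bounded compact_continuous_image continuous_on_subset[OF cpd] K) auto
  then obtain C where C: "C > 0" "\<And>u. u \<in> K \<Longrightarrow> norm (pd i F u) \<le> C"
    by (auto simp: bounded_pos)
  then have C': "\<bar>pd i F u\<bar> \<le> C" for u using pd0[of u] by (cases "u \<in> K") auto
  obtain B where B: "\<And>u. u \<in> K \<Longrightarrow> norm u \<le> B" using K compact_imp_bounded bounded_iff by metis
  let ?e = "axis i 1 :: real^2"
  have line: "((\<lambda>s. F (u + s *\<^sub>R ?e)) has_real_derivative pd i F (u + s *\<^sub>R ?e)) (at s)" for u s
  proof -
    let ?D = "frechet_derivative F (at (u + s *\<^sub>R ?e))"
    have D: "(F has_derivative ?D) (at (u + s *\<^sub>R ?e))"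
      using dF by (simp add: frechet_derivative_works)
    have "((\<lambda>s. F (u + s *\<^sub>R ?e)) has_derivative (\<lambda>h. ?D (h *\<^sub>R ?e))) (at s)"
      by (rule has_derivative_compose[where f="\<lambda>s. u + s *\<^sub>R ?e" and g=F, OF _ D])
         (auto intro!: derivative_eq_intros)
    moreover have "?D (h *\<^sub>R ?e) = pd i F (u + s *\<^sub>R ?e) * h" for h
      using linear_frechet_derivative[OF dF] linear_scale[of ?D] by (simp add: pd_def)
    ultimately show ?thesis by (simp add: has_field_derivative_def)
  qed
  define q where "q n u = (F ((1 / real (Suc n)) *\<^sub>R ?e + u) - F u) * real (Suc n)" for n u
  have qint: "integrable lborel F"
  proof -
    have "integrable lborel (\<lambda>u. indicator K u *\<^sub>R F u)"
      by (rule borel_integrable_compact[OF K(1) continuous_on_subset[OF cF]]) auto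
    moreover have "(\<lambda>u. indicator K u *\<^sub>R F u) = F" using K(2) by (auto simp: fun_eq_iff indicator_def)
    ultimately show ?thesis by simp
  qed
  have F_meas: "F \<in> borel_measurable borel" using cF by (rule borel_measurable_continuous_onI)
  have int_shift: "integrable lborel (\<lambda>u. F (c + u))" for c
  proof -
    have "integrable (distr lborel borel ((+) c)) F" using qint by (simp add: lborel_distr_plus)
    then show ?thesis using F_meas by (simp add: integrable_distr_eq)
  qed
  have q0: "(LINT u|lborel. q n u) = 0" for n
    unfolding q_def using int_shift qint lborel_integral_translation[of F] by simp
  \<comment> \<open>The shifts have length at most 1, so all difference quotients vanish outside the
    ball of radius B + 1.\<close>
  let ?w = "\<lambda>u. indicator (cball 0 (B + 1)) u * C :: real"
  have wint: "integrable lborel ?w"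
    by (intro integrable_mult_left integrable_real_indicator) (auto simp: emeasure_bounded_finite[unfolded infinity_ennreal_def])
  have lim: "(\<lambda>n. q n u) \<longlonglongrightarrow> pd i F u" for u
  proof -
    have "((\<lambda>h. (F (u + (0 + h) *\<^sub>R ?e) - F (u + 0 *\<^sub>R ?e)) / h) \<longlongrightarrow> pd i F (u + 0 *\<^sub>R ?e)) (at 0)"
      using line[of u 0] by (simp add: DERIV_def)
    then have "((\<lambda>h. (F (u + h *\<^sub>R ?e) - F u) / h) \<longlongrightarrow> pd i F u) (at 0)" by simp
    moreover have "filterlim (\<lambda>n. 1 / real (Suc n)) (at 0) sequentially"
      using LIMSEQ_inverse_real_of_nat by (auto simp: filterlim_at inverse_eq_divide)
    ultimately have "(\<lambda>n. (F (u + (1 / real (Suc n)) *\<^sub>R ?e) - F u) / (1 / real (Suc n))) \<longlonglongrightarrow> pd i F u"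
      by (rule filterlim_compose)
    then show ?thesis by (simp add: q_def add.commute)
  qed
  have bnd: "norm (q n u) \<le> ?w u" for n u
  proof (cases "u \<in> cball 0 (B + 1)")
    case True
    have "norm (F (u + (1 / real (Suc n)) *\<^sub>R ?e) - F (u + 0 *\<^sub>R ?e)) \<le> C * norm (1 / real (Suc n) - 0)"
      by (rule field_differentiable_bound[where S=UNIV and f'="\<lambda>s. pd i F (u + s *\<^sub>R ?e)"])
         (use line C' in auto)
    then have "\<bar>F ((1 / real (Suc n)) *\<^sub>R ?e + u) - F u\<bar> \<le> C / real (Suc n)"
      by (simp add: add.commute)
    then have "\<bar>F ((1 / real (Suc n)) *\<^sub>R ?e + u) - F u\<bar> * real (Suc n) \<le> C"
      by (simp only: pos_le_divide_eq of_nat_0_less_iff zero_less_Suc)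
    then have "norm (q n u) \<le> C"
      unfolding q_def real_norm_def abs_mult abs_of_nat .
    then show ?thesis using True by simp
  next
    case False
    then have u: "norm u > B + 1" by simp
    have "F u = 0" using K(2) B u by fastforce
    moreover have "F ((1 / real (Suc n)) *\<^sub>R ?e + u) = 0"
    proof -
      have "norm u \<le> norm ((1 / real (Suc n)) *\<^sub>R ?e + u) + norm ((1 / real (Suc n)) *\<^sub>R ?e)"
        using norm_triangle_ineq4[of "(1 / real (Suc n)) *\<^sub>R ?e + u" "(1 / real (Suc n)) *\<^sub>R ?e"] by simp
      moreover have "norm ((1 / real (Suc n)) *\<^sub>R ?e) \<le> 1" by simp
      ultimately have "norm ((1 / real (Suc n)) *\<^sub>R ?e + u) > B" using u by linarith
      then show ?thesis using K(2) B by fastforce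
    qed
    ultimately show ?thesis using C(1) by (simp add: q_def)
  qed
  have q_meas: "q n \<in> borel_measurable lborel" for n
    unfolding q_def using int_shift[THEN borel_measurable_integrable] F_meas by measurable
  have pd_meas: "pd i F \<in> borel_measurable lborel"
    using cpd borel_measurable_continuous_onI by auto
  show "integrable lborel (pd i F)"
    by (rule integrable_dominated_convergence[where s=q, OF pd_meas q_meas wint]) (use lim bnd in auto)
  have "(\<lambda>n. LINT u|lborel. q n u) \<longlonglongrightarrow> (LINT u|lborel. pd i F u)"
    by (rule integral_dominated_convergence[where s=q, OF pd_meas q_meas wint]) (use lim bnd in auto)
  then show "(LINT u|lborel. pd i F u) = 0"
    unfolding q0 using LIMSEQ_unique tendsto_const by metis
qed

text \<open>The disc \<bar>x\<bar>^2 < a has area pi a, linear in a, and half-lines generate the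
  Borel sets. This is the benefit of the variable t = \<bar>x\<bar>^2: radial integrals carry no
  weight.\<close>

lemma distr_norm_square_lborel:
  "distr (lborel :: (real^2) measure) borel (\<lambda>x. x \<bullet> x) = density lborel (\<lambda>t. ennreal pi * indicator {0<..} t)"
  (is "?N = ?D")
proof (rule measure_eqI_generator_eq[where E="range (\<lambda>a::real. {..<a})" and \<Omega>=UNIV and A="\<lambda>n. {..<real n}"])
  show "Int_stable (range (\<lambda>a::real. {..<a}))"
    unfolding Int_stable_def
  proof safe
    fix a b :: real
    have "{..<a} \<inter> {..<b} = {..<min a b}" by auto
    then show "{..<a} \<inter> {..<b} \<in> range lessThan" by simp
  qed
  show "sets ?N = sigma_sets UNIV (range lessThan)" "sets ?D = sigma_sets UNIV (range lessThan)"
    by (simp_all add: borel_Iio)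
  have N: "emeasure ?N {..<a} = ennreal (pi * max 0 a)" for a
  proof -
    have "(\<lambda>x::real^2. x \<bullet> x) -` {..<a} = ball 0 (sqrt (max 0 a))"
      by (auto simp: norm_eq_sqrt_inner less_max_iff_disj leD)
    then have "emeasure ?N {..<a} = emeasure lborel (ball (0::real^2) (sqrt (max 0 a)))"
      by (subst emeasure_distr) auto
    also have "\<dots> = ennreal (pi * max 0 a)"
      by (subst emeasure_ball) (auto simp: unit_ball_vol_2)
    finally show ?thesis .
  qed
  show "emeasure ?N X = emeasure ?D X" if X': "X \<in> range lessThan" for X
  proof -
    obtain a where X: "X = {..<a}" using X' by blast
    have "emeasure ?D {..<a} = (\<integral>\<^sup>+t. ennreal pi * indicator {0<..<max 0 a} t \<partial>lborel)"
      by (subst emeasure_density) (auto intro!: nn_integral_cong simp: indicator_def)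
    also have "\<dots> = ennreal (pi * max 0 a)"
      by (subst nn_integral_cmult_indicator) (auto simp: ennreal_mult)
    finally show ?thesis using N X by simp
  qed
  show "emeasure ?N {..<real i} \<noteq> \<infinity>" for i by (simp add: N)
  show "(\<Union>i. {..<real i}) = UNIV" using reals_Archimedean2 by auto
qed auto

lemma integral_radial:
  fixes k :: "real \<Rightarrow> real"
  assumes k: "k \<in> borel_measurable borel"
  shows "integrable (lborel :: (real^2) measure) (\<lambda>x. k (x \<bullet> x)) \<longleftrightarrow> integrable lborel (\<lambda>t. indicator {0<..} t * k t)"
    and "(LINT x|(lborel :: (real^2) measure). k (x \<bullet> x)) = pi * (LINT t|lborel. indicator {0<..} t * k t)"
proof -
  have D: "density lborel (\<lambda>t. ennreal pi * indicator {0<..} t) = density lborel (\<lambda>t. ennreal (pi * indicator {0<..} t))"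
    by (rule arg_cong[where f="density lborel"]) (auto simp: fun_eq_iff split: split_indicator)
  have m: "(\<lambda>x::real^2. x \<bullet> x) \<in> measurable lborel borel" by simp
  have "integrable (lborel :: (real^2) measure) (\<lambda>x. k (x \<bullet> x)) \<longleftrightarrow>
      integrable (density lborel (\<lambda>t. ennreal (pi * indicator {0<..} t))) k"
    using integrable_distr_eq[OF m k] unfolding distr_norm_square_lborel D by simp
  also have "\<dots> \<longleftrightarrow> integrable lborel (\<lambda>t. pi * (indicator {0<..} t * k t))"
    by (subst integrable_density) (use k in \<open>auto simp: mult.assoc\<close>)
  also have "\<dots> \<longleftrightarrow> integrable lborel (\<lambda>t. indicator {0<..} t * k t)"
    by (rule integrable_mult_left_iff[THEN trans]) simp
  finally show "integrable (lborel :: (real^2) measure) (\<lambda>x. k (x \<bullet> x)) \<longleftrightarrow> integrable lborel (\<lambda>t. indicator {0<..} t * k t)" .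
  have "(LINT x|(lborel :: (real^2) measure). k (x \<bullet> x)) =
      (LINT t|density lborel (\<lambda>t. ennreal (pi * indicator {0<..} t)). k t)"
    using integral_distr[OF m k] unfolding distr_norm_square_lborel D by simp
  also have "\<dots> = (LINT t|lborel. pi * (indicator {0<..} t * k t))"
    by (subst integral_density) (use k in \<open>auto simp: mult.assoc\<close>)
  finally show "(LINT x|(lborel :: (real^2) measure). k (x \<bullet> x)) = pi * (LINT t|lborel. indicator {0<..} t * k t)"
    by simp
qed

text \<open>The real function is regarded as one with values in \<open>real^1\<close>, to which the
  change of variables for vector-valued functions applies.\<close>

lemma absolute_integral_change_of_variables_real:
  fixes f :: "real^2 \<Rightarrow> real" and g :: "real^2 \<Rightarrow> real^2"
  assumes S: "S \<in> sets lebesgue"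
    and der: "\<And>x. x \<in> S \<Longrightarrow> (g has_derivative g' x) (at x within S)" and inj: "inj_on g S"
  shows "(\<lambda>x. \<bar>det (matrix (g' x))\<bar> * f (g x)) absolutely_integrable_on S \<and>
           integral S (\<lambda>x. \<bar>det (matrix (g' x))\<bar> * f (g x)) = b
     \<longleftrightarrow> f absolutely_integrable_on (g ` S) \<and> integral (g ` S) f = b"
proof -
  have eq: "h absolutely_integrable_on T \<and> integral T h = b \<longleftrightarrow>
      (\<lambda>x. vec (h x) :: real^1) absolutely_integrable_on T \<and> integral T (\<lambda>x. vec (h x) :: real^1) = vec b"
    for h :: "real^2 \<Rightarrow> real" and T
  proof -
    show ?thesis
      by (simp add: absolutely_integrable_on_1_iff integral_on_1_eq vec_eq_iff)
  qed
  have v: "(vec (a * c) :: real^1) = a *\<^sub>R vec c" for a c by (simp add: vec_eq_iff)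
  show ?thesis
    unfolding eq[where h="\<lambda>x. \<bar>det (matrix (g' x))\<bar> * f (g x)"] eq[where h=f]
    using has_absolute_integral_change_of_variables[OF S der inj, of "\<lambda>x. vec (f x) :: real^1" "vec b"]
    by (simp add: v)
qed

section \<open>Parametrized patches\<close>

lemma bounded_linear_matrix_vec_nth: "bounded_linear (\<lambda>v::real^'n. (B *v v) $ m)"
  by (intro bounded_linear_compose[OF bounded_linear_vec_nth matrix_vector_mul_bounded_linear])

context
  fixes M :: "(real^3) set" and U and X :: "real^2 \<Rightarrow> real^3"
  assumes lp: "local_param M U X"
begin

lemma local_param_open: "open U" using lp by (simp add: local_param_def)

lemma local_param_Ck_on: "Ck_on k X U"
  using lp real_analytic_imp_Ck_on by (auto simp: local_param_def)

lemma local_param_differentiable: "u \<in> U \<Longrightarrow> X differentiable (at u)"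
  using local_param_Ck_on[of 1] by (simp add: differentiable_on_eq_differentiable_at[OF local_param_open])

lemma local_param_continuous_on: "continuous_on U X"
  using Ck_on_imp_continuous_on[OF local_param_open local_param_Ck_on] .

lemma local_param_inj_on: "inj_on X U"
  using lp unfolding local_param_def homeomorphism_def by (metis inj_on_inverseI)

lemma local_param_subset: "X ` U \<subseteq> M"
  using lp unfolding local_param_def by (blast dest: openin_imp_subset)

lemma local_param_continuous_on_inverse: "continuous_on (X ` U) (inv_into U X)"
proof -
  obtain Y where Y: "homeomorphism U (X ` U) X Y" using lp by (auto simp: local_param_def)
  have "inv_into U X P = Y P" if "P \<in> X ` U" for P
    using that Y local_param_inj_on by (metis homeomorphism_apply1 image_iff inv_into_f_f)
  then show ?thesis using Y continuous_on_cong[of "X ` U" "X ` U" "inv_into U X" Y]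
    by (simp add: homeomorphism_def)
qed

lemma local_param_openin_image:
  assumes "open V" "V \<subseteq> U"
  shows "openin (top_of_set M) (X ` V)"
proof -
  obtain Y where Y: "homeomorphism U (X ` U) X Y" using lp by (auto simp: local_param_def)
  have "openin (top_of_set U) V" using assms by (simp add: openin_open_eq local_param_open)
  then have "openin (top_of_set (X ` U)) (X ` V)"
    using homeomorphism_imp_open_map[OF Y] by blast
  then show ?thesis using lp openin_trans by (auto simp: local_param_def)
qed

lemma local_param_restrict:
  assumes "open V" "V \<subseteq> U"
  shows "local_param M V X"
proof -
  obtain Y where Y: "homeomorphism U (X ` U) X Y" using lp by (auto simp: local_param_def)
  have "homeomorphism V (X ` V) X Y"
    by (rule homeomorphism_of_subsets[OF Y assms(2)]) auto
  then show ?thesis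
    using lp assms local_param_openin_image[OF assms]
    unfolding local_param_def real_analytic_on_def by blast
qed

lemma local_param_open_vimage:
  assumes "openin (top_of_set M) W"
  shows "open {u \<in> U. X u \<in> W}"
proof -
  obtain T where T: "open T" "W = M \<inter> T" using assms by (auto simp: openin_open)
  have "{u \<in> U. X u \<in> W} = U \<inter> X -` T" using T local_param_subset by auto
  then show ?thesis
    using continuous_open_preimage[OF local_param_continuous_on local_param_open T(1)] by simp
qed

lemma Ck_on_pd_param: "Ck_on k (pd i X) U"
  using local_param_Ck_on[of "Suc k"] by simp

lemma Ck_on_induced_metric: "Ck_on k (\<lambda>u. induced_metric X u $ i $ j) U"
  unfolding induced_metric_def
  by (simp, rule Ck_on_inner[OF local_param_open Ck_on_pd_param Ck_on_pd_param])

text \<open>This is the Gram determinant of the partial derivatives a and b. If it vanishes, then w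
  = (b . b) a - (a . b) b satisfies w . w = (b . b) det = 0, and injectivity of the derivative turns
  w = 0 into b = 0, which it also excludes.\<close>

lemma det_induced_metric_pos:
  assumes u: "u \<in> U"
  shows "det (induced_metric X u) > 0"
proof -
  let ?D = "frechet_derivative X (at u)"
  define a b where "a = pd 1 X u" and "b = pd 2 X u"
  have lin: "linear ?D" using local_param_differentiable[OF u] linear_frechet_derivative by blast
  have injD: "inj ?D" using lp u by (auto simp: local_param_def)
  have det: "det (induced_metric X u) = (a \<bullet> a) * (b \<bullet> b) - (a \<bullet> b)\<^sup>2"
    by (simp add: det_2 induced_metric_def a_def b_def inner_commute power2_eq_square)
  have eq: "(b \<bullet> b) *\<^sub>R a - (a \<bullet> b) *\<^sub>R b = ?D ((b \<bullet> b) *\<^sub>R axis 1 1 - (a \<bullet> b) *\<^sub>R axis 2 1)"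
    by (simp add: a_def b_def pd_def linear_diff[OF lin] linear_scale[OF lin])
  have b0: "b \<noteq> 0"
  proof
    assume "b = 0"
    then have "?D (axis 2 1) = ?D 0" by (simp add: b_def pd_def linear_0[OF lin])
    then show False using injD by (simp add: inj_eq axis_eq_0_iff)
  qed
  have "det (induced_metric X u) \<noteq> 0"
  proof
    assume "det (induced_metric X u) = 0"
    then have d0: "(a \<bullet> a) * (b \<bullet> b) = (a \<bullet> b)\<^sup>2" using det by simp
    define w where "w = (b \<bullet> b) *\<^sub>R a - (a \<bullet> b) *\<^sub>R b"
    have "w \<bullet> w = (b \<bullet> b) * ((a \<bullet> a) * (b \<bullet> b) - (a \<bullet> b)\<^sup>2)"
      by (simp add: w_def inner_diff_left inner_diff_right inner_commute[of b a] power2_eq_square algebra_simps)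
    then have "w = 0" using d0 by simp
    then have "?D ((b \<bullet> b) *\<^sub>R axis 1 1 - (a \<bullet> b) *\<^sub>R axis 2 1) = ?D 0"
      using eq by (simp add: w_def linear_0[OF lin])
    then have z: "(b \<bullet> b) *\<^sub>R axis 1 1 - (a \<bullet> b) *\<^sub>R axis 2 1 = (0 :: real^2)"
      using injD by (simp add: inj_eq)
    have "b \<bullet> b = 0" using arg_cong[OF z, of "\<lambda>v. v $ 1"] by (simp add: axis_def)
    then show False using b0 by simp
  qed
  moreover have "(a \<bullet> b)\<^sup>2 \<le> (a \<bullet> a) * (b \<bullet> b)" by (rule Cauchy_Schwarz_ineq)
  ultimately show ?thesis using det by linarith
qed

lemma area_density_pos: "u \<in> U \<Longrightarrow> area_density X u > 0"
  unfolding area_density_def using det_induced_metric_pos by simp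

lemma Ck_on_det_induced_metric: "Ck_on k (\<lambda>u. det (induced_metric X u)) U"
  unfolding det_2 by (intro Ck_on_diff Ck_on_mult local_param_open Ck_on_induced_metric)

lemma Ck_on_area_density: "Ck_on 1 (area_density X) U"
proof -
  have "Ck_real 0 (\<lambda>t. inverse (sqrt t) / 2) {0<..}"
    by (auto intro!: continuous_intros)
  then have "Ck_real 1 sqrt {0<..}"
    unfolding One_nat_def by (rule Ck_real_SucI[rotated]) (auto intro!: DERIV_real_sqrt)
  then show ?thesis
    unfolding area_density_def[abs_def]
    by (intro Ck_on_compose_real[OF local_param_open Ck_on_det_induced_metric, where T="{0<..}"])
       (auto intro: det_induced_metric_pos)
qed

lemma continuous_on_area_density: "continuous_on U (area_density X)"
  using Ck_on_imp_continuous_on[OF local_param_open Ck_on_area_density] .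

lemma matrix_inv_induced_metric:
  assumes "u \<in> U"
  defines "g \<equiv> induced_metric X u"
  shows "matrix_inv g $ 1 $ 1 = g $ 2 $ 2 / det g" "matrix_inv g $ 2 $ 2 = g $ 1 $ 1 / det g"
    "matrix_inv g $ 1 $ 2 = - g $ 1 $ 2 / det g" "matrix_inv g $ 2 $ 1 = - g $ 2 $ 1 / det g"
proof -
  define d where "d = det g"
  have d: "d \<noteq> 0" using det_induced_metric_pos[OF assms(1)] by (simp add: g_def d_def)
  have dd: "d = g $ 1 $ 1 * g $ 2 $ 2 - g $ 1 $ 2 * g $ 2 $ 1" by (simp add: d_def det_2)
  define B :: "real^2^2" where
    "B = vector [vector [g $ 2 $ 2 / d, - g $ 1 $ 2 / d], vector [- g $ 2 $ 1 / d, g $ 1 $ 1 / d]]"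
  have "g ** B = mat 1"
    using d by (simp add: vec_eq_iff matrix_matrix_mult_def sum_2 forall_2 B_def mat_def field_simps)
      (simp add: dd)
  moreover from this have "B ** g = mat 1" by (simp add: matrix_left_right_inverse)
  \<comment> \<open>\<open>matrix_inv\<close> chooses a two-sided inverse, and associativity makes
    it unique.\<close>
  ultimately have "matrix_inv g = B"
    unfolding matrix_inv_def
    by (intro some_equality) (metis matrix_mul_assoc matrix_mul_lid matrix_mul_rid)+
  then show "matrix_inv g $ 1 $ 1 = g $ 2 $ 2 / det g" "matrix_inv g $ 2 $ 2 = g $ 1 $ 1 / det g"
    "matrix_inv g $ 1 $ 2 = - g $ 1 $ 2 / det g" "matrix_inv g $ 2 $ 1 = - g $ 2 $ 1 / det g"
    by (simp_all add: B_def d_def)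
qed

lemma Ck_on_matrix_inv: "Ck_on 1 (\<lambda>u. matrix_inv (induced_metric X u) $ i $ j) U"
proof -
  have "Ck_real 0 (\<lambda>t::real. - (inverse t ^ 2)) {0<..}"
    by (auto intro!: continuous_intros)
  then have "Ck_real 1 inverse {0<..}"
    unfolding One_nat_def
    by (rule Ck_real_SucI[rotated]) (auto intro!: derivative_eq_intros simp: power2_eq_square)
  then have c: "Ck_on 1 (\<lambda>u. inverse (det (induced_metric X u))) U"
    by (intro Ck_on_compose_real[OF local_param_open Ck_on_det_induced_metric, where T="{0<..}"])
       (auto intro: det_induced_metric_pos)
  have m: "Ck_on 1 (\<lambda>u. induced_metric X u $ k $ l * inverse (det (induced_metric X u))) U"
    "Ck_on 1 (\<lambda>u. - induced_metric X u $ k $ l * inverse (det (induced_metric X u))) U" for k l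
    by (intro Ck_on_mult Ck_on_minus local_param_open Ck_on_induced_metric c)+
  have cg: "Ck_on 1 (\<lambda>u. matrix_inv (induced_metric X u) $ i $ j) U"
    if "Ck_on 1 F U" "\<And>u. u \<in> U \<Longrightarrow> matrix_inv (induced_metric X u) $ i $ j = F u" for F
    by (rule Ck_on_cong[OF local_param_open, THEN iffD1, OF _ that(1)]) (use that(2) in simp)
  consider "i = 1" "j = 1" | "i = 1" "j = 2" | "i = 2" "j = 1" | "i = 2" "j = 2"
    using exhaust_2 by metis
  then show ?thesis
  proof cases
    case 1
    show ?thesis
      by (rule cg[OF m(1)[of 2 2]]) (simp add: 1 matrix_inv_induced_metric divide_inverse)
  next
    case 2
    show ?thesis
      by (rule cg[OF m(2)[of 1 2]]) (simp add: 2 matrix_inv_induced_metric divide_inverse)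
  next
    case 3
    show ?thesis
      by (rule cg[OF m(2)[of 2 1]]) (simp add: 3 matrix_inv_induced_metric divide_inverse)
  next
    case 4
    show ?thesis
      by (rule cg[OF m(1)[of 1 1]]) (simp add: 4 matrix_inv_induced_metric divide_inverse)
  qed
qed

text \<open>The condition on patches says that \<open>\<sigma>\<close> restricted to the patch is the image under \<open>X\<close> of the
  measure with density \<open>area_density X\<close>.\<close>

lemma area_measure_patch_integral:
  assumes \<sigma>: "area_measure M \<sigma>"
    and F: "(\<lambda>u. indicator U u * F (X u)) \<in> borel_measurable borel"
    and F0: "\<And>P. P \<in> M \<Longrightarrow> P \<notin> X ` U \<Longrightarrow> F P = (0::real)"
  shows "(LINT P|\<sigma>. F P) = (LINT u|lborel. indicator U u * (F (X u) * area_density X u))"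
proof -
  have sp: "space \<sigma> = M" and ss: "sets \<sigma> = sets (restrict_space borel M)"
    and em: "\<And>B. B \<in> sets borel \<Longrightarrow> B \<subseteq> U \<Longrightarrow>
      emeasure \<sigma> (X ` B) = (\<integral>\<^sup>+u\<in>B. ennreal (area_density X u) \<partial>lborel)"
    using \<sigma> lp unfolding area_measure_def by blast+
  let ?I = "X ` U"
  obtain T where T: "open T" "?I = M \<inter> T" using lp by (auto simp: local_param_def openin_open)
  have Iset: "?I \<in> sets \<sigma>" unfolding ss using T by (auto simp: sets_restrict_space)
  define N where "N = restrict_space \<sigma> ?I"
  have spN: "space N = ?I" using local_param_subset sp by (auto simp: N_def space_restrict_space)
  have setsN: "sets N = sets (restrict_space borel ?I)"
  proof -
    have "sets N = sets (restrict_space (restrict_space borel M) ?I)"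
      unfolding N_def by (rule sets_restrict_space_cong[OF ss])
    also have "\<dots> = sets (restrict_space borel ?I)"
      using local_param_subset by (simp add: sets_restrict_restrict_space Int_absorb1)
    finally show ?thesis .
  qed
  define L where "L = density (restrict_space lborel U) (\<lambda>u. ennreal (area_density X u))"
  have Uset: "U \<in> sets borel" using local_param_open by simp
  have spL: "space L = U" by (simp add: L_def space_restrict_space)
  have setsL: "sets L = sets (restrict_space borel U)"
    unfolding L_def using sets_restrict_space_cong[OF sets_lborel] by simp
  have ad_meas: "(\<lambda>u. area_density X u) \<in> borel_measurable (restrict_space lborel U)"
    using borel_measurable_continuous_on_restrict[OF continuous_on_area_density]
      measurable_cong_sets[OF sets_restrict_space_cong[OF sets_lborel] refl] by blast
  have Xm: "X \<in> measurable L N"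
  proof -
    have "X \<in> measurable (restrict_space borel U) (restrict_space borel ?I)"
      by (rule measurable_restrict_space2)
         (auto simp: space_restrict_space intro: borel_measurable_continuous_on_restrict[OF local_param_continuous_on])
    then show ?thesis using measurable_cong_sets[OF setsL setsN] by blast
  qed
  have distr: "distr L N X = N"
  proof (rule measure_eqI)
    fix A assume "A \<in> sets (distr L N X)"
    then have A: "A \<in> sets N" by simp
    then have AI: "A \<subseteq> ?I" using sets.sets_into_space spN by blast
    define B where "B = X -` A \<inter> U"
    have XB: "X ` B = A" using AI by (auto simp: B_def)
    have BL: "B \<in> sets L" using measurable_sets[OF Xm A] spL by (simp add: B_def)
    then have B: "B \<in> sets borel" "B \<subseteq> U"
      using Uset unfolding setsL by (auto simp: sets_restrict_space)
    have "emeasure (distr L N X) A = emeasure L B"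
      using emeasure_distr[OF Xm A] by (simp add: B_def spL)
    also have "\<dots> = (\<integral>\<^sup>+u\<in>B. ennreal (area_density X u) \<partial>restrict_space lborel U)"
      unfolding L_def by (rule emeasure_density) (use ad_meas BL in \<open>auto simp: L_def\<close>)
    also have "\<dots> = (\<integral>\<^sup>+u. ennreal (area_density X u) * indicator B u * indicator U u \<partial>lborel)"
      by (rule nn_integral_restrict_space) (use Uset in auto)
    also have "\<dots> = (\<integral>\<^sup>+u\<in>B. ennreal (area_density X u) \<partial>lborel)"
      by (rule nn_integral_cong) (use B in \<open>auto simp: indicator_def\<close>)
    also have "\<dots> = emeasure \<sigma> A" using em[OF B] XB by simp
    also have "\<dots> = emeasure N A"
      unfolding N_def using emeasure_restrict_space[of ?I \<sigma> A] Iset AI sp local_param_subset by (auto simp: Int_absorb2)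
    finally show "emeasure (distr L N X) A = emeasure N A" .
  qed simp
  \<comment> \<open>Measurability is given for the pullback of F only; composing with the continuous
    inverse of the chart carries it to the patch.\<close>
  have FN: "F \<in> borel_measurable N"
  proof -
    have "inv_into U X \<in> measurable N borel"
      using borel_measurable_continuous_on_restrict[OF local_param_continuous_on_inverse]
        measurable_cong_sets[OF setsN refl] by blast
    from measurable_compose[OF this F]
    have "(\<lambda>P. indicator U (inv_into U X P) * F (X (inv_into U X P))) \<in> borel_measurable N" .
    then show ?thesis
      by (rule measurable_cong[THEN iffD1, rotated])
         (auto simp: spN inv_into_f_f[OF local_param_inj_on])
  qed
  have "(LINT P|\<sigma>. F P) = (LINT P|\<sigma>. indicator ?I P *\<^sub>R F P)"
    by (rule Bochner_Integration.integral_cong) (use F0 sp in \<open>auto simp: indicator_def\<close>)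
  also have "\<dots> = (LINT P|N. F P)"
    unfolding N_def by (rule integral_restrict_space[symmetric]) (use Iset sets.Int_space_eq2 in auto)
  also have "\<dots> = (LINT P|distr L N X. F P)" by (simp add: distr)
  also have "\<dots> = (LINT u|L. F (X u))" by (rule integral_distr[OF Xm FN])
  also have "\<dots> = (LINT u|restrict_space lborel U. area_density X u *\<^sub>R F (X u))"
    unfolding L_def
  proof (rule integral_density)
    show "(\<lambda>u. F (X u)) \<in> borel_measurable (restrict_space lborel U)"
      using measurable_compose[OF Xm FN] by (simp add: L_def)
    show "AE u in restrict_space lborel U. 0 \<le> area_density X u"
      by (rule AE_I2) (use area_density_pos in \<open>auto simp: space_restrict_space intro: less_imp_le\<close>)
  qed (rule ad_meas)
  also have "\<dots> = (LINT u|lborel. indicator U u *\<^sub>R (area_density X u *\<^sub>R F (X u)))"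
    by (rule integral_restrict_space) (use Uset in auto)
  finally show ?thesis by (simp add: mult_ac)
qed

end

text \<open>Meant for points off the support of a test function and for indicators of clopen
  sets.\<close>

lemma LB_locally_const:
  assumes "open V" "u \<in> V" "\<And>w. w \<in> V \<Longrightarrow> v w = c"
  shows "LB X v u = 0"
proof -
  have "pd j v w = 0" if "w \<in> V" for j w
    using pd_cong_open[OF assms(1) that, of v "\<lambda>_. c"] assms(3) by (simp add: pd_const)
  then have "pd i (\<lambda>w. area_density X w *
      (\<Sum>j\<in>UNIV. matrix_inv (induced_metric X w) $ i $ j * pd j v w)) u = pd i (\<lambda>_. 0) u" for i
    by (intro pd_cong_open[OF assms(1,2)]) simp
  then show ?thesis by (simp add: LB_def pd_const)
qed

section \<open>The equation of the Green function on an axially symmetric patch\<close>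

text \<open>The primitive of -b that vanishes at the right end. Being constant below \<alpha>, it
  gives test functions that are constant near the pole; being 0 above \<beta>, it keeps their
  support inside the patch.\<close>

lemma bump_antiderivative:
  fixes b :: "real \<Rightarrow> real"
  assumes b: "\<And>k. Ck_real k b UNIV" and b0: "\<And>t. t \<le> \<alpha> \<or> \<beta> \<le> t \<Longrightarrow> b t = 0" and "\<alpha> < \<beta>"
  obtains h where "\<And>k. Ck_real k h UNIV" "\<And>t. (h has_real_derivative - b t) (at t)"
    "\<And>t. \<beta> \<le> t \<Longrightarrow> h t = 0" "\<And>t. t \<le> \<alpha> \<Longrightarrow> h t = h \<alpha>"
proof -
  have cb: "continuous_on UNIV b" using b[of 0] by simp
  \<comment> \<open>Starting at \<alpha> - 1 puts \<alpha> into the interior of the interval of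
    integration, so that a two-sided derivative is obtained there too.\<close>
  define H where "H t = integral {\<alpha> - 1..t} b" for t
  have DH: "(H has_real_derivative b t) (at t)" for t
  proof (cases "t < \<alpha>")
    case True
    have H0: "H s = 0" if "s < \<alpha>" for s
      unfolding H_def by (rule integral_unique, rule has_integral_is_0) (use b0 that in auto)
    have "((\<lambda>_. 0) has_real_derivative b t) (at t)" using b0 True by simp
    then show ?thesis
      by (rule has_field_derivative_transform_within_open[of _ _ _ "{..<\<alpha>}"]) (use True H0 in auto)
  next
    case False
    have "(H has_real_derivative b t) (at t within {\<alpha> - 1..t + 1})"
      unfolding H_def[abs_def]
      by (rule integral_has_real_derivative) (use False continuous_on_subset[OF cb] in auto)
    then show ?thesis using False at_within_Icc_at[of "\<alpha> - 1" t "t + 1"] by simp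
  qed
  define h where "h t = H \<beta> - H t" for t
  have Dh: "(h has_real_derivative - b t) (at t)" for t
    unfolding h_def[abs_def] using DERIV_diff[OF DERIV_const DH, of "H \<beta>" t] by simp
  have const: "h s = h t" if "s \<le> t" "\<And>r. s \<le> r \<Longrightarrow> r \<le> t \<Longrightarrow> b r = 0" for s t
  proof (cases "s = t")
    case False
    then have "s < t" using that by simp
    then obtain r where "s < r" "r < t" "h t - h s = (t - s) * - b r"
      using MVT2[of s t h "\<lambda>r. - b r"] Dh by blast
    then show ?thesis using that(2)[of r] by simp
  qed simp
  show ?thesis
  proof (rule that)
    show "Ck_real k h UNIV" for k
    proof (cases k)
      case 0
      then show ?thesis using Dh by (auto intro!: continuous_at_imp_continuous_on DERIV_isCont)
    next
      case (Suc m)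
      have "Ck_real m (\<lambda>t. (-1) * b t) UNIV" by (intro Ck_real_mult Ck_real_const b)
      then have "Ck_real m (\<lambda>t. - b t) UNIV" by simp
      then show ?thesis unfolding Suc using Dh by (intro Ck_real_SucI[of _ h "\<lambda>t. - b t"]) auto
    qed
    show "(h has_real_derivative - b t) (at t)" for t by (rule Dh)
    show "h t = 0" if "\<beta> \<le> t" for t
      using const[OF that] b0 by (simp add: h_def)
    show "h t = h \<alpha>" if "t \<le> \<alpha>" for t
      using const[OF that] b0 by simp
  qed
qed

text \<open>The columns of A are an orthonormal frame whose third vector serves as the normal at Q;
  \<theta> is the projection along it, and \<open>height\<close> makes the patch a graph over a
  disc. X stays a general analytic parametrization, related to the graph by the Jacobian
  \<open>J\<close> of \<theta>.\<close>

locale axial_patch =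
  fixes M :: "(real^3) set" and A :: "real^3^3" and Q :: "real^3"
    and U :: "(real^2) set" and X :: "real^2 \<Rightarrow> real^3" and u0 :: "real^2"
    and a \<delta> :: real and f f' :: "real \<Rightarrow> real" and \<theta> :: "real^2 \<Rightarrow> real^2"
  assumes lp: "local_param M U X"
    and orth: "orthogonal_matrix A"
    and theta: "\<theta> = (\<lambda>u. vector [(transpose A *v (X u - Q)) $ 1, (transpose A *v (X u - Q)) $ 2])"
    and homeo: "\<exists>g. homeomorphism U (ball 0 (sqrt \<delta>)) \<theta> g"
    and curve: "profile_curve a \<delta> f f'"
    and height: "\<And>u. u \<in> U \<Longrightarrow> (transpose A *v (X u - Q)) $ 3 = f (\<theta> u \<bullet> \<theta> u)"
    and u0: "u0 \<in> U" "X u0 = Q"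
begin

definition p :: "3 \<Rightarrow> real^2 \<Rightarrow> real" where "p m u = (transpose A *v (X u - Q)) $ m"

text \<open>The same quantity as \<open>\<tau>\<close>, but as a polynomial on space, so that test
  functions built from it can be examined in every parametrization of M.\<close>

definition axial_sq :: "real^3 \<Rightarrow> real" where
  "axial_sq P = ((transpose A *v (P - Q)) $ 1)\<^sup>2 + ((transpose A *v (P - Q)) $ 2)\<^sup>2"

definition \<tau> :: "real^2 \<Rightarrow> real" where "\<tau> u = (p 1 u)\<^sup>2 + (p 2 u)\<^sup>2"

definition J :: "real^2 \<Rightarrow> real" where "J u = pd 1 (p 1) u * pd 2 (p 2) u - pd 2 (p 1) u * pd 1 (p 2) u"

section \<open>Coordinates and metric on the patch\<close>

lemmas opU = local_param_open[OF lp]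

lemma axial_sq_X: "axial_sq (X u) = \<tau> u" by (simp add: axial_sq_def \<tau>_def p_def)

lemma theta_inner: "\<theta> u \<bullet> \<theta> u = \<tau> u"
  by (simp add: theta inner_vec_def sum_2 \<tau>_def p_def power2_eq_square)

lemma height': "u \<in> U \<Longrightarrow> p 3 u = f (\<tau> u)"
  using height[of u] by (simp add: theta_inner p_def)

lemma Ck_on_p: "Ck_on k (p m) U"
proof -
  have "Ck_on k (\<lambda>u. X u - Q) U"
    by (intro Ck_on_diff Ck_on_const opU local_param_Ck_on[OF lp])
  from Ck_on_linear[OF opU bounded_linear_matrix_vec_nth this, of "transpose A" m]
  show ?thesis by (simp add: p_def[abs_def])
qed

lemma p_differentiable: "u \<in> U \<Longrightarrow> p m differentiable (at u)"
  using Ck_on_p[of 1 m] by (simp add: differentiable_on_eq_differentiable_at[OF opU])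

lemma Ck_on_tau: "Ck_on k \<tau> U"
  unfolding \<tau>_def[abs_def] power2_eq_square
  by (intro Ck_on_add Ck_on_mult opU Ck_on_p)

lemma tau_differentiable: "u \<in> U \<Longrightarrow> \<tau> differentiable (at u)"
  using Ck_on_tau[of 1] by (simp add: differentiable_on_eq_differentiable_at[OF opU])

lemma continuous_on_tau: "continuous_on U \<tau>"
  using Ck_on_imp_continuous_on[OF opU Ck_on_tau] .

lemma pd_tau: "u \<in> U \<Longrightarrow> pd i \<tau> u = 2 * (p 1 u * pd i (p 1) u + p 2 u * pd i (p 2) u)"
  unfolding \<tau>_def[abs_def] power2_eq_square
  by (subst pd_add) (auto intro!: differentiable_mult p_differentiable simp: pd_mult p_differentiable)

lemma tau_nonneg: "\<tau> u \<ge> 0" by (simp add: \<tau>_def)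

lemma tau_lt: "u \<in> U \<Longrightarrow> \<tau> u < \<delta>"
proof -
  assume "u \<in> U"
  then have "\<theta> u \<in> ball 0 (sqrt \<delta>)" using homeo by (auto simp: homeomorphism_def)
  then have "sqrt (\<theta> u \<bullet> \<theta> u) < sqrt \<delta>" by (simp add: norm_eq_sqrt_inner)
  then show ?thesis by (simp add: theta_inner)
qed

lemma theta_inj: "inj_on \<theta> U"
  using homeo unfolding homeomorphism_def by (metis inj_on_inverseI)

lemma theta_image: "\<theta> ` U = ball 0 (sqrt \<delta>)"
  using homeo by (auto simp: homeomorphism_def)

lemma p_u0: "p m u0 = 0" using u0 by (simp add: p_def)

lemma tau_eq_0_iff: "u \<in> U \<Longrightarrow> \<tau> u = 0 \<longleftrightarrow> u = u0"
proof
  assume u: "u \<in> U" and "\<tau> u = 0"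
  then have "\<theta> u = 0" using theta_inner[of u] by simp
  moreover have "\<theta> u0 = 0" using theta_inner[of u0] by (simp add: \<tau>_def p_u0)
  ultimately show "u = u0" using theta_inj u u0 by (metis inj_onD)
qed (simp add: \<tau>_def p_u0)

lemma compact_tau_le: "\<beta> < \<delta> \<Longrightarrow> compact {u \<in> U. \<tau> u \<le> \<beta>}"
proof -
  assume \<beta>: "\<beta> < \<delta>"
  obtain g where g: "homeomorphism U (ball 0 (sqrt \<delta>)) \<theta> g" using homeo by blast
  have sub: "{x::real^2. x \<bullet> x \<le> \<beta>} \<subseteq> ball 0 (sqrt \<delta>)"
    using \<beta> by (auto simp: norm_eq_sqrt_inner)
  have "{x::real^2. x \<bullet> x \<le> \<beta>} = cball 0 (sqrt \<beta>)"
    by (auto simp: norm_eq_sqrt_inner)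
  then have "compact {x::real^2. x \<bullet> x \<le> \<beta>}" by simp
  then have "compact (g ` {x. x \<bullet> x \<le> \<beta>})"
    using g sub by (intro compact_continuous_image) (auto simp: homeomorphism_def intro: continuous_on_subset)
  moreover have "g ` {x. x \<bullet> x \<le> \<beta>} = {u \<in> U. \<tau> u \<le> \<beta>}"
    using g sub unfolding homeomorphism_def theta_inner[symmetric] by (force simp: image_iff)
  ultimately show ?thesis by simp
qed

lemma compact_tau_between:
  assumes "\<beta> < \<delta>" shows "compact {u \<in> U. \<alpha> \<le> \<tau> u \<and> \<tau> u \<le> \<beta>}"
proof -
  have "closedin (top_of_set {u \<in> U. \<tau> u \<le> \<beta>}) ({u \<in> U. \<tau> u \<le> \<beta>} \<inter> \<tau> -` {\<alpha>..})"
    by (rule continuous_closedin_preimage) (auto intro: continuous_on_subset[OF continuous_on_tau])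
  moreover have "{u \<in> U. \<tau> u \<le> \<beta>} \<inter> \<tau> -` {\<alpha>..} = {u \<in> U. \<alpha> \<le> \<tau> u \<and> \<tau> u \<le> \<beta>}" by auto
  ultimately show ?thesis using closedin_compact[OF compact_tau_le[OF assms]] by simp
qed

lemma orthogonal_transformation_transpose: "orthogonal_transformation ((*v) (transpose A))"
  using orth by (simp add: orthogonal_transformation_matrix)

lemma dist_X: "(dist (X u) Q)\<^sup>2 = \<tau> u + (p 3 u)\<^sup>2"
proof -
  have "norm (transpose A *v (X u - Q)) = norm (X u - Q)"
    by (rule orthogonal_transformation_norm[OF orthogonal_transformation_transpose])
  then have "(dist (X u) Q)\<^sup>2 = (norm (transpose A *v (X u - Q)))\<^sup>2" by (simp add: dist_norm)
  also have "\<dots> = \<tau> u + (p 3 u)\<^sup>2"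
    unfolding power2_norm_eq_inner by (simp add: inner_vec_def sum_3 \<tau>_def p_def power2_eq_square)
  finally show ?thesis .
qed

lemma pd_inner: "u \<in> U \<Longrightarrow> pd i X u \<bullet> pd j X u =
    pd i (p 1) u * pd j (p 1) u + pd i (p 2) u * pd j (p 2) u + pd i (p 3) u * pd j (p 3) u"
proof -
  assume u: "u \<in> U"
  have d: "(\<lambda>u. X u - Q) differentiable (at u)"
    using local_param_differentiable[OF lp u] by (auto intro: differentiable_diff)
  have pdX: "pd i (\<lambda>u. X u - Q) u = pd i X u" for i
    using pd_add[of X u "\<lambda>_. - Q" i] local_param_differentiable[OF lp u] by (simp add: pd_const)
  have e: "pd i (p m) u = (transpose A *v pd i X u) $ m" for i m
    unfolding p_def[abs_def] pd_linear[OF bounded_linear_matrix_vec_nth d] pdX ..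
  have "pd i X u \<bullet> pd j X u = (transpose A *v pd i X u) \<bullet> (transpose A *v pd j X u)"
    using orthogonal_transformation_transpose unfolding orthogonal_transformation_def by metis
  then show ?thesis by (simp add: inner_vec_def sum_3 e)
qed

lemma pd_p3:
  assumes u: "u \<in> U" "u \<noteq> u0"
  shows "pd i (p 3) u = f' (\<tau> u) * pd i \<tau> u"
proof -
  have "\<tau> u \<in> {0<..<\<delta>}" using u tau_lt tau_nonneg[of u] tau_eq_0_iff by (auto simp: less_le)
  then have "(f has_real_derivative f' (\<tau> u)) (at (\<tau> u))" using curve by (simp add: profile_curve_def)
  from pd_compose_real(1)[OF this tau_differentiable[OF u(1)], of i]
  have "pd i (\<lambda>u. f (\<tau> u)) u = f' (\<tau> u) * pd i \<tau> u" .
  moreover have "pd i (p 3) u = pd i (\<lambda>u. f (\<tau> u)) u"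
    by (rule pd_cong_open[OF opU u(1)]) (rule height')
  ultimately show ?thesis by simp
qed

text \<open>The metric is the pullback under \<theta> of the metric of the graph, whose determinant
  is 1 + 4 t f'^2.\<close>

lemma metric_det:
  assumes u: "u \<in> U" "u \<noteq> u0"
  shows "det (induced_metric X u) = (J u)\<^sup>2 * (1 + 4 * \<tau> u * (f' (\<tau> u))\<^sup>2)"
  unfolding det_2 induced_metric_def
  by (simp add: pd_inner[OF u(1)] pd_p3[OF u] pd_tau[OF u(1)] J_def \<tau>_def)
     (simp add: power2_eq_square algebra_simps)

lemma area_density_eq:
  assumes u: "u \<in> U" "u \<noteq> u0"
  shows "area_density X u = \<bar>J u\<bar> * profile_speed f' (\<tau> u)"
  unfolding area_density_def metric_det[OF u] by (simp add: real_sqrt_mult profile_speed_def)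

text \<open>The gradient of \<tau> times the area density; its coordinate divergence is the area
  density times the Laplacian of \<tau>.\<close>

definition tau_flux :: "2 \<Rightarrow> real^2 \<Rightarrow> real" where
  "tau_flux i u = area_density X u * (\<Sum>j\<in>UNIV. matrix_inv (induced_metric X u) $ i $ j * pd j \<tau> u)"

lemma Ck_on_tau_flux: "Ck_on 1 (tau_flux i) U"
  unfolding tau_flux_def[abs_def]
  by (intro Ck_on_mult Ck_on_sum Ck_on_area_density[OF lp] Ck_on_matrix_inv[OF lp] opU)
     (use Ck_on_tau[of "Suc 1"] in auto)

text \<open>On the graph the radial direction is stretched by S, so the gradient of \<bar>x\<bar>^2
  has squared length 4 t / S^2 in the metric. The area density \<bar>J\<bar> S supplies the
  remaining factor.\<close>

lemma grad_tau_pairing: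
  assumes u: "u \<in> U" "u \<noteq> u0"
  shows "(\<Sum>i\<in>UNIV. pd i \<tau> u * tau_flux i u) = \<bar>J u\<bar> * (4 * \<tau> u / profile_speed f' (\<tau> u))"
proof -
  define S where "S = profile_speed f' (\<tau> u)"
  have S: "S > 0" "S\<^sup>2 = 1 + 4 * \<tau> u * (f' (\<tau> u))\<^sup>2"
    unfolding S_def using profile_speed_ge_1[OF tau_nonneg, of f' u]
    by linarith (simp add: profile_speed_def tau_nonneg)
  have dp: "det (induced_metric X u) > 0" by (rule det_induced_metric_pos[OF lp u(1)])
  have det: "det (induced_metric X u) = (J u)\<^sup>2 * S\<^sup>2" using metric_det[OF u] S by simp
  then have J0: "J u \<noteq> 0" using dp by auto
  let ?g = "induced_metric X u"
  have "?g $ 2 $ 2 * (pd 1 \<tau> u)\<^sup>2 - ?g $ 1 $ 2 * (pd 1 \<tau> u * pd 2 \<tau> u) - ?g $ 2 $ 1 * (pd 1 \<tau> u * pd 2 \<tau> u)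
      + ?g $ 1 $ 1 * (pd 2 \<tau> u)\<^sup>2 = (J u)\<^sup>2 * (4 * \<tau> u)"
    unfolding induced_metric_def
    by (simp add: pd_inner[OF u(1)] pd_p3[OF u] pd_tau[OF u(1)] J_def \<tau>_def)
       (simp add: power2_eq_square algebra_simps)
  moreover have "(\<Sum>i\<in>UNIV. pd i \<tau> u * tau_flux i u) = area_density X u / det ?g *
     (?g $ 2 $ 2 * (pd 1 \<tau> u)\<^sup>2 - ?g $ 1 $ 2 * (pd 1 \<tau> u * pd 2 \<tau> u) - ?g $ 2 $ 1 * (pd 1 \<tau> u * pd 2 \<tau> u)
      + ?g $ 1 $ 1 * (pd 2 \<tau> u)\<^sup>2)"
    unfolding tau_flux_def sum_2 matrix_inv_induced_metric[OF lp u(1)] power2_eq_square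
    by (simp add: diff_divide_distrib add_divide_distrib algebra_simps)
  ultimately have "(\<Sum>i\<in>UNIV. pd i \<tau> u * tau_flux i u) = (\<bar>J u\<bar> * S) / ((J u)\<^sup>2 * S\<^sup>2) * ((J u)\<^sup>2 * (4 * \<tau> u))"
    using area_density_eq[OF u] det by (simp add: S_def)
  also have "\<dots> = \<bar>J u\<bar> * (4 * \<tau> u / S)" using J0 S(1) by (simp add: field_simps power2_eq_square)
  finally show ?thesis by (simp add: S_def)
qed

lemma theta_has_derivative:
  assumes u: "u \<in> U"
  shows "(\<theta> has_derivative frechet_derivative \<theta> (at u)) (at u)"
    "det (matrix (frechet_derivative \<theta> (at u))) = J u"
proof -
  have c: "\<theta> u $ 1 = p 1 u" "\<theta> u $ 2 = p 2 u" for u by (simp_all add: theta p_def)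
  have "(\<lambda>u. \<theta> u \<bullet> i) differentiable (at u)" if i: "i \<in> Basis" for i
  proof -
    obtain k where k: "i = axis k 1" using i by (auto simp: Basis_vec_def)
    then have "(\<lambda>u. \<theta> u \<bullet> i) = p 1 \<or> (\<lambda>u. \<theta> u \<bullet> i) = p 2"
      using exhaust_2[of k] c by (auto simp: inner_axis fun_eq_iff)
    then show ?thesis using p_differentiable[OF u] by metis
  qed
  then have d: "\<theta> differentiable (at u)" using differentiable_componentwise_within by blast
  then show "(\<theta> has_derivative frechet_derivative \<theta> (at u)) (at u)" by (simp add: frechet_derivative_works)
  have e: "pd i (\<lambda>u. \<theta> u $ k) u = pd i \<theta> u $ k" for i k
    by (rule pd_linear[OF bounded_linear_vec_nth d])
  have "(\<lambda>u. \<theta> u $ 1) = p 1" "(\<lambda>u. \<theta> u $ 2) = p 2" using c by auto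
  then have "pd i (p 1) u = pd i \<theta> u $ 1" "pd i (p 2) u = pd i \<theta> u $ 2" for i
    using e[of i 1] e[of i 2] by simp_all
  then show "det (matrix (frechet_derivative \<theta> (at u))) = J u"
    by (simp add: det_2 matrix_def J_def pd_def)
qed

lemma continuous_on_J: "continuous_on U J"
proof -
  have "continuous_on U (pd i (p m))" for i m using Ck_on_p[of 1 m] by simp
  then show ?thesis unfolding J_def[abs_def] by (intro continuous_intros)
qed

text \<open>Substituting y = \<theta> u absorbs \<bar>J\<bar>; the image of planar Lebesgue measure
  under \<bar>y\<bar>^2 is then pi dt.\<close>

lemma radial_integral:
  assumes \<alpha>\<beta>: "0 \<le> \<alpha>" "\<beta> < \<delta>" and k: "continuous_on {\<alpha>..\<beta>} k"
  shows "(LINT u|lborel. indicator U u * (\<bar>J u\<bar> * (indicator {\<alpha>..\<beta>} (\<tau> u) * k (\<tau> u)))) = pi * integral {\<alpha>..\<beta>} k"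
proof -
  define K where "K t = indicator {\<alpha>..\<beta>} t * k t" for t
  have Km: "K \<in> borel_measurable borel"
    unfolding K_def using borel_measurable_continuous_on_indicator[OF _ k] by simp
  have Kint: "integrable lborel (\<lambda>t. indicator {\<alpha>..\<beta>} t *\<^sub>R k t)"
    by (rule borel_integrable_compact[OF compact_Icc k])
  have Keq: "(\<lambda>t. indicator {0<..} t * K t) = (\<lambda>t. if t = 0 then 0 else indicator {\<alpha>..\<beta>} t *\<^sub>R k t)"
    using \<alpha>\<beta> by (auto simp: K_def fun_eq_iff indicator_def)
  \<comment> \<open>For \<alpha> = 0 the two integrands may differ at t = 0, a null set.\<close>
  have ae: "AE t in lborel. indicator {0<..} t * K t = indicator {\<alpha>..\<beta>} t *\<^sub>R k t"
    using AE_lborel_singleton[of 0] by eventually_elim (use \<alpha>\<beta> in \<open>auto simp: K_def indicator_def\<close>)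
  have m0: "(\<lambda>t. indicator {0<..} t * K t) \<in> borel_measurable lborel" using Km by simp
  have i0: "integrable lborel (\<lambda>t. indicator {0<..} t * K t)"
    using integrable_cong_AE[OF m0 borel_measurable_integrable[OF Kint] ae] Kint by simp
  have v0: "(LINT t|lborel. indicator {0<..} t * K t) = integral {\<alpha>..\<beta>} k"
    using integral_cong_AE[OF m0 borel_measurable_integrable[OF Kint] ae]
      set_borel_integral_eq_integral(2)[of "{\<alpha>..\<beta>}" k] Kint
    by (simp add: set_integrable_def set_lebesgue_integral_def)
  have Kx: "integrable (lborel :: (real^2) measure) (\<lambda>x. K (x \<bullet> x))"
    "(LINT x|(lborel :: (real^2) measure). K (x \<bullet> x)) = pi * integral {\<alpha>..\<beta>} k"
    using integral_radial[OF Km] i0 v0 by auto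
  let ?B = "ball (0::real^2) (sqrt \<delta>)"
  have KB: "(\<lambda>x. indicator ?B x *\<^sub>R K (x \<bullet> x)) = (\<lambda>x::real^2. K (x \<bullet> x))"
    using \<alpha>\<beta> by (auto simp: fun_eq_iff K_def indicator_def norm_eq_sqrt_inner)
  have si: "set_integrable lborel ?B (\<lambda>x. K (x \<bullet> x))"
    unfolding set_integrable_def KB by (rule Kx(1))
  then have ab: "(\<lambda>x. K (x \<bullet> x)) absolutely_integrable_on ?B"
    unfolding set_integrable_def
    by (simp only: integrable_completion[OF borel_measurable_integrable])
  have "(LINT x:?B|lborel. K (x \<bullet> x)) = pi * integral {\<alpha>..\<beta>} k"
    unfolding set_lebesgue_integral_def KB by (rule Kx(2))
  moreover have "(LINT x:?B|lborel. K (x \<bullet> x)) = integral ?B (\<lambda>x. K (x \<bullet> x))"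
    by (rule set_borel_integral_eq_integral(2)[OF si])
  ultimately have iv: "integral ?B (\<lambda>x. K (x \<bullet> x)) = pi * integral {\<alpha>..\<beta>} k" by simp
  have Ul: "U \<in> sets lebesgue" using opU by auto
  have dw: "(\<theta> has_derivative frechet_derivative \<theta> (at u)) (at u within U)" if "u \<in> U" for u
    using theta_has_derivative(1)[OF that] by (rule has_derivative_at_withinI)
  have "(\<lambda>u. \<bar>det (matrix (frechet_derivative \<theta> (at u)))\<bar> * K (\<theta> u \<bullet> \<theta> u)) absolutely_integrable_on U \<and>
     integral U (\<lambda>u. \<bar>det (matrix (frechet_derivative \<theta> (at u)))\<bar> * K (\<theta> u \<bullet> \<theta> u)) = pi * integral {\<alpha>..\<beta>} k"
    by (rule absolute_integral_change_of_variables_real[OF Ul dw theta_inj, THEN iffD2])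
       (use ab iv theta_image in simp_all)
  then have c: "(\<lambda>u. \<bar>det (matrix (frechet_derivative \<theta> (at u)))\<bar> * K (\<tau> u)) absolutely_integrable_on U"
     "integral U (\<lambda>u. \<bar>det (matrix (frechet_derivative \<theta> (at u)))\<bar> * K (\<tau> u)) = pi * integral {\<alpha>..\<beta>} k"
    by (auto simp: theta_inner)
  have c1: "(\<lambda>u. \<bar>J u\<bar> * K (\<tau> u)) absolutely_integrable_on U"
    by (rule absolutely_integrable_spike[OF c(1), of "{}"]) (auto simp: theta_has_derivative(2))
  have c2: "integral U (\<lambda>u. \<bar>J u\<bar> * K (\<tau> u)) = pi * integral {\<alpha>..\<beta>} k"
    unfolding c(2)[symmetric] by (rule Henstock_Kurzweil_Integration.integral_cong) (simp add: theta_has_derivative(2))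
  have meas: "(\<lambda>u. indicator U u * (\<bar>J u\<bar> * K (\<tau> u))) \<in> borel_measurable borel"
  proof -
    have "(\<lambda>u. indicator U u *\<^sub>R J u) \<in> borel_measurable borel" "(\<lambda>u. indicator U u *\<^sub>R \<tau> u) \<in> borel_measurable borel"
      using borel_measurable_continuous_on_indicator[OF _ continuous_on_J]
        borel_measurable_continuous_on_indicator[OF _ continuous_on_tau] borel_open[OF opU] by blast+
    moreover have "(\<lambda>u. indicator U u * (\<bar>J u\<bar> * K (\<tau> u))) =
      (\<lambda>u. indicator U u * (\<bar>indicator U u *\<^sub>R J u\<bar> * K (indicator U u *\<^sub>R \<tau> u)))"
      by (auto simp: fun_eq_iff indicator_def)
    moreover have "(indicator U :: real^2 \<Rightarrow> real) \<in> borel_measurable borel"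
      using opU by (intro borel_measurable_indicator) auto
    ultimately show ?thesis using Km by (auto intro!: borel_measurable_times measurable_compose[OF _ Km])
  qed
  have "(LINT u|lborel. indicator U u * (\<bar>J u\<bar> * K (\<tau> u))) = (LINT u|lebesgue. indicator U u *\<^sub>R (\<bar>J u\<bar> * K (\<tau> u)))"
    using integral_completion[of "\<lambda>u. indicator U u * (\<bar>J u\<bar> * K (\<tau> u))" lborel] meas by simp
  also have "\<dots> = integral U (\<lambda>u. \<bar>J u\<bar> * K (\<tau> u))"
    using set_lebesgue_integral_eq_integral(2)[OF c1] by (simp add: set_lebesgue_integral_def)
  finally show ?thesis using c2 by (simp add: K_def)
qed

lemma continuous_on_profile: "continuous_on {0<..<\<delta>} f'" "continuous_on {0<..<\<delta>} f"
  using curve unfolding profile_curve_def by (auto intro: continuous_at_imp_continuous_on DERIV_isCont)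

lemma flux_denominator_pos: "t > 0 \<Longrightarrow> (t + (f t)\<^sup>2) * profile_speed f' t > 0"
  using profile_speed_ge_1[of t f'] by (intro mult_pos_pos) (auto intro: add_pos_nonneg)

section \<open>Radial test functions and Green's identity\<close>

context
  fixes h b :: "real \<Rightarrow> real" and \<alpha> \<beta> :: real
  assumes h: "\<And>k. Ck_real k h UNIV" and Dh: "\<And>t. (h has_real_derivative - b t) (at t)"
    and h0: "\<And>t. \<beta> \<le> t \<Longrightarrow> h t = 0" and hc: "\<And>t. t \<le> \<alpha> \<Longrightarrow> h t = h \<alpha>"
    and b: "\<And>k. Ck_real k b UNIV" and b0: "\<And>t. t \<le> \<alpha> \<or> \<beta> \<le> t \<Longrightarrow> b t = 0"
    and \<alpha>\<beta>: "0 < \<alpha>" "\<alpha> < \<beta>" "\<beta> < \<delta>"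
begin

text \<open>This test function is constant near Q, so its Laplacian vanishes around the logarithmic
  pole of G, and it is 0 beyond \<tau> = \<beta>.\<close>

definition \<phi> :: "real^3 \<Rightarrow> real" where
  "\<phi> P = (if P \<in> X ` U then h (axial_sq P) else 0)"

definition \<psi> :: "real^3 \<Rightarrow> real" where
  "\<psi> P = (if P \<in> X ` U then LB X (\<phi> \<circ> X) (inv_into U X P) else 0)"

text \<open>The support lies in the image of the compact set \<tau> \<le> \<beta>, which is closed,
  so a point off the patch has a neighbourhood that avoids it. This makes the extension by zero
  smooth across the edge of the patch.\<close>

lemma phi_vanishes_outside_patch:
  assumes lp': "local_param M U' X'" and u: "u \<in> U'" "X' u \<notin> X ` U"
  obtains V where "open V" "u \<in> V" "\<And>w. w \<in> V \<Longrightarrow> \<phi> (X' w) = 0"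
proof -
  define K where "K = {u \<in> U. \<tau> u \<le> \<beta>}"
  have "compact (X ` K)"
    unfolding K_def using compact_tau_le[OF \<alpha>\<beta>(3)] local_param_continuous_on[OF lp]
    by (intro compact_continuous_image) (auto intro: continuous_on_subset)
  then have "openin (top_of_set M) (M - X ` K)"
    by (simp add: Diff_eq openin_open_Int open_Compl compact_imp_closed)
  from local_param_open_vimage[OF lp' this] have "open {w \<in> U'. X' w \<in> M - X ` K}" .
  moreover have "u \<in> {w \<in> U'. X' w \<in> M - X ` K}"
    using u local_param_subset[OF lp'] by (auto simp: K_def)
  moreover have "\<phi> (X' w) = 0" if w: "w \<in> {w \<in> U'. X' w \<in> M - X ` K}" for w
  proof (cases "X' w \<in> X ` U")
    case True
    then obtain v where v: "v \<in> U" "X' w = X v" by auto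
    then have "v \<notin> K" using w by auto
    then have "\<tau> v > \<beta>" using v by (simp add: K_def)
    then show ?thesis using v h0 by (simp add: \<phi>_def axial_sq_X)
  qed (simp add: \<phi>_def)
  ultimately show ?thesis by (rule that)
qed

lemma phi_X: "u \<in> U \<Longrightarrow> \<phi> (X u) = h (\<tau> u)"
  by (auto simp: \<phi>_def axial_sq_X)

lemma phi_Q: "\<phi> Q = h \<alpha>"
proof -
  have "\<tau> u0 = 0" using tau_eq_0_iff u0 by blast
  then show ?thesis using phi_X[OF u0(1)] hc[of 0] \<alpha>\<beta> by (simp add: u0(2))
qed

lemma phi_smooth: "smooth_on_surface M \<phi>"
  unfolding smooth_on_surface_def smooth_on_def
proof (intro allI impI)
  fix U' X' k assume lp': "local_param M U' X'"
  note op' = local_param_open[OF lp']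
  show "Ck_on k (\<phi> \<circ> X') U'"
  proof (rule Ck_on_local[OF op'])
    fix u assume u: "u \<in> U'"
    show "\<exists>V. open V \<and> u \<in> V \<and> Ck_on k (\<phi> \<circ> X') V"
    proof (cases "X' u \<in> X ` U")
      case True
      define V where "V = {w \<in> U'. X' w \<in> X ` U}"
      have oV: "open V"
        unfolding V_def by (rule local_param_open_vimage[OF lp']) (use lp in \<open>simp add: local_param_def\<close>)
      have "Ck_on k (\<lambda>w. X' w - Q) U'"
        by (intro Ck_on_diff Ck_on_const op' local_param_Ck_on[OF lp'])
      then have c: "Ck_on k (\<lambda>w. (transpose A *v (X' w - Q)) $ m) U'" for m
        by (rule Ck_on_linear[OF op' bounded_linear_matrix_vec_nth])
      have "Ck_on k (\<lambda>w. axial_sq (X' w)) U'"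
        unfolding axial_sq_def power2_eq_square by (intro Ck_on_add Ck_on_mult op' c)
      then have "Ck_on k (\<lambda>w. h (axial_sq (X' w))) U'"
        by (rule Ck_on_compose_real[OF op' _ _ h]) auto
      then have "Ck_on k (\<lambda>w. h (axial_sq (X' w))) V"
        by (rule Ck_on_subset[OF op' oV, rotated]) (auto simp: V_def)
      then have "Ck_on k (\<phi> \<circ> X') V"
        by (rule Ck_on_cong[OF oV, THEN iffD1, rotated]) (simp add: V_def \<phi>_def)
      moreover have "u \<in> V" using u True by (simp add: V_def)
      ultimately show ?thesis using oV by (intro exI[of _ V] conjI)
    next
      case False
      obtain V where V: "open V" "u \<in> V" "\<And>w. w \<in> V \<Longrightarrow> \<phi> (X' w) = 0"
        using phi_vanishes_outside_patch[OF lp' u False] by metis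
      have "Ck_on k (\<phi> \<circ> X') V"
        by (rule Ck_on_cong[OF V(1), THEN iffD1, OF _ Ck_on_const[of k 0]]) (simp add: V)
      then show ?thesis using V(1,2) by (intro exI[of _ V] conjI)
    qed
  qed
qed

lemma phi_laplace:
  assumes "analytic_surface M"
  shows "has_laplace_beltrami M \<phi> \<psi>"
  unfolding has_laplace_beltrami_def
proof
  fix P assume P: "P \<in> M"
  show "\<exists>U' X' u. local_param M U' X' \<and> u \<in> U' \<and> X' u = P \<and> \<psi> P = LB X' (\<phi> \<circ> X') u"
  proof (cases "P \<in> X ` U")
    case True
    then show ?thesis
      using lp by (intro exI[of _ U] exI[of _ X] exI[of _ "inv_into U X P"])
        (auto simp: \<psi>_def inv_into_into f_inv_into_f)
  next
    case False
    obtain U' X' where "local_param M U' X'" "P \<in> X' ` U'"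
      using assms P unfolding analytic_surface_def by blast
    then obtain u where u: "local_param M U' X'" "u \<in> U'" "X' u = P" by blast
    obtain V where V: "open V" "u \<in> V" "\<And>w. w \<in> V \<Longrightarrow> \<phi> (X' w) = 0"
      using phi_vanishes_outside_patch[OF u(1,2)] False u(3) by metis
    have "LB X' (\<phi> \<circ> X') u = 0" by (rule LB_locally_const[OF V(1,2)]) (simp add: V(3))
    then show ?thesis using u False by (intro exI[of _ U'] exI[of _ X'] exI[of _ u]) (simp add: \<psi>_def)
  qed
qed

text \<open>The area density times the gradient of \<phi>, since h' = -b.\<close>

definition flux :: "2 \<Rightarrow> real^2 \<Rightarrow> real" where "flux i u = - b (\<tau> u) * tau_flux i u"

lemma Ck_on_flux: "Ck_on 1 (flux i) U"
  unfolding flux_def[abs_def]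
  by (intro Ck_on_mult Ck_on_minus opU Ck_on_tau_flux Ck_on_compose_real[OF opU Ck_on_tau _ b]) auto

lemma psi_X: "u \<in> U \<Longrightarrow> \<psi> (X u) * area_density X u = (\<Sum>i\<in>UNIV. pd i (flux i) u)"
proof -
  assume u: "u \<in> U"
  have pdv: "pd j (\<phi> \<circ> X) w = - b (\<tau> w) * pd j \<tau> w" if "w \<in> U" for j w
  proof -
    have "pd j (\<phi> \<circ> X) w = pd j (\<lambda>w. h (\<tau> w)) w"
      by (rule pd_cong_open[OF opU that]) (simp add: phi_X)
    then show ?thesis using pd_compose_real(1)[OF Dh tau_differentiable[OF that]] by simp
  qed
  have "pd i (\<lambda>w. area_density X w *
      (\<Sum>j\<in>UNIV. matrix_inv (induced_metric X w) $ i $ j * pd j (\<phi> \<circ> X) w)) u = pd i (flux i) u" for i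
    by (rule pd_cong_open[OF opU u])
       (simp add: pdv flux_def tau_flux_def sum_distrib_left mult_ac sum_negf)
  then have "LB X (\<phi> \<circ> X) u = (\<Sum>i\<in>UNIV. pd i (flux i) u) / area_density X u"
    by (simp add: LB_def)
  then show ?thesis
    using u area_density_pos[OF lp u] local_param_inj_on[OF lp] by (simp add: \<psi>_def)
qed

lemma phi_integral:
  assumes "area_measure M \<sigma>"
  shows "(LINT P|\<sigma>. \<phi> P) = pi * integral {0..\<beta>} (\<lambda>t. h t * profile_speed f' t)"
proof -
  have ch: "continuous_on UNIV h" using h[of 0] by simp
  have cht: "continuous_on U (\<lambda>u. h (\<tau> u))"
    using continuous_on_compose2[OF ch continuous_on_tau] by simp
  have m: "(\<lambda>u. indicator U u *\<^sub>R h (\<tau> u)) \<in> borel_measurable borel"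
    by (rule borel_measurable_continuous_on_indicator[OF borel_open[OF opU] cht])
  have "(\<lambda>u. indicator U u * \<phi> (X u)) = (\<lambda>u. indicator U u *\<^sub>R h (\<tau> u))"
    by (auto simp: fun_eq_iff phi_X indicator_def)
  then have "(LINT P|\<sigma>. \<phi> P) = (LINT u|lborel. indicator U u * (\<phi> (X u) * area_density X u))"
    using m by (intro area_measure_patch_integral[OF lp assms]) (auto simp: \<phi>_def)
  also have "\<dots> = (LINT u|lborel. indicator U u * (\<bar>J u\<bar> * (indicator {0..\<beta>} (\<tau> u) * (h (\<tau> u) * profile_speed f' (\<tau> u)))))"
  proof (rule integral_cong_AE)
    have ad: "(\<lambda>u. indicator U u *\<^sub>R (h (\<tau> u) * area_density X u)) \<in> borel_measurable borel"
      by (intro borel_measurable_continuous_on_indicator[OF borel_open[OF opU]] continuous_intros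
          cht continuous_on_area_density[OF lp])
    moreover have e: "(\<lambda>u. indicator U u * (\<phi> (X u) * area_density X u)) = (\<lambda>u. indicator U u *\<^sub>R (h (\<tau> u) * area_density X u))"
      by (auto simp: fun_eq_iff phi_X indicator_def)
    ultimately show "(\<lambda>u. indicator U u * (\<phi> (X u) * area_density X u)) \<in> borel_measurable lborel" by simp
    \<comment> \<open>The formula for the area density is available away from u0 only, and a single
      point is a null set.\<close>
    show "AE u in lborel. indicator U u * (\<phi> (X u) * area_density X u) =
        indicator U u * (\<bar>J u\<bar> * (indicator {0..\<beta>} (\<tau> u) * (h (\<tau> u) * profile_speed f' (\<tau> u))))"
      using AE_lborel_singleton[of u0]
      by eventually_elim (auto simp: indicator_def phi_X area_density_eq tau_nonneg h0)
    then have *: "AE u in lborel. indicator U u *\<^sub>R (h (\<tau> u) * area_density X u) =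
        indicator U u * (\<bar>J u\<bar> * (indicator {0..\<beta>} (\<tau> u) * (h (\<tau> u) * profile_speed f' (\<tau> u))))"
      unfolding e[THEN fun_cong, symmetric] .
    have cS: "continuous_on U (\<lambda>u. profile_speed f' (\<tau> u))"
      by (rule continuous_on_compose2[OF continuous_on_profile_speed[OF curve] continuous_on_tau])
         (use tau_nonneg tau_lt in auto)
    have c: "continuous_on U (\<lambda>u. \<bar>J u\<bar> * (h (\<tau> u) * profile_speed f' (\<tau> u)))"
      by (intro continuous_intros continuous_on_J cht cS)
    have "(\<lambda>u. indicator U u * (\<bar>J u\<bar> * (indicator {0..\<beta>} (\<tau> u) * (h (\<tau> u) * profile_speed f' (\<tau> u))))) =
       (\<lambda>u. indicator U u *\<^sub>R (\<bar>J u\<bar> * (h (\<tau> u) * profile_speed f' (\<tau> u))))"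
      by (auto simp: fun_eq_iff indicator_def tau_nonneg h0)
    then show "(\<lambda>u. indicator U u * (\<bar>J u\<bar> * (indicator {0..\<beta>} (\<tau> u) * (h (\<tau> u) * profile_speed f' (\<tau> u))))) \<in> borel_measurable lborel"
      using borel_measurable_continuous_on_indicator[OF borel_open[OF opU] c] by simp
  qed
  also have "\<dots> = pi * integral {0..\<beta>} (\<lambda>t. h t * profile_speed f' t)"
    by (rule radial_integral)
       (use \<alpha>\<beta> in \<open>auto intro!: continuous_intros continuous_on_subset[OF ch]
          continuous_on_subset[OF continuous_on_profile_speed[OF curve]]\<close>)
  finally show ?thesis .
qed

text \<open>Green's identity: integrating by parts moves one derivative from the test function to \<open>G\<close>.
  What remains contains first derivatives only, so it transforms by the chain rule.\<close>

lemma green_integral: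
  assumes \<sigma>: "area_measure M \<sigma>"
    and G: "\<And>P. P \<in> M \<Longrightarrow> P \<noteq> Q \<Longrightarrow> G P = - (1 / (2 * pi)) * ln (dist P Q) + C"
  shows "- (LINT P|\<sigma>. G P * \<psi> P) =
    integral {\<alpha>..\<beta>} (\<lambda>t. b t * (t * (1 + 2 * f t * f' t) / ((t + (f t)\<^sup>2) * profile_speed f' t)))"
proof -
  \<comment> \<open>The pole is removed because ln N is singular there. The set K below avoids it,
    as \<alpha> > 0, and the flux vanishes off K.\<close>
  define U1 where "U1 = U - {u0}"
  define K where "K = {u \<in> U. \<alpha> \<le> \<tau> u \<and> \<tau> u \<le> \<beta>}"
  define N where "N u = \<tau> u + (p 3 u)\<^sup>2" for u
  \<comment> \<open>N is the squared distance to Q, so the factor 1 / (2 pi) becomes 1 / (4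
    pi).\<close>
  define \<gamma> where "\<gamma> u = - (1 / (4 * pi)) * ln (N u) + C" for u
  define q where "q t = t * (1 + 2 * f t * f' t) / ((t + (f t)\<^sup>2) * profile_speed f' t)" for t
  have op1: "open U1" unfolding U1_def using opU by (simp add: open_delete)
  have sub1: "U1 \<subseteq> U" by (auto simp: U1_def)
  have Kc: "compact K" unfolding K_def using compact_tau_between[OF \<alpha>\<beta>(3)] .
  have K1: "K \<subseteq> U1" using \<alpha>\<beta>(1) tau_eq_0_iff[OF u0(1)] by (auto simp: K_def U1_def)
  have tpos: "\<tau> u > 0" if "u \<in> U1" for u
    using that tau_nonneg[of u] tau_eq_0_iff[of u] by (auto simp: U1_def less_le)
  have Npos: "N u > 0" if "u \<in> U1" for u
    using tpos[OF that] by (simp add: N_def add_pos_nonneg)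
  have CN: "Ck_on k N U1" for k
    unfolding N_def[abs_def] power2_eq_square
    by (intro Ck_on_add Ck_on_mult op1 Ck_on_subset[OF opU op1 sub1] Ck_on_tau Ck_on_p)
  have Ck_ln: "Ck_real 1 ln {0::real<..}"
    unfolding One_nat_def
    by (rule Ck_real_SucI[where h'="inverse"]) (auto intro!: DERIV_ln continuous_intros)
  have C\<gamma>: "Ck_on 1 \<gamma> U1"
    unfolding \<gamma>_def[abs_def]
    by (intro Ck_on_add Ck_on_mult Ck_on_const op1 Ck_on_compose_real[OF op1 CN _ Ck_ln]) (auto intro: Npos)
  have Cflux: "Ck_on 1 (flux i) U1" for i
    by (rule Ck_on_subset[OF opU op1 sub1 Ck_on_flux])
  have d\<gamma>: "\<gamma> differentiable (at u)" and dflux: "flux i differentiable (at u)" if "u \<in> U1" for u i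
    using that C\<gamma> Cflux[of i] by (auto simp: differentiable_on_eq_differentiable_at[OF op1])
  have flux0: "flux i u = 0" if "u \<in> U - K" for i u
    using that b0[of "\<tau> u"] by (auto simp: flux_def K_def)
  have opK: "open (U - K)" "open (- K)"
    using opU Kc compact_imp_closed by (auto simp: open_Diff open_Compl)
  have pdflux0: "pd i (flux i) u = 0" if "u \<in> U - K" for i u
    using pd_cong_open[OF opK(1) that, of "flux i" "\<lambda>_. 0"] flux0 by (simp add: pd_const)
  have GX: "G (X u) = \<gamma> u" if u: "u \<in> U1" for u
  proof -
    have "X u \<noteq> Q"
      using u u0 local_param_inj_on[OF lp] by (auto simp: U1_def dest: inj_onD)
    then have "dist (X u) Q > 0" by simp
    then have "ln (N u) = 2 * ln (dist (X u) Q)"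
      using dist_X[of u] by (simp add: N_def ln_realpow flip: dist_X)
    then show ?thesis
      using G[of "X u"] \<open>X u \<noteq> Q\<close> local_param_subset[OF lp] u sub1 by (auto simp: \<gamma>_def)
  qed
  \<comment> \<open>The field \<gamma> flux, extended by zero to a C^1 field with compact support in
    the plane. Its divergence splits into E, with the derivative on \<gamma>, and D, with the
    derivative on the flux, which is the density times G \<psi>.\<close>
  define W where "W i u = (if u \<in> U1 then \<gamma> u * flux i u else 0)" for i u
  have W0: "W i u = 0" if "u \<notin> K" for i u
    using that flux0 sub1 by (auto simp: W_def)
  have CW: "Ck_on 1 (W i) UNIV" for i
  proof (rule Ck_on_local[OF open_UNIV])
    fix u :: "real^2"
    show "\<exists>V. open V \<and> u \<in> V \<and> Ck_on 1 (W i) V"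
    proof (cases "u \<in> U1")
      case True
      have "Ck_on 1 (\<lambda>u. \<gamma> u * flux i u) U1" by (intro Ck_on_mult op1 C\<gamma> Cflux)
      then have "Ck_on 1 (W i) U1"
        by (rule Ck_on_cong[OF op1, THEN iffD1, rotated]) (simp add: W_def)
      then show ?thesis using op1 True by (intro exI[of _ U1] conjI)
    next
      case False
      have "Ck_on 1 (W i) (- K)"
        by (rule Ck_on_cong[OF opK(2), THEN iffD1, OF _ Ck_on_const[of 1 0]]) (simp add: W0)
      moreover have "u \<in> - K" using False K1 by auto
      ultimately show ?thesis using opK(2) by (intro exI[of _ "- K"] conjI)
    qed
  qed
  have pdW: "pd i (W i) u = indicator U1 u * (pd i \<gamma> u * flux i u) + indicator U1 u * (\<gamma> u * pd i (flux i) u)" for i u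
  proof (cases "u \<in> U1")
    case True
    have "pd i (W i) u = pd i (\<lambda>u. \<gamma> u * flux i u) u"
      by (rule pd_cong_open[OF op1 True]) (simp add: W_def)
    then show ?thesis using True pd_mult[OF d\<gamma>[OF True] dflux[OF True]] by simp
  next
    case False
    then have "u \<in> - K" using K1 by auto
    have "pd i (W i) u = pd i (\<lambda>_. 0) u"
      by (rule pd_cong_open[OF opK(2) \<open>u \<in> - K\<close>]) (simp add: W0)
    then show ?thesis using False by (simp add: pd_const)
  qed
  note intW = integral_pd_compact_support[OF Kc W0 CW]
  define E where "E u = indicator U1 u * (\<Sum>i\<in>UNIV. pd i \<gamma> u * flux i u)" for u
  define D where "D u = indicator U1 u * (\<gamma> u * (\<Sum>i\<in>UNIV. pd i (flux i) u))" for u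
  have ED: "E u + D u = (\<Sum>i\<in>UNIV. pd i (W i) u)" for u
    by (simp add: E_def D_def pdW sum.distrib sum_distrib_left)
  have E_K: "E u = indicator K u *\<^sub>R (\<Sum>i\<in>UNIV. pd i \<gamma> u * flux i u)" for u
    using flux0 K1 sub1 by (auto simp: E_def indicator_def)
  have "continuous_on U1 (\<lambda>u. \<Sum>i\<in>UNIV. pd i \<gamma> u * flux i u)"
    using C\<gamma> Ck_on_imp_continuous_on[OF op1 Cflux] by (intro continuous_intros) auto
  then have "continuous_on K (\<lambda>u. \<Sum>i\<in>UNIV. pd i \<gamma> u * flux i u)"
    using K1 continuous_on_subset by blast
  then have Eint: "integrable lborel E"
    unfolding E_K[abs_def] by (rule borel_integrable_compact[OF Kc])
  have "integrable lborel (\<lambda>u. \<Sum>i\<in>UNIV. pd i (W i) u)"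
    using intW by auto
  then have "integrable lborel (\<lambda>u. (\<Sum>i\<in>UNIV. pd i (W i) u) - E u)"
    using Eint by (rule Bochner_Integration.integrable_diff)
  then have Dint: "integrable lborel D" unfolding ED[symmetric] by simp
  have "(LINT u|lborel. E u) + (LINT u|lborel. D u) = (LINT u|lborel. E u + D u)"
    using Eint Dint by simp
  also have "\<dots> = 0"
    unfolding ED using intW by (subst Bochner_Integration.integral_sum) auto
  finally have parts: "(LINT u|lborel. E u) = - (LINT u|lborel. D u)" by simp
  have psi_zero: "\<psi> (X u) = 0" if "u \<in> U - K" for u
    using psi_X[of u] pdflux0[OF that] area_density_pos[OF lp, of u] that by auto
  \<comment> \<open>No value of G at Q is prescribed; the product G \<psi> is controlled there
    because \<psi> vanishes at Q.\<close>
  have u0K: "u0 \<in> U - K" using u0 K1 by (auto simp: U1_def)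
  have "(LINT P|\<sigma>. G P * \<psi> P) = (LINT u|lborel. indicator U u * ((G (X u) * \<psi> (X u)) * area_density X u))"
  proof (rule area_measure_patch_integral[OF lp \<sigma>, of "\<lambda>P. G P * \<psi> P"])
    have eq: "(\<lambda>u. indicator U u * (G (X u) * \<psi> (X u))) =
      (\<lambda>u. indicator U1 u *\<^sub>R (\<gamma> u * ((\<Sum>i\<in>UNIV. pd i (flux i) u) / area_density X u)))" (is "?l = ?r")
    proof
      fix u show "?l u = ?r u"
      proof (cases "u \<in> U1")
        case True
        then have "\<psi> (X u) = (\<Sum>i\<in>UNIV. pd i (flux i) u) / area_density X u"
          using psi_X[of u] area_density_pos[OF lp, of u] sub1 by (auto simp: field_simps)
        then show ?thesis using True GX sub1 by auto
      next
        case False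
        then show ?thesis using psi_zero[OF u0K] by (auto simp: U1_def indicator_def)
      qed
    qed
    have cont: "continuous_on U1 (\<lambda>u. \<gamma> u * ((\<Sum>i\<in>UNIV. pd i (flux i) u) / area_density X u))"
    proof (intro continuous_intros)
      show "continuous_on U1 \<gamma>" using Ck_on_imp_continuous_on[OF op1 C\<gamma>] .
      show "continuous_on U1 (\<lambda>u. pd i (flux i) u)" for i using Cflux[of i] by simp
      show "continuous_on U1 (area_density X)"
        using continuous_on_subset[OF continuous_on_area_density[OF lp] sub1] .
      show "\<forall>u\<in>U1. area_density X u \<noteq> 0" using area_density_pos[OF lp] sub1 by force
    qed
    show "(\<lambda>u. indicator U u * (G (X u) * \<psi> (X u))) \<in> borel_measurable borel"
      unfolding eq by (rule borel_measurable_continuous_on_indicator[OF borel_open[OF op1] cont])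
  qed (simp add: \<psi>_def)
  also have "\<dots> = (LINT u|lborel. D u)"
  proof (rule Bochner_Integration.integral_cong[OF refl])
    fix u
    show "indicator U u * (G (X u) * \<psi> (X u) * area_density X u) = D u"
    proof (cases "u \<in> U1")
      case True
      then show ?thesis using psi_X[of u] GX sub1 by (auto simp: D_def mult.assoc)
    next
      case False
      then show ?thesis using psi_zero[OF u0K] by (auto simp: D_def U1_def indicator_def)
    qed
  qed
  also have "- \<dots> = (LINT u|lborel. E u)" using parts by simp
  also have "\<dots> = (LINT u|lborel. indicator U u * (\<bar>J u\<bar> * (indicator {\<alpha>..\<beta>} (\<tau> u) * (b (\<tau> u) * q (\<tau> u) / pi))))"
  proof (rule Bochner_Integration.integral_cong[OF refl])
    fix u
    show "E u = indicator U u * (\<bar>J u\<bar> * (indicator {\<alpha>..\<beta>} (\<tau> u) * (b (\<tau> u) * q (\<tau> u) / pi)))"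
    proof (cases "u \<in> K")
      case True
      then have u: "u \<in> U" "u \<noteq> u0" "u \<in> U1" "\<tau> u \<in> {\<alpha>..\<beta>}" using K1 by (auto simp: K_def U1_def)
      have dN: "N differentiable (at u)"
        using CN[of 1] u by (auto simp: differentiable_on_eq_differentiable_at[OF op1])
      have pdN: "pd i N u = pd i \<tau> u * (1 + 2 * f (\<tau> u) * f' (\<tau> u))" for i
      proof -
        have "pd i N u = pd i \<tau> u + (pd i (p 3) u * p 3 u + p 3 u * pd i (p 3) u)"
          unfolding N_def[abs_def] power2_eq_square
          using tau_differentiable[OF u(1)] p_differentiable[OF u(1)]
          by (subst pd_add) (auto intro!: differentiable_mult simp: pd_mult)
        then show ?thesis using pd_p3[OF u(1,2)] height'[OF u(1)] by (simp add: algebra_simps)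
      qed
      have pd\<gamma>: "pd i \<gamma> u = - (1 / (4 * pi)) * (1 / N u) * pd i N u" for i
      proof -
        have "((\<lambda>s. - (1 / (4 * pi)) * ln s + C) has_real_derivative - (1 / (4 * pi)) * (1 / N u)) (at (N u))"
          using Npos[OF u(3)] by (auto intro!: derivative_eq_intros)
        from pd_compose_real(1)[OF this dN] show ?thesis unfolding \<gamma>_def[abs_def] .
      qed
      have "E u = (\<Sum>i\<in>UNIV. pd i \<gamma> u * flux i u)" using u by (simp add: E_def)
      also have "\<dots> = (\<Sum>i\<in>UNIV. ((1 / (4 * pi)) * (1 / N u) * (1 + 2 * f (\<tau> u) * f' (\<tau> u)) * b (\<tau> u)) * (pd i \<tau> u * tau_flux i u))"
        by (rule sum.cong) (auto simp: pd\<gamma> pdN flux_def)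
      also have "\<dots> = ((1 / (4 * pi)) * (1 / N u) * (1 + 2 * f (\<tau> u) * f' (\<tau> u)) * b (\<tau> u)) * (\<bar>J u\<bar> * (4 * \<tau> u / profile_speed f' (\<tau> u)))"
        unfolding sum_distrib_left[symmetric] grad_tau_pairing[OF u(1,2)] ..
      \<comment> \<open>The constants give 4 / (4 pi) = 1 / pi; the radial integral multiplies by pi
        again.\<close>
      also have "\<dots> = \<bar>J u\<bar> * (b (\<tau> u) * q (\<tau> u) / pi)"
        proof -
        have "N u = \<tau> u + (f (\<tau> u))\<^sup>2" using height'[OF u(1)] by (simp add: N_def)
        then show ?thesis unfolding q_def by (simp only: mult_ac times_divide_eq_right times_divide_eq_left divide_divide_eq_left) simp
      qed
      finally show ?thesis using u by simp
    next
      case False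
      then show ?thesis unfolding E_K by (auto simp: K_def indicator_def)
    qed
  qed
  also have "\<dots> = pi * integral {\<alpha>..\<beta>} (\<lambda>t. b t * q t / pi)"
  proof (rule radial_integral)
    have cb: "continuous_on {\<alpha>..\<beta>} b" using b[of 0] continuous_on_subset by auto
    have sub: "{\<alpha>..\<beta>} \<subseteq> {0<..<\<delta>}" using \<alpha>\<beta> by auto
    note cf' = continuous_on_subset[OF continuous_on_profile(1) sub]
    note cf = continuous_on_subset[OF continuous_on_profile(2) sub]
    have cS: "continuous_on {\<alpha>..\<beta>} (profile_speed f')"
      by (rule continuous_on_subset[OF continuous_on_profile_speed[OF curve]]) (use \<alpha>\<beta> in auto)
    show "continuous_on {\<alpha>..\<beta>} (\<lambda>t. b t * q t / pi)"
      unfolding q_def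
    proof (intro continuous_intros cb cf cf' cS)
      show "\<forall>t\<in>{\<alpha>..\<beta>}. (t + (f t)\<^sup>2) * profile_speed f' t \<noteq> 0"
        using flux_denominator_pos \<alpha>\<beta>(1) by (metis atLeastAtMost_iff less_irrefl less_le_trans)
    qed auto
  qed (use \<alpha>\<beta> in auto)
  also have "\<dots> = integral {\<alpha>..\<beta>} (\<lambda>t. b t * q t)" by simp
  finally show ?thesis by (simp add: q_def)
qed

end

text \<open>For every bump b, Green's identity and one integration by parts in t turn the
  distributional equation into the vanishing of the integral of b E, with E continuous. The
  fundamental lemma of the calculus of variations gives E = 0, which is the equation divided by (t +
  f^2) S.\<close>

lemma patch_profile_ode:
  assumes M: "analytic_surface M" and \<sigma>: "area_measure M \<sigma>" and green: "green_function M \<sigma> Q G"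
    and G: "\<And>P. P \<in> M \<Longrightarrow> P \<noteq> Q \<Longrightarrow> G P = - (1 / (2 * pi)) * ln (dist P Q) + C"
  shows "profile_ode (pi / measure \<sigma> M) \<delta> f f'"
proof -
  define \<kappa> where "\<kappa> = pi / measure \<sigma> M"
  define q where "q t = t * (1 + 2 * f t * f' t) / ((t + (f t)\<^sup>2) * profile_speed f' t)" for t
  define E where "E t = q t - 1 + \<kappa> * profile_area f' t" for t
  note den = flux_denominator_pos
  note cf' = continuous_on_profile(1) and cf = continuous_on_profile(2)
  have cS: "continuous_on {0<..<\<delta>} (profile_speed f')"
    by (rule continuous_on_subset[OF continuous_on_profile_speed[OF curve]]) auto
  have cW: "continuous_on {0<..<\<delta>} (profile_area f')"
    by (auto intro!: continuous_at_imp_continuous_on DERIV_isCont profile_area_has_derivative[OF curve])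
  have cE: "continuous_on {0<..<\<delta>} E"
    unfolding E_def[abs_def] q_def[abs_def]
    by (intro continuous_intros cf cf' cS cW) (use den in \<open>metis greaterThanLessThan_iff less_irrefl\<close>)
  have weak: "integral {\<alpha>..\<beta>} (\<lambda>t. b t * E t) = 0"
    if b: "\<And>k. Ck_real k b UNIV" "\<And>t. t \<le> \<alpha> \<or> \<beta> \<le> t \<Longrightarrow> b t = 0"
      and \<alpha>\<beta>: "0 < \<alpha>" "\<alpha> < \<beta>" "\<beta> < \<delta>" for b \<alpha> \<beta>
  proof -
    obtain h where h: "\<And>k. Ck_real k h UNIV" "\<And>t. (h has_real_derivative - b t) (at t)"
      "\<And>t. \<beta> \<le> t \<Longrightarrow> h t = 0" "\<And>t. t \<le> \<alpha> \<Longrightarrow> h t = h \<alpha>"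
      using bump_antiderivative[OF b \<alpha>\<beta>(2)] by metis
    note facts = h b \<alpha>\<beta>
    note phi = phi_smooth[OF facts] phi_laplace[OF facts M] phi_Q[OF facts]
      phi_integral[OF facts \<sigma>] green_integral[OF facts \<sigma> G]
    have "- (LINT P|\<sigma>. G P * \<psi> h P) = \<phi> h Q - (1 / measure \<sigma> M) * (LINT P|\<sigma>. \<phi> h P)"
      using green phi(1,2) unfolding green_function_def by blast
    then have main: "integral {\<alpha>..\<beta>} (\<lambda>t. b t * q t) =
        h \<alpha> - \<kappa> * integral {0..\<beta>} (\<lambda>t. h t * profile_speed f' t)"
      using phi(3-5) by (simp add: q_def \<kappa>_def)
    have sub: "{\<alpha>..\<beta>} \<subseteq> {0<..<\<delta>}" using \<alpha>\<beta> by auto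
    have cb: "continuous_on T b" and ch: "continuous_on T h" for T
      using b(1)[of 0] h(1)[of 0] continuous_on_subset by auto
    \<comment> \<open>Both terms on the right of \<open>main\<close> are now written as integrals
      against b: the point mass h \<alpha> is the integral of b, and the integral of h S will be
      that of b W.\<close>
    have hb: "((\<lambda>t. - b t) has_integral (h \<beta> - h \<alpha>)) {\<alpha>..\<beta>}"
      by (rule fundamental_theorem_of_calculus)
         (use \<alpha>\<beta> h(2) in \<open>auto simp: has_real_derivative_iff_has_vector_derivative[symmetric] intro: has_field_derivative_at_within\<close>)
    have ib: "integral {\<alpha>..\<beta>} b = h \<alpha>"
      using integral_unique[OF hb] h(3)[of \<beta>] by simp
    have cS': "continuous_on {0..\<beta>} (profile_speed f')"
      by (rule continuous_on_subset[OF continuous_on_profile_speed[OF curve]]) (use \<alpha>\<beta> in auto)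
    have cW': "continuous_on {0..\<beta>} (profile_area f')"
      by (rule continuous_on_profile_area[OF curve \<alpha>\<beta>(3)])
    \<comment> \<open>Integration by parts for h W, whose derivative is known inside the interval
      and whose continuity holds up to 0. The boundary terms vanish because h \<beta> = 0 and W(0) =
      0.\<close>
    have "((\<lambda>t. - b t * profile_area f' t + profile_speed f' t * h t) has_integral
        (h \<beta> * profile_area f' \<beta> - h 0 * profile_area f' 0)) {0..\<beta>}"
    proof (rule fundamental_theorem_of_calculus_interior)
      show "continuous_on {0..\<beta>} (\<lambda>t. h t * profile_area f' t)"
        by (intro continuous_intros ch cW')
      fix t assume t: "t \<in> {0<..<\<beta>}"
      show "((\<lambda>t. h t * profile_area f' t) has_vector_derivative - b t * profile_area f' t + profile_speed f' t * h t) (at t)"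
        unfolding has_real_derivative_iff_has_vector_derivative[symmetric]
        by (rule DERIV_mult[OF h(2) profile_area_has_derivative[OF curve]]) (use t \<alpha>\<beta> in auto)
    qed (use \<alpha>\<beta> in auto)
    then have "integral {0..\<beta>} (\<lambda>t. - b t * profile_area f' t + profile_speed f' t * h t) = 0"
      using h(3)[of \<beta>] by (simp add: integral_unique profile_area_0[OF curve])
    moreover have "integral {0..\<beta>} (\<lambda>t. - b t * profile_area f' t + profile_speed f' t * h t) =
        integral {0..\<beta>} (\<lambda>t. - b t * profile_area f' t) + integral {0..\<beta>} (\<lambda>t. profile_speed f' t * h t)"
      by (intro Henstock_Kurzweil_Integration.integral_add integrable_continuous_real continuous_intros cb ch cS' cW')
    moreover have "integral {0..\<beta>} (\<lambda>t. - b t * profile_area f' t) = - integral {\<alpha>..\<beta>} (\<lambda>t. b t * profile_area f' t)"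
    proof -
      have "integral {0..\<alpha>} (\<lambda>t. b t * profile_area f' t) = 0"
        by (rule integral_unique, rule has_integral_is_0) (use b(2) in auto)
      moreover have "integral {0..\<alpha>} (\<lambda>t. b t * profile_area f' t) + integral {\<alpha>..\<beta>} (\<lambda>t. b t * profile_area f' t)
          = integral {0..\<beta>} (\<lambda>t. b t * profile_area f' t)"
        by (rule Henstock_Kurzweil_Integration.integral_combine)
           (use \<alpha>\<beta> in \<open>auto intro!: integrable_continuous_real continuous_intros cb cW'\<close>)
      ultimately show ?thesis by simp
    qed
    ultimately have hS: "integral {0..\<beta>} (\<lambda>t. h t * profile_speed f' t) = integral {\<alpha>..\<beta>} (\<lambda>t. b t * profile_area f' t)"
      by (simp add: mult.commute)
    have cq: "continuous_on {\<alpha>..\<beta>} q"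
      unfolding q_def[abs_def]
      by (intro continuous_intros continuous_on_subset[OF cf sub] continuous_on_subset[OF cf' sub]
          continuous_on_subset[OF cS sub])
         (use den \<alpha>\<beta>(1) in \<open>metis atLeastAtMost_iff less_irrefl less_le_trans\<close>)
    have i: "(\<lambda>t. b t * q t) integrable_on {\<alpha>..\<beta>}" "b integrable_on {\<alpha>..\<beta>}"
      "(\<lambda>t. \<kappa> * (b t * profile_area f' t)) integrable_on {\<alpha>..\<beta>}"
      by (intro integrable_continuous_real continuous_intros cb cq continuous_on_subset[OF cW sub])+
    have "integral {\<alpha>..\<beta>} (\<lambda>t. b t * E t) =
        integral {\<alpha>..\<beta>} (\<lambda>t. (b t * q t - b t) + \<kappa> * (b t * profile_area f' t))"
      by (simp add: E_def algebra_simps)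
    also have "\<dots> = integral {\<alpha>..\<beta>} (\<lambda>t. b t * q t) - integral {\<alpha>..\<beta>} b
        + \<kappa> * integral {\<alpha>..\<beta>} (\<lambda>t. b t * profile_area f' t)"
      using i by (simp add: Henstock_Kurzweil_Integration.integral_add Henstock_Kurzweil_Integration.integral_diff integrable_diff)
    also have "\<dots> = 0" using main hS ib by simp
    finally show ?thesis .
  qed
  have E0: "E t = 0" if t: "0 < t" "t < \<delta>" for t
  proof (rule ccontr)
    assume ne: "E t \<noteq> 0"
    \<comment> \<open>Multiplication by the sign treats positive and negative values of E at
      once.\<close>
    define s where "s = sgn (E t)"
    have s: "s * E t > 0" using ne by (simp add: s_def sgn_mult_self_eq abs_sgn[symmetric] mult.commute)
    have "isCont (\<lambda>x. s * E x) t"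
      using cE t by (intro continuous_intros) (simp add: continuous_on_eq_continuous_at)
    then have "eventually (\<lambda>x. s * E x > 0) (at t)"
      using s unfolding isCont_def by (rule order_tendstoD(1))
    then obtain d where d: "d > 0" "\<And>x. x \<noteq> t \<Longrightarrow> dist x t < d \<Longrightarrow> s * E x > 0"
      by (auto simp: eventually_at)
    define e where "e = min (d / 2) (min (t / 2) ((\<delta> - t) / 2))"
    have e: "e > 0" "e < d" "e < t" "t + e < \<delta>" using d t by (auto simp: e_def min_def field_simps)
    have pos: "s * E x > 0" if "x \<in> {t - e..t + e}" for x
      using d(2)[of x] s e that by (cases "x = t") (auto simp: dist_real_def)
    obtain b where b: "\<And>k. Ck_real k b UNIV" "\<And>x. t - e < x \<Longrightarrow> x < t + e \<Longrightarrow> b x > 0"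
      "\<And>x. x \<le> t - e \<or> t + e \<le> x \<Longrightarrow> b x = 0"
      using smooth_bump[of "t - e" "t + e"] e by auto
    have w: "integral {t - e..t + e} (\<lambda>x. b x * E x) = 0"
      using weak[OF b(1,3)] e by simp
    have c: "continuous_on {t - e..t + e} (\<lambda>x. s * (b x * E x))"
      using b(1)[of 0] e by (intro continuous_intros continuous_on_subset[OF cE]) (auto elim: continuous_on_subset)
    have nonneg: "0 \<le> s * (b x * E x)" if "x \<in> {t - e..t + e}" for x
    proof -
      have "b x \<ge> 0" using b(2,3)[of x] by (cases "t - e < x \<and> x < t + e") (auto intro: less_imp_le)
      then have "0 \<le> b x * (s * E x)" using pos[OF that] by simp
      then show ?thesis by (simp add: mult_ac)
    qed
    have "integral {t - e..t + e} (\<lambda>x. s * (b x * E x)) = 0" using w by simp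
    then have "s * (b t * E t) = 0"
      using integral_eq_0_iff[OF c] e nonneg by auto
    then show False using b(2)[of t] e s by auto
  qed
  show ?thesis
    unfolding profile_ode_def
  proof
    fix t assume t: "t \<in> {0<..<\<delta>}"
    then have "q t = 1 - \<kappa> * profile_area f' t" using E0[of t] by (simp add: E_def)
    then show "t * (1 + 2 * f t * f' t) =
        (1 - pi / measure \<sigma> M * profile_area f' t) * ((t + (f t)\<^sup>2) * profile_speed f' t)"
      using den[of t] t by (auto simp: q_def \<kappa>_def[symmetric] divide_eq_eq split: if_splits)
  qed
qed

end

section \<open>Existence of an axially symmetric patch\<close>

lemma exists_rotation_about_axis3:
  fixes x y :: "real^2"
  assumes xy: "norm x = norm y" and x: "x \<noteq> 0"
  obtains B :: "real^3^3" where "rotation_matrix B" "B *v axis 3 1 = axis 3 1"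
    "\<And>z. B *v vector [x $ 1, x $ 2, z] = vector [y $ 1, y $ 2, z]"
proof -
  define n where "n = (x $ 1)\<^sup>2 + (x $ 2)\<^sup>2"
  have ns: "(norm v)\<^sup>2 = (v $ 1)\<^sup>2 + (v $ 2)\<^sup>2" for v :: "real^2"
    unfolding power2_norm_eq_inner by (simp add: inner_vec_def sum_2 power2_eq_square)
  have n: "n = (norm x)\<^sup>2" "n = (y $ 1)\<^sup>2 + (y $ 2)\<^sup>2" using ns[of x] ns[of y] xy by (simp_all add: n_def)
  have n0: "n \<noteq> 0" using x n(1) by simp
  \<comment> \<open>Cosine and sine of the angle from x to y: dot and cross product over
    \<bar>x\<bar>^2. Lagrange's identity gives c^2 + s^2 = 1.\<close>
  define c where "c = (x $ 1 * y $ 1 + x $ 2 * y $ 2) / n"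
  define s where "s = (x $ 1 * y $ 2 - x $ 2 * y $ 1) / n"
  have cs: "c\<^sup>2 + s\<^sup>2 = 1"
  proof -
    have "n\<^sup>2 = ((x $ 1)\<^sup>2 + (x $ 2)\<^sup>2) * ((y $ 1)\<^sup>2 + (y $ 2)\<^sup>2)"
      unfolding n(2)[symmetric] n_def[symmetric] by (rule power2_eq_square)
    then have "(x $ 1 * y $ 1 + x $ 2 * y $ 2)\<^sup>2 + (x $ 1 * y $ 2 - x $ 2 * y $ 1)\<^sup>2 = n\<^sup>2"
      by (simp add: power2_eq_square algebra_simps)
    then show ?thesis using n0
      by (simp add: c_def s_def power_divide flip: add_divide_distrib)
  qed
  define B :: "real^3^3" where "B = vector [vector [c, - s, 0], vector [s, c, 0], vector [0, 0, 1]]"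
  show ?thesis
  proof
    have "transpose B ** B = mat 1"
      using cs by (simp add: vec_eq_iff matrix_matrix_mult_def transpose_def sum_3 forall_3 B_def mat_def
          power2_eq_square algebra_simps)
    moreover have "det B = 1" using cs by (simp add: det_3 B_def power2_eq_square)
    ultimately show "rotation_matrix B" by (simp add: rotation_matrix_def orthogonal_matrix)
    show "B *v axis 3 1 = axis 3 1"
      by (simp add: vec_eq_iff matrix_vector_mult_def sum_3 forall_3 B_def axis_def)
    have nc: "n * c = x $ 1 * y $ 1 + x $ 2 * y $ 2" and ns: "n * s = x $ 1 * y $ 2 - x $ 2 * y $ 1"
      using n0 by (simp_all add: c_def s_def)
    have "n * (c * x $ 1 - s * x $ 2) = (n * c) * x $ 1 - (n * s) * x $ 2"
      "n * (s * x $ 1 + c * x $ 2) = (n * s) * x $ 1 + (n * c) * x $ 2" by (simp_all add: algebra_simps)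
    then have "n * (c * x $ 1 - s * x $ 2) = n * y $ 1" "n * (s * x $ 1 + c * x $ 2) = n * y $ 2"
      unfolding nc ns by (simp_all add: n_def power2_eq_square algebra_simps)
    then have "c * x $ 1 - s * x $ 2 = y $ 1" "s * x $ 1 + c * x $ 2 = y $ 2" using n0 by auto
    then show "B *v vector [x $ 1, x $ 2, z] = vector [y $ 1, y $ 2, z]" for z
      by (simp add: vec_eq_iff matrix_vector_mult_def sum_3 forall_3 B_def)
  qed
qed

lemma inverse_function_Ck:
  fixes \<theta> :: "real^2 \<Rightarrow> real^2"
  assumes U: "open U" "u0 \<in> U" and \<theta>: "Ck_on 1 \<theta> U"
    and inj: "inj (frechet_derivative \<theta> (at u0))"
  obtains U' V g where "open U'" "U' \<subseteq> U" "u0 \<in> U'" "open V" "homeomorphism U' V \<theta> g"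
    "\<And>y. y \<in> V \<Longrightarrow> g differentiable (at y)"
    "\<And>u. u \<in> U' \<Longrightarrow> inj (frechet_derivative \<theta> (at u))"
proof -
  let ?D = "\<lambda>u. frechet_derivative \<theta> (at u)"
  have d: "\<theta> differentiable (at u)" if "u \<in> U" for u
    using \<theta> that Ck_on_Suc_open[OF U(1), of 0 \<theta>] by simp
  have bl: "bounded_linear (?D u)" if "u \<in> U" for u
    using has_derivative_bounded_linear d[OF that] by (auto simp: frechet_derivative_works)
  define D where "D u = Blinfun (?D u)" for u
  have D: "blinfun_apply (D u) = ?D u" if "u \<in> U" for u
    unfolding D_def using bounded_linear_Blinfun_apply[OF bl[OF that]] .
  have "continuous_on U D"
  proof (rule continuous_on_blinfun_componentwise)
    fix i :: "real^2" assume i: "i \<in> Basis"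
    then obtain k where k: "i = axis k 1" by (auto simp: Basis_vec_def)
    have "continuous_on U (pd k \<theta>)" using \<theta> by simp
    then show "continuous_on U (\<lambda>u. blinfun_apply (D u) i)"
      by (rule continuous_on_eq) (simp add: D k pd_def)
  qed
  moreover obtain E where E: "linear E" "E \<circ> ?D u0 = id"
    using linear_injective_left_inverse[OF bounded_linear.linear[OF bl[OF U(2)]] inj] by blast
  moreover have "Blinfun E o\<^sub>L D u0 = id_blinfun"
    using E D[OF U(2)] by (intro blinfun_eqI)
      (simp add: bounded_linear_Blinfun_apply linear_conv_bounded_linear[symmetric] o_def fun_eq_iff)
  ultimately obtain U' V g g' where g: "open U'" "U' \<subseteq> U" "u0 \<in> U'" "open V" "homeomorphism U' V \<theta> g"
    "\<And>y. y \<in> V \<Longrightarrow> (g has_derivative (g' y)) (at y)"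
    "\<And>y. y \<in> V \<Longrightarrow> bij (blinfun_apply (D (g y)))"
    using inverse_function_theorem[of U \<theta> D u0 "Blinfun E"] U d
    by (metis (no_types, lifting) D frechet_derivative_works)
  show ?thesis
  proof (rule that[OF g(1-5)])
    show "g differentiable (at y)" if "y \<in> V" for y using g(6)[OF that] by (rule differentiableI)
    fix u assume u: "u \<in> U'"
    then have "\<theta> u \<in> V" "g (\<theta> u) = u" using g(5) by (auto simp: homeomorphism_def)
    then have "bij (blinfun_apply (D u))" using g(7)[of "\<theta> u"] by simp
    moreover have "blinfun_apply (D u) = ?D u" using u g(2) by (intro D) auto
    ultimately show "inj (?D u)" by (simp add: bij_def)
  qed
qed

text \<open>By the intermediate value theorem, t takes every small positive value at small
  parameters, so a limit along the curve is a one-sided limit of v itself.\<close>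

lemma tendsto_at_right_via_curve:
  fixes t v :: "real \<Rightarrow> real"
  assumes t: "continuous_on {0..s0} t" "t 0 = 0" "\<And>s. 0 < s \<Longrightarrow> s \<le> s0 \<Longrightarrow> t s > 0" and "s0 > 0"
    and v: "((\<lambda>s. v (t s)) \<longlongrightarrow> a) (at_right 0)"
  shows "(v \<longlongrightarrow> a) (at_right (0::real))"
proof (rule tendstoI)
  fix e :: real assume "e > 0"
  then have "eventually (\<lambda>s. dist (v (t s)) a < e) (at_right 0)" using v tendstoD by blast
  then obtain d where d: "d > 0" "\<And>s. 0 < s \<Longrightarrow> s < d \<Longrightarrow> dist (v (t s)) a < e"
    by (auto simp: eventually_at_right[of 0 1])
  define s1 where "s1 = min (d / 2) s0"
  have s1: "0 < s1" "s1 < d" "s1 \<le> s0" using d assms(4) by (auto simp: s1_def)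
  have "dist (v r) a < e" if r: "0 < r" "r < t s1" for r
  proof -
    obtain s where s: "0 \<le> s" "s \<le> s1" "t s = r"
      using IVT'[of t 0 r s1] r s1 t(2) continuous_on_subset[OF t(1), of "{0..s1}"] by auto
    then have "s \<noteq> 0" using r t(2) by auto
    then show ?thesis using d(2)[of s] s s1 by auto
  qed
  moreover have "t s1 > 0" using t(3) s1 by auto
  ultimately show "eventually (\<lambda>r. dist (v r) a < e) (at_right 0)"
    by (auto simp: eventually_at_right[of 0 "t s1"] intro!: exI[of _ "t s1"])
qed

text \<open>A rotation about the normal sends a point of the patch near Q to a point of M at the
  same distance from Q, hence again on the patch; comparing coordinates shows that the height
  depends on \<bar>x\<bar> only. The delicate point is t = 0, where f contains a square root: the
  limit of f' is obtained from second derivatives of the height in the given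
  parametrization.\<close>

lemma axial_patch_exists:
  assumes M: "analytic_surface M" and Q: "Q \<in> M" and S1: "S1_invariant M Q"
  obtains A U X u0 a \<delta> f f' \<theta> where "axial_patch M A Q U X u0 a \<delta> f f' \<theta>"
proof -
  obtain n where n: "norm n = 1" "\<And>v. v \<in> tangent_space M Q \<Longrightarrow> n \<bullet> v = 0"
    "\<And>R. rotation_matrix R \<Longrightarrow> R *v n = n \<Longrightarrow> (\<lambda>P. Q + R *v (P - Q)) ` M = M"
    using S1 unfolding S1_invariant_def by blast
  obtain A :: "real^3^3" where A: "rotation_matrix A" "A *v axis 3 1 = n"
    using rotation_matrix_exists_basis[of n 3] n(1) by auto
  have orth: "orthogonal_matrix A" using A(1) by (simp add: rotation_matrix_def)
  have AtA: "transpose A *v (A *v v) = v" and AAt: "A *v (transpose A *v v) = v" for v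
    using orth unfolding orthogonal_matrix_def
    by (simp_all add: matrix_vector_mul_assoc del: transpose_matrix_vector)
  obtain U0 X where lp0: "local_param M U0 X" and "Q \<in> X ` U0"
    using M Q unfolding analytic_surface_def by blast
  then obtain u0 where u0: "u0 \<in> U0" "X u0 = Q" by auto
  note op0 = local_param_open[OF lp0]
  define p where "p m u = (transpose A *v (X u - Q)) $ m" for m u
  define \<theta> :: "real^2 \<Rightarrow> real^2" where "\<theta> u = vector [p 1 u, p 2 u]" for u
  have Cp: "Ck_on k (p m) U0" for k m
  proof -
    have "Ck_on k (\<lambda>u. X u - Q) U0" by (intro Ck_on_diff Ck_on_const op0 local_param_Ck_on[OF lp0])
    from Ck_on_linear[OF op0 bounded_linear_matrix_vec_nth this, of "transpose A" m]
    show ?thesis by (simp add: p_def[abs_def])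
  qed
  have dp: "p m differentiable (at u)" if "u \<in> U0" for m u
    using Cp[of 1 m] that by (simp add: differentiable_on_eq_differentiable_at[OF op0])
  have \<theta>_eq: "\<theta> u = p 1 u *\<^sub>R axis 1 1 + p 2 u *\<^sub>R axis 2 1" for u
    by (simp add: \<theta>_def vec_eq_iff forall_2 axis_def)
  have C\<theta>: "Ck_on k \<theta> U0" for k
    unfolding \<theta>_eq[abs_def]
    by (intro Ck_on_add op0 Ck_on_linear[OF op0 bounded_linear_scaleR_left Cp])
  have d\<theta>: "\<theta> differentiable (at u)" if "u \<in> U0" for u
    using C\<theta>[of 1] that by (simp add: differentiable_on_eq_differentiable_at[OF op0])
  define DX where "DX = frechet_derivative X (at u0)"
  have dX: "(X has_derivative DX) (at u0)"
    using local_param_differentiable[OF lp0 u0(1)] by (simp add: DX_def frechet_derivative_works)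
  have Dp: "(p m has_derivative (\<lambda>h. (transpose A *v DX h) $ m)) (at u0)" for m
    unfolding p_def[abs_def]
    by (rule bounded_linear.has_derivative[OF bounded_linear_matrix_vec_nth])
       (use has_derivative_diff[OF dX has_derivative_const[of Q]] in simp)
  \<comment> \<open>Tangent vectors at Q have no normal component, so injectivity of the derivative
    of X passes to that of the projection \<theta>.\<close>
  have D3: "(transpose A *v DX h) $ 3 = 0" for h
  proof -
    have "DX h \<in> tangent_space M Q" unfolding tangent_space_def DX_def using lp0 u0 by blast
    then have "n \<bullet> DX h = 0" by (rule n(2))
    then have "axis 3 1 \<bullet> (transpose A *v DX h) = 0"
      using A(2) by (metis dot_lmul_matrix inner_commute transpose_matrix_vector vector_transpose_matrix)
    then show ?thesis by (simp add: inner_axis' del: transpose_matrix_vector)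
  qed
  have D\<theta>: "frechet_derivative \<theta> (at u0) = (\<lambda>h. vector [(transpose A *v DX h) $ 1, (transpose A *v DX h) $ 2])"
  proof -
    have "(\<theta> has_derivative (\<lambda>h. (transpose A *v DX h) $ 1 *\<^sub>R axis 1 1 + (transpose A *v DX h) $ 2 *\<^sub>R axis 2 1)) (at u0)"
      unfolding \<theta>_eq[abs_def] by (intro has_derivative_add has_derivative_scaleR_left Dp)
    moreover have "(transpose A *v DX h) $ 1 *\<^sub>R axis 1 1 + (transpose A *v DX h) $ 2 *\<^sub>R axis 2 1
        = (vector [(transpose A *v DX h) $ 1, (transpose A *v DX h) $ 2] :: real^2)" for h
      by (simp add: vec_eq_iff forall_2 axis_def)
    ultimately show ?thesis using frechet_derivative_at by force
  qed
  have inj0: "inj (frechet_derivative \<theta> (at u0))"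
  proof -
    have lin: "linear (frechet_derivative \<theta> (at u0))"
      using linear_frechet_derivative[OF d\<theta>[OF u0(1)]] .
    have "h = 0" if h: "frechet_derivative \<theta> (at u0) h = 0" for h
    proof -
      have "(transpose A *v DX h) $ 1 = 0" "(transpose A *v DX h) $ 2 = 0"
        using h unfolding D\<theta> by (simp_all add: vec_eq_iff forall_2)
      then have "transpose A *v DX h = 0" using D3[of h] by (simp add: vec_eq_iff forall_3 del: transpose_matrix_vector)
      then have "DX h = 0" using AAt[of "DX h"] by (simp del: transpose_matrix_vector)
      then have "DX h = DX 0" using linear_0[OF has_derivative_linear[OF dX]] by simp
      then show "h = 0" using lp0 u0(1) by (auto simp: local_param_def DX_def inj_eq)
    qed
    then show ?thesis using linear_injective_0[OF lin] by blast
  qed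
  obtain U1 V g where g: "open U1" "U1 \<subseteq> U0" "u0 \<in> U1" "open V" "homeomorphism U1 V \<theta> g"
    "\<And>y. y \<in> V \<Longrightarrow> g differentiable (at y)"
    "\<And>u. u \<in> U1 \<Longrightarrow> inj (frechet_derivative \<theta> (at u))"
    using inverse_function_Ck[OF op0 u0(1) C\<theta> inj0] by metis
  have p0: "p m u0 = 0" for m using u0(2) by (simp add: p_def)
  have \<theta>0: "\<theta> u0 = 0" by (simp add: \<theta>_def p0 vec_eq_iff forall_2)
  have V0: "0 \<in> V" "g 0 = u0" using g(3,5) \<theta>0 by (auto simp: homeomorphism_def)
  have gV: "\<And>y. y \<in> V \<Longrightarrow> g y \<in> U1" "\<And>y. y \<in> V \<Longrightarrow> \<theta> (g y) = y" "\<And>u. u \<in> U1 \<Longrightarrow> g (\<theta> u) = u"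
    "\<And>u. u \<in> U1 \<Longrightarrow> \<theta> u \<in> V" and cg: "continuous_on V g"
    using g(5) by (auto simp: homeomorphism_def)
  \<comment> \<open>The rotations preserve the distance to Q, so points starting in this ball return
    to the patch after being rotated.\<close>
  obtain \<epsilon> where \<epsilon>: "\<epsilon> > 0" "M \<inter> ball Q \<epsilon> \<subseteq> X ` U1"
  proof -
    have "openin (top_of_set M) (X ` U1)" by (rule local_param_openin_image[OF lp0 g(1,2)])
    then show ?thesis using that u0 g(3) unfolding openin_contains_ball
      by (metis imageI inf_commute)
  qed
  have cX: "continuous_on V (\<lambda>y. X (g y))"
    by (rule continuous_on_compose2[OF local_param_continuous_on[OF lp0] cg]) (use gV g(2) in auto)
  obtain d0 where d0: "d0 > 0" "ball 0 d0 \<subseteq> V" "\<And>y. y \<in> ball 0 d0 \<Longrightarrow> X (g y) \<in> ball Q \<epsilon>"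
  proof -
    have "open (V \<inter> (\<lambda>y. X (g y)) -` ball Q \<epsilon>)"
      by (rule continuous_open_preimage[OF cX g(4)]) simp
    moreover have "0 \<in> V \<inter> (\<lambda>y. X (g y)) -` ball Q \<epsilon>" using V0 u0 \<epsilon>(1) by simp
    ultimately obtain e where "e > 0" "ball 0 e \<subseteq> V \<inter> (\<lambda>y. X (g y)) -` ball Q \<epsilon>"
      using open_contains_ball by blast
    then show ?thesis by (intro that[of e]) auto
  qed
  define F where "F y = p 3 (g y)" for y
  have vec3: "v = vector [v $ 1, v $ 2, v $ 3]" for v :: "real^3"
    by (simp add: vec_eq_iff forall_3)
  have pvec: "transpose A *v (X u - Q) = vector [\<theta> u $ 1, \<theta> u $ 2, p 3 u]" for u
    by (simp add: vec_eq_iff forall_3 \<theta>_def p_def)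
  have Frot: "F y = F x" if x: "x \<in> ball 0 d0" and y: "y \<in> ball 0 d0" and xy: "norm x = norm y" for x y
  proof (cases "x = 0")
    case True
    then show ?thesis using xy by simp
  next
    case False
    obtain B :: "real^3^3" where B: "rotation_matrix B" "B *v axis 3 1 = axis 3 1"
      "\<And>z. B *v vector [x $ 1, x $ 2, z] = vector [y $ 1, y $ 2, z]"
      using exists_rotation_about_axis3[OF xy False] by metis
    \<comment> \<open>B turns x into y about the third axis, and conjugation by A moves that axis to
      n.\<close>
    define R where "R = A ** B ** transpose A"
    have rotR: "rotation_matrix R"
      using A(1) B(1) unfolding R_def rotation_matrix_def
      by (simp add: orthogonal_matrix_mul det_mul)
    have Rv: "R *v v = A *v (B *v (transpose A *v v))" for v
      by (simp add: R_def matrix_vector_mul_assoc matrix_mul_assoc del: transpose_matrix_vector)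
    have "R *v n = n" unfolding Rv A(2)[symmetric] AtA B(2) ..
    note inv = n(3)[OF rotR this]
    define P where "P = X (g x)"
    have xV: "x \<in> V" "y \<in> V" using x y d0 by auto
    have PM: "P \<in> M" using local_param_subset[OF lp0] gV(1)[OF xV(1)] g(2) by (auto simp: P_def)
    define P' where "P' = Q + R *v (P - Q)"
    have "P' \<in> M" using inv PM unfolding P'_def by blast
    moreover have "dist Q P' < \<epsilon>"
    proof -
      have "orthogonal_transformation ((*v) R)"
        using rotR by (simp add: rotation_matrix_def orthogonal_transformation_matrix)
      then have "norm (R *v (P - Q)) = norm (P - Q)" by (rule orthogonal_transformation_norm)
      then have "dist Q P' = dist Q P" by (simp add: P'_def dist_norm norm_minus_commute)
      then show ?thesis using d0(3)[OF x] by (simp add: P_def)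
    qed
    ultimately obtain u where u: "u \<in> U1" "P' = X u" using \<epsilon>(2) by auto
    have "transpose A *v (X u - Q) = B *v (transpose A *v (P - Q))"
      unfolding u(2)[symmetric] P'_def by (simp add: Rv AtA del: transpose_matrix_vector)
    also have "transpose A *v (P - Q) = vector [x $ 1, x $ 2, F x]"
      unfolding P_def pvec F_def gV(2)[OF xV(1)] ..
    also have "B *v vector [x $ 1, x $ 2, F x] = vector [y $ 1, y $ 2, F x]" by (rule B(3))
    finally have e: "vector [\<theta> u $ 1, \<theta> u $ 2, p 3 u] = (vector [y $ 1, y $ 2, F x] :: real^3)"
      unfolding pvec .
    have "\<theta> u = y" "p 3 u = F x"
      using arg_cong[OF e, of "\<lambda>v. v $ 1"] arg_cong[OF e, of "\<lambda>v. v $ 2"] arg_cong[OF e, of "\<lambda>v. v $ 3"]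
      by (simp_all add: vec_eq_iff forall_2)
    then show ?thesis using gV(3)[OF u(1)] by (auto simp: F_def)
  qed
  define \<delta> where "\<delta> = d0\<^sup>2"
  have sd: "sqrt \<delta> = d0" "\<delta> > 0" using d0(1) by (auto simp: \<delta>_def)
  \<comment> \<open>A ray in the disc along which \<bar>x\<bar>^2 = t.\<close>
  define r where "r t = (vector [sqrt t, 0] :: real^2)" for t
  have nr: "norm (r t) = sqrt t" if "t \<ge> 0" for t
    using that by (simp add: r_def norm_vec_def L2_set_def sum_2)
  have r_ball: "r t \<in> ball 0 d0" if "0 \<le> t" "t < \<delta>" for t
    using that nr[OF that(1)] sd by (simp flip: sd(1))
  define f where "f t = F (r t)" for t
  have Ff: "F y = f (y \<bullet> y)" if y: "y \<in> ball 0 d0" for y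
  proof -
    have "norm (r (y \<bullet> y)) = norm y" unfolding nr[OF inner_ge_zero] by (simp add: norm_eq_sqrt_inner)
    then show ?thesis using Frot[of "r (y \<bullet> y)" y] y by (simp add: f_def)
  qed
  define U where "U = U1 \<inter> \<theta> -` ball 0 d0"
  have c\<theta>: "continuous_on U1 \<theta>" using g(5) by (simp add: homeomorphism_def)
  have opU: "open U" unfolding U_def by (rule continuous_open_preimage[OF c\<theta> g(1)]) simp
  have UU: "U \<subseteq> U1" "U \<subseteq> U0" using g(2) by (auto simp: U_def)
  have lpU: "local_param M U X" by (rule local_param_restrict[OF lp0 opU UU(2)])
  have homU: "homeomorphism U (ball 0 d0) \<theta> g"
    by (rule homeomorphism_of_subsets[OF g(5) UU(1)]) (use d0(2) gV in \<open>force simp: U_def image_iff\<close>)+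
  have u0U: "u0 \<in> U" using g(3) \<theta>0 d0(1) by (simp add: U_def)
  define \<tau> where "\<tau> u = (p 1 u)\<^sup>2 + (p 2 u)\<^sup>2" for u
  have \<theta>\<tau>: "\<theta> u \<bullet> \<theta> u = \<tau> u" for u by (simp add: \<theta>_def \<tau>_def inner_vec_def sum_2 power2_eq_square)
  have height: "p 3 u = f (\<tau> u)" if "u \<in> U" for u
    using that Ff[of "\<theta> u"] gV(3)[of u] by (auto simp: F_def U_def \<theta>\<tau>)
  have C\<tau>: "Ck_on k \<tau> U0" for k
    unfolding \<tau>_def[abs_def] power2_eq_square by (intro Ck_on_add Ck_on_mult op0 Cp)
  have d\<tau>: "\<tau> differentiable (at u)" if "u \<in> U0" for u
    using C\<tau>[of 1] that by (simp add: differentiable_on_eq_differentiable_at[OF op0])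
  have pd\<tau>: "pd i \<tau> u = 2 * (p 1 u * pd i (p 1) u + p 2 u * pd i (p 2) u)" if "u \<in> U0" for i u
    unfolding \<tau>_def[abs_def] power2_eq_square
    by (subst pd_add) (auto intro!: differentiable_mult dp that simp: pd_mult dp[OF that])
  have df: "f differentiable (at t)" if t: "0 < t" "t < \<delta>" for t
  proof -
    have rt: "r t \<in> V" using r_ball[of t] t d0(2) by auto
    have 1: "(p 3) differentiable (at (g (r t)))" using gV(1)[OF rt] g(2) dp by auto
    have 2: "g differentiable (at (r t))" using g(6)[OF rt] .
    have 3: "r differentiable (at t)"
    proof -
      have "(\<lambda>t. sqrt t *\<^sub>R axis 1 1 :: real^2) differentiable (at t)"
        by (rule differentiableI[OF has_derivative_scaleR_left[OF
              DERIV_real_sqrt[OF t(1), unfolded has_field_derivative_def]]])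
      moreover have "(\<lambda>t. sqrt t *\<^sub>R axis 1 1) = r" by (auto simp: fun_eq_iff r_def vec_eq_iff forall_2 axis_def)
      ultimately show ?thesis by simp
    qed
    show ?thesis
      using differentiable_chain_at[OF 3 differentiable_chain_at[OF 2 1]]
      unfolding f_def[abs_def] F_def by (simp add: o_def)
  qed
  define f' where "f' = deriv f"
  have Df: "(f has_real_derivative f' t) (at t)" if "0 < t" "t < \<delta>" for t
    unfolding f'_def using df[OF that] DERIV_deriv_iff_real_differentiable by blast
  have pdp3: "pd i (p 3) u = f' (\<tau> u) * pd i \<tau> u" if u: "u \<in> U" "\<tau> u > 0" for i u
  proof -
    have "\<tau> u < \<delta>"
    proof -
      have "norm (\<theta> u) < d0" using u(1) by (simp add: U_def)
      then have "sqrt (\<tau> u) < sqrt \<delta>" by (simp add: norm_eq_sqrt_inner \<theta>\<tau> sd)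
      then show ?thesis by simp
    qed
    from pd_compose_real(1)[OF Df[OF u(2) this] d\<tau>, of i]
    have "pd i (\<lambda>u. f (\<tau> u)) u = f' (\<tau> u) * pd i \<tau> u" using u UU by auto
    moreover have "pd i (p 3) u = pd i (\<lambda>u. f (\<tau> u)) u"
      by (rule pd_cong_open[OF opU u(1)]) (rule height)
    ultimately show ?thesis by simp
  qed
  \<comment> \<open>If the gradient of \<tau> vanished, \<theta> u would be orthogonal to the range
    of the derivative of \<theta>. That range is the whole plane and contains the nonzero vector
    \<theta> u.\<close>
  have grad: "(\<Sum>i\<in>UNIV. (pd i \<tau> u)\<^sup>2) \<noteq> 0" if u: "u \<in> U" "\<tau> u > 0" for u
  proof
    assume "(\<Sum>i\<in>UNIV. (pd i \<tau> u)\<^sup>2) = 0"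
    then have z: "pd i \<tau> u = 0" for i by (simp add: sum_nonneg_eq_0_iff)
    let ?D = "frechet_derivative \<theta> (at u)"
    have lin: "linear ?D" using linear_frechet_derivative[OF d\<theta>] u UU by auto
    have "surj ?D" using linear_injective_imp_surjective[OF lin] g(7) u UU by auto
    then obtain h where h: "?D h = \<theta> u" by (metis surjD)
    have hh: "h = (\<Sum>i\<in>UNIV. h $ i *\<^sub>R axis i 1)" by (simp add: vec_eq_iff sum_2 forall_2 axis_def)
    have pdth: "pd i \<theta> u $ 1 = pd i (p 1) u" "pd i \<theta> u $ 2 = pd i (p 2) u" for i
    proof -
      have uU0: "u \<in> U0" using u UU by auto
      have "pd i (\<lambda>u. \<theta> u $ 1) u = pd i \<theta> u $ 1" "pd i (\<lambda>u. \<theta> u $ 2) u = pd i \<theta> u $ 2"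
        by (rule pd_linear[OF bounded_linear_vec_nth d\<theta>[OF uU0]])+
      then show "pd i \<theta> u $ 1 = pd i (p 1) u" "pd i \<theta> u $ 2 = pd i (p 2) u"
        by (simp_all add: \<theta>_def)
    qed
    have "\<theta> u \<bullet> pd i \<theta> u = 0" for i
      using z[of i] pd\<tau>[of u i] u UU by (auto simp: inner_vec_def sum_2 pdth) (auto simp: \<theta>_def)
    then have "\<theta> u \<bullet> ?D h = 0"
      by (subst hh) (simp add: linear_sum[OF lin] linear_scale[OF lin] inner_sum_right pd_def)
    then show False using h u(2) by (simp add: \<theta>\<tau>)
  qed
  \<comment> \<open>Solves grad (p 3) = f' grad \<tau> for f' by pairing with grad \<tau>, so
    continuity of f' follows from that of first derivatives.\<close>
  define H where "H u = (\<Sum>i\<in>UNIV. pd i (p 3) u * pd i \<tau> u) / (\<Sum>i\<in>UNIV. (pd i \<tau> u)\<^sup>2)" for u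
  have gr: "g (r t) \<in> U" "\<tau> (g (r t)) = t" if "0 \<le> t" "t < \<delta>" for t
  proof -
    have "r t \<in> ball 0 d0" using r_ball that by auto
    then have *: "r t \<in> V" using d0(2) by auto
    then show "g (r t) \<in> U" using gV(1,2) \<open>r t \<in> ball 0 d0\<close> by (simp add: U_def)
    have "\<tau> (g (r t)) = r t \<bullet> r t" using \<theta>\<tau>[of "g (r t)"] gV(2)[OF *] by simp
    then show "\<tau> (g (r t)) = t" using nr[OF that(1)] that(1) by (metis power2_norm_eq_inner real_sqrt_pow2)
  qed
  have f'H: "f' t = H (g (r t))" if t: "0 < t" "t < \<delta>" for t
  proof -
    let ?u = "g (r t)"
    have u: "?u \<in> U" "\<tau> ?u = t" using gr t by auto
    have "(\<Sum>i\<in>UNIV. pd i (p 3) ?u * pd i \<tau> ?u) = f' t * (\<Sum>i\<in>UNIV. (pd i \<tau> ?u)\<^sup>2)"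
      using pdp3[OF u(1)] u(2) t by (simp add: sum_distrib_left power2_eq_square mult.assoc)
    then show ?thesis using grad[OF u(1)] u(2) t by (simp add: H_def)
  qed
  have cr: "continuous_on {0..<\<delta>} (\<lambda>t. g (r t))"
  proof (rule continuous_on_compose2[OF cg])
    have "r = (\<lambda>t. sqrt t *\<^sub>R axis 1 1)" by (auto simp: fun_eq_iff r_def vec_eq_iff forall_2 axis_def)
    then show "continuous_on {0..<\<delta>} r" by (simp add: continuous_intros)
    show "r ` {0..<\<delta>} \<subseteq> V" using r_ball d0(2) by auto
  qed
  have cf': "continuous_on {0<..<\<delta>} f'"
  proof -
    have cpd: "continuous_on U0 (pd i (p m))" "continuous_on U0 (pd i \<tau>)" for i m
      using Cp[of 1 m] C\<tau>[of 1] by auto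
    have cH: "continuous_on {u \<in> U. \<tau> u > 0} H"
      unfolding H_def[abs_def]
      by (intro continuous_intros continuous_on_subset[OF cpd(1)] continuous_on_subset[OF cpd(2)])
         (use UU grad in auto)
    have "continuous_on {0<..<\<delta>} (\<lambda>t. H (g (r t)))"
      by (rule continuous_on_compose2[OF cH continuous_on_subset[OF cr]]) (use gr in auto)
    then show ?thesis by (rule continuous_on_eq) (simp add: f'H)
  qed
  have f0: "(f \<longlongrightarrow> 0) (at_right 0)"
  proof -
    have "continuous_on {0..<\<delta>} f"
      unfolding f_def[abs_def] F_def
      by (rule continuous_on_compose2[OF Ck_on_imp_continuous_on[OF op0 Cp] cr]) (use gr UU in auto)
    then have "continuous_on {0..\<delta>/2} f" using sd(2) by (elim continuous_on_subset) auto
    then have "(f \<longlongrightarrow> f 0) (at_right 0)" using sd(2) by (simp add: continuous_on_Icc_at_rightD)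
    moreover have "f 0 = 0"
    proof -
      have "r 0 = 0" by (simp add: r_def vec_eq_iff forall_2)
      then show ?thesis by (simp add: f_def F_def V0 p0)
    qed
    ultimately show ?thesis by simp
  qed
  \<comment> \<open>Both gradients vanish at the pole. Along this line the quotient of the first
    derivatives of p 3 and \<tau> tends to the quotient of their second derivatives.\<close>
  define l where "l s = u0 + s *\<^sub>R (axis 1 1 :: real^2)" for s
  have l0: "l 0 = u0" by (simp add: l_def)
  have line: "((\<lambda>s. \<Phi> (l s)) has_real_derivative pd 1 \<Phi> (l s)) (at s)"
    if "\<Phi> differentiable (at (l s))" for \<Phi> s
  proof -
    let ?D = "frechet_derivative \<Phi> (at (l s))"
    have D: "(\<Phi> has_derivative ?D) (at (l s))" using that by (simp add: frechet_derivative_works)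
    have "(l has_derivative (\<lambda>h. h *\<^sub>R axis 1 1)) (at s)"
      unfolding l_def[abs_def] by (auto intro!: derivative_eq_intros)
    from has_derivative_compose[OF this D]
    have "((\<lambda>s. \<Phi> (l s)) has_derivative (\<lambda>h. ?D (h *\<^sub>R axis 1 1))) (at s)" .
    moreover have "?D (h *\<^sub>R axis 1 1) = pd 1 \<Phi> (l s) * h" for h
      using linear_scale[OF linear_frechet_derivative[OF that]] by (simp add: pd_def)
    ultimately show ?thesis by (simp add: has_field_derivative_def)
  qed
  define c2 where "c2 = pd 1 (pd 1 \<tau>) u0"
  have dpd: "pd 1 (p m) differentiable (at u)" "pd 1 \<tau> differentiable (at u)" if "u \<in> U0" for m u
    using Cp[of "Suc 1" m] C\<tau>[of "Suc 1"] that
    by (auto simp: differentiable_on_eq_differentiable_at[OF op0])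
  \<comment> \<open>The terms with second derivatives of p 1 and p 2 drop out because both functions
    vanish at the pole; what is left is positive by injectivity of the derivative of
    \<theta>.\<close>
  have c2_eq: "c2 = 2 * ((pd 1 (p 1) u0)\<^sup>2 + (pd 1 (p 2) u0)\<^sup>2)"
  proof -
    have "c2 = pd 1 (\<lambda>u. 2 * (p 1 u * pd 1 (p 1) u + p 2 u * pd 1 (p 2) u)) u0"
      unfolding c2_def by (rule pd_cong_open[OF op0 u0(1)]) (rule pd\<tau>)
    also have "\<dots> = 2 * ((pd 1 (p 1) u0)\<^sup>2 + (pd 1 (p 2) u0)\<^sup>2)"
      using dp[OF u0(1)] dpd[OF u0(1)]
      by (subst pd_linear[OF bounded_linear_mult_right], auto intro!: differentiable_add differentiable_mult)
         (subst pd_add, auto intro!: differentiable_mult simp: pd_mult p0 power2_eq_square)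
    finally show ?thesis .
  qed
  have c2pos: "c2 > 0"
  proof -
    have "pd 1 \<theta> u0 \<noteq> 0"
    proof
      assume "pd 1 \<theta> u0 = 0"
      then have "frechet_derivative \<theta> (at u0) (axis 1 1) = frechet_derivative \<theta> (at u0) 0"
        using linear_0[OF linear_frechet_derivative[OF d\<theta>[OF u0(1)]]] by (simp add: pd_def)
      then show False using inj0 by (simp add: inj_eq axis_eq_0_iff)
    qed
    moreover have "pd 1 \<theta> u0 $ 1 = pd 1 (p 1) u0" "pd 1 \<theta> u0 $ 2 = pd 1 (p 2) u0"
      using pd_linear[OF bounded_linear_vec_nth d\<theta>[OF u0(1)], of 1 1] pd_linear[OF bounded_linear_vec_nth d\<theta>[OF u0(1)], of 1 2]
      by (simp_all add: \<theta>_def)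
    ultimately have "pd 1 (p 1) u0 \<noteq> 0 \<or> pd 1 (p 2) u0 \<noteq> 0" by (auto simp: vec_eq_iff forall_2)
    then have "(pd 1 (p 1) u0)\<^sup>2 + (pd 1 (p 2) u0)\<^sup>2 > 0" by (simp add: sum_power2_gt_zero_iff)
    then show ?thesis unfolding c2_eq by (rule mult_pos_pos[rotated]) simp
  qed
  define a where "a = pd 1 (pd 1 (p 3)) u0 / c2"
  have pd0: "pd 1 \<tau> u0 = 0" "pd 1 (p 3) u0 = 0"
    using pd\<tau>[OF u0(1)] p0 pd_eqI[OF Dp, of 1 3] D3 by (simp_all del: transpose_matrix_vector)
  have slope: "((\<lambda>s. \<Phi> (l s) / s) \<longlongrightarrow> pd 1 \<Phi> u0) (at_right 0)"
    if "\<Phi> differentiable (at u0)" "\<Phi> u0 = 0" for \<Phi>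
  proof -
    have "((\<lambda>s. \<Phi> (l s)) has_real_derivative pd 1 \<Phi> u0) (at 0)" using line[of \<Phi> 0] that by (simp add: l0)
    then have "((\<lambda>s. (\<Phi> (l s) - \<Phi> (l 0)) / (s - 0)) \<longlongrightarrow> pd 1 \<Phi> u0) (at 0)"
      by (simp add: has_field_derivative_iff)
    then show ?thesis using that by (auto simp: l0 intro: tendsto_within_subset)
  qed
  have cl: "continuous_on UNIV l" unfolding l_def[abs_def] by (intro continuous_intros)
  have "open (l -` U)" using open_vimage[OF opU cl] .
  moreover have "0 \<in> l -` U" using u0U l0 by simp
  ultimately obtain s1 where "s1 > 0" "ball 0 s1 \<subseteq> l -` U"
    unfolding open_contains_ball by blast
  then have s1: "s1 > 0" "\<And>s. \<bar>s\<bar> < s1 \<Longrightarrow> l s \<in> U"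
    by (auto simp: subset_iff dist_real_def)
  have tau_pos: "\<tau> (l s) > 0" if "0 < s" "s < s1" for s
  proof -
    have "l s \<noteq> u0" using that by (simp add: l_def axis_eq_0_iff)
    moreover have "l s \<in> U1" using s1(2)[of s] that UU by auto
    ultimately have "\<theta> (l s) \<noteq> 0" using \<theta>0 gV(3) g(3) by metis
    then have "\<theta> (l s) \<bullet> \<theta> (l s) > 0" by simp
    then show ?thesis by (simp add: \<theta>\<tau>)
  qed
  have limf': "(f' \<longlongrightarrow> a) (at_right 0)"
  proof (rule tendsto_at_right_via_curve[of "s1 / 2" "\<lambda>s. \<tau> (l s)"])
    show "continuous_on {0..s1 / 2} (\<lambda>s. \<tau> (l s))"
      by (rule continuous_on_compose2[OF Ck_on_imp_continuous_on[OF op0 C\<tau>] continuous_on_subset[OF cl]])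
         (use s1 UU in auto)
    show "\<tau> (l 0) = 0" by (simp add: l0 \<tau>_def p0)
    show "\<tau> (l s) > 0" if "0 < s" "s \<le> s1 / 2" for s using tau_pos that by simp
    have "((\<lambda>s. (pd 1 (p 3) (l s) / s) / (pd 1 \<tau> (l s) / s)) \<longlongrightarrow> pd 1 (pd 1 (p 3)) u0 / c2) (at_right 0)"
      using c2pos unfolding c2_def by (intro tendsto_divide slope dpd u0(1) pd0) auto
    moreover have "eventually (\<lambda>s. (pd 1 (p 3) (l s) / s) / (pd 1 \<tau> (l s) / s) = f' (\<tau> (l s))) (at_right 0)"
    proof -
      have "eventually (\<lambda>s. pd 1 \<tau> (l s) / s > 0) (at_right 0)"
        using order_tendstoD(1)[OF slope[OF dpd(2)[OF u0(1)] pd0(1)], of 0] c2pos by (simp add: c2_def)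
      with eventually_at_right_0_lt[OF s1(1)] show ?thesis
      proof eventually_elim
        case (elim s)
        then show ?case using pdp3[OF s1(2) tau_pos, of s 1] by auto
      qed
    qed
    ultimately show "((\<lambda>s. f' (\<tau> (l s))) \<longlongrightarrow> a) (at_right 0)"
      unfolding a_def by (rule Lim_transform_eventually)
  qed (use s1 in auto)
  have "axial_patch M A Q U X u0 a \<delta> f f' \<theta>"
  proof
    show "\<theta> = (\<lambda>u. vector [(transpose A *v (X u - Q)) $ 1, (transpose A *v (X u - Q)) $ 2])"
      by (simp add: \<theta>_def p_def fun_eq_iff)
    show "\<exists>g. homeomorphism U (ball 0 (sqrt \<delta>)) \<theta> g" using homU sd by auto
    show "profile_curve a \<delta> f f'"
      unfolding profile_curve_def using sd Df cf' f0 limf' by auto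
    show "(transpose A *v (X u - Q)) $ 3 = f (\<theta> u \<bullet> \<theta> u)" if "u \<in> U" for u
      using height[OF that] by (simp add: p_def \<theta>\<tau>)
  qed (use lpU orth u0U u0 in auto)
  then show ?thesis by (rule that)
qed

section \<open>Global argument\<close>

text \<open>The indicator of a clopen set C containing Q is a smooth test function with Laplacian 0,
  so the equation reads 0 = 1 - area(C) / V. As division by zero gives 0, the case V = 0 would say 0
  = 1. With C = A the complement is null, and a nonempty open piece of M has positive area.\<close>

lemma clopen_subset_full_measure:
  assumes M: "analytic_surface M" and \<sigma>: "area_measure M \<sigma>" and green: "green_function M \<sigma> Q G"
    and A: "openin (top_of_set M) A" "openin (top_of_set M) (M - A)" and Q: "Q \<in> A"
  shows "measure \<sigma> M > 0" "A = M"
proof -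
  have sp: "space \<sigma> = M" and ss: "sets \<sigma> = sets (restrict_space borel M)"
    and em: "\<And>U X B. local_param M U X \<Longrightarrow> B \<in> sets borel \<Longrightarrow> B \<subseteq> U \<Longrightarrow>
      emeasure \<sigma> (X ` B) = (\<integral>\<^sup>+u\<in>B. ennreal (area_density X u) \<partial>lborel)"
    using \<sigma> unfolding area_measure_def by blast+
  have meas_clopen: "measure \<sigma> C = measure \<sigma> M \<and> measure \<sigma> M \<noteq> 0"
    if C: "openin (top_of_set M) C" "openin (top_of_set M) (M - C)" "Q \<in> C" for C
  proof -
    define \<phi> :: "real^3 \<Rightarrow> real" where "\<phi> = indicator C"
    have loc: "\<exists>V c. open V \<and> u \<in> V \<and> (\<forall>w\<in>V. \<phi> (X w) = c)" if "local_param M U X" "u \<in> U" for U X u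
    proof (cases "X u \<in> C")
      case True
      with local_param_open_vimage[OF that(1) C(1)] that(2) show ?thesis
        by (intro exI[of _ "{u \<in> U. X u \<in> C}"] exI[of _ 1]) (auto simp: \<phi>_def)
    next
      case False
      with local_param_open_vimage[OF that(1) C(2)] that(2) local_param_subset[OF that(1)] show ?thesis
        by (intro exI[of _ "{u \<in> U. X u \<in> M - C}"] exI[of _ 0]) (auto simp: \<phi>_def)
    qed
    have "smooth_on_surface M \<phi>"
      unfolding smooth_on_surface_def smooth_on_def
    proof (intro allI impI)
      fix U X k assume lp: "local_param M U X"
      show "Ck_on k (\<phi> \<circ> X) U"
      proof (rule Ck_on_local[OF local_param_open[OF lp]])
        fix u assume "u \<in> U"
        then obtain V c where V: "open V" "u \<in> V" "\<forall>w\<in>V. \<phi> (X w) = c" using loc[OF lp] by blast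
        have "Ck_on k (\<phi> \<circ> X) V"
          by (rule Ck_on_cong[OF V(1), THEN iffD1, OF _ Ck_on_const[of k c]]) (simp add: V(3))
        then show "\<exists>V. open V \<and> u \<in> V \<and> Ck_on k (\<phi> \<circ> X) V"
          using V(1,2) by (intro exI[of _ V] conjI)
      qed
    qed
    moreover have "has_laplace_beltrami M \<phi> (\<lambda>_. 0)"
      unfolding has_laplace_beltrami_def
    proof
      fix P assume "P \<in> M"
      then obtain U X where lp: "local_param M U X" "P \<in> X ` U" using M unfolding analytic_surface_def by blast
      then obtain u where u: "u \<in> U" "X u = P" by blast
      obtain V c where V: "open V" "u \<in> V" "\<forall>w\<in>V. \<phi> (X w) = c" using loc[OF lp(1) u(1)] by blast
      have "LB X (\<phi> \<circ> X) u = 0" by (rule LB_locally_const[OF V(1,2), of _ c]) (simp add: V(3))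
      then show "\<exists>U X u. local_param M U X \<and> u \<in> U \<and> X u = P \<and> 0 = LB X (\<phi> \<circ> X) u"
        using lp(1) u by (intro exI[of _ U] exI[of _ X] exI[of _ u]) simp
    qed
    ultimately have "- (LINT P|\<sigma>. G P * 0) = \<phi> Q - (1 / measure \<sigma> M) * (LINT P|\<sigma>. \<phi> P)"
      using green unfolding green_function_def by blast
    moreover have "(LINT P|\<sigma>. \<phi> P) = measure \<sigma> C"
    proof -
      have "C \<inter> space \<sigma> = C" using C(1) openin_imp_subset sp by blast
      then show ?thesis by (simp add: \<phi>_def)
    qed
    ultimately have "(1 / measure \<sigma> M) * measure \<sigma> C = 1" using C(3) by (simp add: \<phi>_def)
    then show ?thesis by (cases "measure \<sigma> M = 0") (auto simp: field_simps)
  qed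
  have AM: "A \<subseteq> M" using A(1) openin_imp_subset by blast
  have mA: "measure \<sigma> A = measure \<sigma> M" and V: "measure \<sigma> M \<noteq> 0" using meas_clopen[OF A Q] by auto
  then show "measure \<sigma> M > 0" using measure_nonneg[of \<sigma> M] by linarith
  have Aset: "A \<in> sets \<sigma>"
  proof -
    obtain T where "open T" "A = M \<inter> T" using A(1) by (auto simp: openin_open)
    then show ?thesis unfolding ss by (auto simp: sets_restrict_space)
  qed
  have Mset: "M \<in> sets \<sigma>" using sets.top[of \<sigma>] sp by simp
  \<comment> \<open>\<open>measure\<close> returns 0 for infinite measure, so V \<noteq> 0 entails
    finiteness.\<close>
  have fin: "emeasure \<sigma> M \<noteq> \<infinity>" using V by (auto simp: measure_def)
  have finA: "emeasure \<sigma> A \<noteq> \<infinity>"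
    using emeasure_mono[OF AM Mset] fin by (auto simp: top_unique)
  have MA: "M - A \<in> sets \<sigma>" using Mset Aset by auto
  have "emeasure \<sigma> (M - A) = emeasure \<sigma> M - emeasure \<sigma> A"
    by (rule emeasure_Diff) (use finA Mset Aset AM in auto)
  also have "\<dots> = 0"
    using emeasure_eq_ennreal_measure[of \<sigma> M] emeasure_eq_ennreal_measure[of \<sigma> A] fin finA mA by simp
  finally have null: "emeasure \<sigma> (M - A) = 0" .
  show "A = M"
  proof (rule ccontr)
    assume "A \<noteq> M"
    then obtain P where P: "P \<in> M - A" using AM by auto
    then obtain U X where lp: "local_param M U X" "P \<in> X ` U" using M unfolding analytic_surface_def by blast
    define W where "W = {u \<in> U. X u \<in> M - A}"
    have W: "open W" "W \<subseteq> U" "W \<noteq> {}"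
      using local_param_open_vimage[OF lp(1) A(2)] lp(2) P by (auto simp: W_def)
    have cW: "continuous_on W (area_density X)"
      by (rule continuous_on_subset[OF continuous_on_area_density[OF lp(1)] W(2)])
    have meas: "(\<lambda>u. ennreal (area_density X u) * indicator W u) \<in> borel_measurable lborel"
    proof -
      have "(\<lambda>u. ennreal (indicator W u *\<^sub>R area_density X u)) \<in> borel_measurable borel"
        using borel_measurable_continuous_on_indicator[OF borel_open[OF W(1)] cW] by measurable
      moreover have "(\<lambda>u. ennreal (indicator W u *\<^sub>R area_density X u)) = (\<lambda>u. ennreal (area_density X u) * indicator W u)"
        by (auto simp: fun_eq_iff indicator_def)
      ultimately show ?thesis by simp
    qed
    have "(\<integral>\<^sup>+u\<in>W. ennreal (area_density X u) \<partial>lborel) = emeasure \<sigma> (X ` W)"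
      using em[OF lp(1) borel_open[OF W(1)] W(2)] by simp
    also have "\<dots> \<le> emeasure \<sigma> (M - A)" by (rule emeasure_mono[OF _ MA]) (auto simp: W_def)
    finally have "(\<integral>\<^sup>+u\<in>W. ennreal (area_density X u) \<partial>lborel) = 0" using null by simp
    then have "AE u in lborel. ennreal (area_density X u) * indicator W u = 0"
      using nn_integral_0_iff_AE[OF meas] by simp
    then have "AE u in lborel. u \<notin> W"
      by eventually_elim (use area_density_pos[OF lp(1)] W(2) in \<open>force simp: indicator_def split: if_splits\<close>)
    then have "W \<in> null_sets lborel"
      using borel_open[OF W(1)] by (subst (asm) AE_iff_null_sets[symmetric]) auto
    then have "negligible W" by (simp add: negligible_iff_null_sets null_sets_completionI)
    then show False using open_not_negligible[OF W(1,3)] by simp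
  qed
qed

text \<open>If a point b were missed, the punctured sphere would be a plane, in which M becomes a
  nonempty set that is compact and, by invariance of domain, open. Connectedness makes it the whole
  plane, which is unbounded.\<close>

lemma closed_surface_in_sphere:
  assumes M: "closed_analytic_surface M" "M \<noteq> {}" and sub: "M \<subseteq> sphere c R" and R: "R > 0"
  shows "M = sphere c R"
proof (rule ccontr)
  assume "M \<noteq> sphere c R"
  then obtain b where b: "b \<in> sphere c R" "b \<notin> M" using sub by blast
  have "(sphere c R - {b}) homeomorphic (UNIV :: (real^2) set)"
    by (rule homeomorphic_punctured_sphere_affine[OF R b(1)]) auto
  then obtain h k where hk: "homeomorphism (sphere c R - {b}) (UNIV :: (real^2) set) h k"
    unfolding homeomorphic_def by blast
  have ch: "continuous_on (sphere c R - {b}) h" and ih: "inj_on h (sphere c R - {b})"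
    using hk unfolding homeomorphism_def by (auto intro: inj_on_inverseI)
  have MS: "M \<subseteq> sphere c R - {b}" using sub b by auto
  have "compact (h ` M)"
    using M(1) MS continuous_on_subset[OF ch] by (intro compact_continuous_image) (auto simp: closed_analytic_surface_def)
  moreover have "open (h ` M)"
    unfolding open_subopen[of "h ` M"]
  proof
    fix x assume "x \<in> h ` M"
    then obtain P where P: "P \<in> M" "x = h P" by auto
    obtain U X where lp: "local_param M U X" "P \<in> X ` U"
      using M(1) P(1) unfolding closed_analytic_surface_def analytic_surface_def by blast
    have XS: "X ` U \<subseteq> sphere c R - {b}" using local_param_subset[OF lp(1)] MS by auto
    have "open ((h \<circ> X) ` U)"
    proof (rule invariance_of_domain)
      show "continuous_on U (h \<circ> X)"
        by (rule continuous_on_compose[OF local_param_continuous_on[OF lp(1)] continuous_on_subset[OF ch XS]])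
      show "inj_on (h \<circ> X) U"
        by (rule comp_inj_on[OF local_param_inj_on[OF lp(1)] inj_on_subset[OF ih XS]])
    qed (rule local_param_open[OF lp(1)])
    then show "\<exists>T. open T \<and> x \<in> T \<and> T \<subseteq> h ` M"
      using local_param_subset[OF lp(1)] lp(2) P(2) by (intro exI[of _ "(h \<circ> X) ` U"]) auto
  qed
  ultimately have "h ` M = UNIV"
    using clopen[of "h ` M"] compact_imp_closed M(2) by auto
  then show False using \<open>compact (h ` M)\<close> compact_imp_bounded not_bounded_UNIV by metis
qed

text \<open>For the complement, a patch around P is taken so small that a single point of
  \<open>A\<close> in it forces the whole patch into the sphere; then P itself would belong to
  \<open>A\<close>.\<close>

lemma clopen_locally_in_sphere:
  fixes M :: "(real^3) set" and c :: "real^3"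
  assumes M: "analytic_surface M" and R: "R > 0"
  defines "A \<equiv> {P \<in> M. \<exists>\<epsilon>>0. M \<inter> ball P \<epsilon> \<subseteq> sphere c R}"
  shows "openin (top_of_set M) A" "openin (top_of_set M) (M - A)"
proof -
  have inA: "P \<in> A" if W: "openin (top_of_set M) W" "P \<in> W" "W \<subseteq> sphere c R" for P W
  proof -
    obtain \<epsilon> where "\<epsilon> > 0" "ball P \<epsilon> \<inter> M \<subseteq> W" "W \<subseteq> M"
      using W(1,2) unfolding openin_contains_ball by blast
    then show ?thesis using W by (auto simp: A_def)
  qed
  show "openin (top_of_set M) A"
  proof (subst openin_subopen, intro ballI)
    fix P assume "P \<in> A"
    then obtain \<epsilon> where \<epsilon>: "\<epsilon> > 0" "M \<inter> ball P \<epsilon> \<subseteq> sphere c R" "P \<in> M" by (auto simp: A_def)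
    have o: "openin (top_of_set M) (M \<inter> ball P \<epsilon>)" by (simp add: openin_open_Int)
    have "M \<inter> ball P \<epsilon> \<subseteq> A" using inA[OF o _ \<epsilon>(2)] by blast
    then show "\<exists>T. openin (top_of_set M) T \<and> P \<in> T \<and> T \<subseteq> A"
      using o \<epsilon> by (intro exI[of _ "M \<inter> ball P \<epsilon>"]) auto
  qed
  show "openin (top_of_set M) (M - A)"
  proof (subst openin_subopen, intro ballI)
    fix P assume P: "P \<in> M - A"
    then obtain U X where lp: "local_param M U X" "P \<in> X ` U" using M unfolding analytic_surface_def by blast
    then obtain u where u: "u \<in> U" "X u = P" by blast
    have "real_analytic_on X U" using lp(1) by (simp add: local_param_def)
    then obtain \<rho> where \<rho>: "\<rho> > 0"
      "\<And>V. open V \<Longrightarrow> V \<inter> ball u \<rho> \<noteq> {} \<Longrightarrow> X ` V \<subseteq> sphere c R \<Longrightarrow> X ` ball u \<rho> \<subseteq> sphere c R"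
      using real_analytic_sphere_propagation[OF _ u(1) R] by metis
    define W where "W = X ` (ball u \<rho> \<inter> U)"
    have W: "openin (top_of_set M) W"
      unfolding W_def by (rule local_param_openin_image[OF lp(1)]) (auto simp: local_param_open[OF lp(1)])
    have PW: "P \<in> W" using u \<rho>(1) by (auto simp: W_def)
    have "W \<inter> A = {}"
    proof (rule ccontr)
      assume "W \<inter> A \<noteq> {}"
      then obtain w where w: "w \<in> ball u \<rho>" "w \<in> U" "X w \<in> A" by (auto simp: W_def)
      then obtain \<epsilon> where \<epsilon>: "\<epsilon> > 0" "M \<inter> ball (X w) \<epsilon> \<subseteq> sphere c R" by (auto simp: A_def)
      define V where "V = {v \<in> U. X v \<in> M \<inter> ball (X w) \<epsilon>}"
      have "open V" unfolding V_def by (rule local_param_open_vimage[OF lp(1)]) (simp add: openin_open_Int)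
      moreover have "w \<in> V" using w \<epsilon> by (auto simp: V_def A_def)
      moreover have "X ` V \<subseteq> sphere c R" using \<epsilon>(2) by (auto simp: V_def)
      ultimately have "X ` ball u \<rho> \<subseteq> sphere c R" using \<rho>(2)[of V] w(1) by blast
      then have "W \<subseteq> sphere c R" by (auto simp: W_def)
      then show False using inA[OF W PW] P by blast
    qed
    moreover have "W \<subseteq> M" using W openin_imp_subset by blast
    ultimately show "\<exists>T. openin (top_of_set M) T \<and> P \<in> T \<and> T \<subseteq> M - A"
      using W PW by (intro exI[of _ W]) auto
  qed
qed

context axial_patch
begin

text \<open>Completing the square in t + f^2 = f / a gives t + (f - 1 / (2 a))^2 = (1 / (2 a))^2,
  which fixes the centre on the normal line through Q. The pole satisfies the relation separately,
  as all coordinates vanish there.\<close>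

lemma patch_locally_in_sphere:
  assumes a: "a \<noteq> 0" and ev: "eventually (\<lambda>t. t + (f t)\<^sup>2 = f t / a) (at_right 0)"
  defines "c \<equiv> Q + (1 / (2 * a)) *\<^sub>R (A *v axis 3 1)"
  shows "\<exists>\<epsilon>>0. M \<inter> ball Q \<epsilon> \<subseteq> sphere c (1 / (2 * \<bar>a\<bar>))"
proof -
  have AtA: "transpose A *v (A *v v) = v" for v
    using orth unfolding orthogonal_matrix_def
    by (simp add: matrix_vector_mul_assoc del: transpose_matrix_vector)
  obtain \<eta> where \<eta>: "\<eta> > 0" "\<And>t. 0 < t \<Longrightarrow> t < \<eta> \<Longrightarrow> t + (f t)\<^sup>2 = f t / a"
    using ev by (auto simp: eventually_at_right[of 0 1])
  have d: "(dist c (X u))\<^sup>2 = \<tau> u + (p 3 u - 1 / (2 * a))\<^sup>2" for u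
  proof -
    let ?v = "transpose A *v (X u - c)"
    have "X u - c = (X u - Q) - (1 / (2 * a)) *\<^sub>R (A *v axis 3 1)" by (simp add: c_def)
    then have "?v = transpose A *v (X u - Q) - (1 / (2 * a)) *\<^sub>R axis 3 1"
      by (simp only: matrix_vector_mult_diff_distrib matrix_vector_mult_scaleR AtA)
    then have v: "?v $ 1 = p 1 u" "?v $ 2 = p 2 u" "?v $ 3 = p 3 u - 1 / (2 * a)"
      by (simp_all add: p_def axis_def del: transpose_matrix_vector)
    have "(dist c (X u))\<^sup>2 = (norm ?v)\<^sup>2"
      using orthogonal_transformation_norm[OF orthogonal_transformation_transpose, of "X u - c"]
      by (simp add: dist_norm norm_minus_commute del: transpose_matrix_vector)
    also have "\<dots> = \<tau> u + (p 3 u - 1 / (2 * a))\<^sup>2"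
      unfolding power2_norm_eq_inner inner_vec_def sum_3 v by (simp add: \<tau>_def power2_eq_square)
    finally show ?thesis .
  qed
  have on: "X u \<in> sphere c (1 / (2 * \<bar>a\<bar>))" if u: "u \<in> U" "\<tau> u < \<eta>" for u
  proof -
    have "\<tau> u + (p 3 u)\<^sup>2 = p 3 u / a"
    proof (cases "u = u0")
      case True
      then show ?thesis by (simp add: p_u0 \<tau>_def)
    next
      case False
      then have "\<tau> u > 0" using tau_eq_0_iff[OF u(1)] tau_nonneg[of u] by (auto simp: less_le)
      then show ?thesis using \<eta>(2)[of "\<tau> u"] u height'[OF u(1)] by simp
    qed
    then have "(dist c (X u))\<^sup>2 = (1 / (2 * a))\<^sup>2"
      unfolding d using a by (simp add: power2_diff)
    also have "\<dots> = (1 / (2 * \<bar>a\<bar>))\<^sup>2" by (simp add: power_divide power_mult_distrib)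
    finally show ?thesis by (simp add: power2_eq_iff_nonneg)
  qed
  define V where "V = U \<inter> \<tau> -` {..<\<eta>}"
  have "open V" unfolding V_def by (rule continuous_open_preimage[OF continuous_on_tau opU]) simp
  then have "openin (top_of_set M) (X ` V)"
    by (rule local_param_openin_image[OF lp]) (auto simp: V_def)
  moreover have "Q \<in> X ` V" using u0 \<eta>(1) tau_eq_0_iff[OF u0(1)] by (force simp: V_def)
  ultimately obtain \<epsilon> where "\<epsilon> > 0" "ball Q \<epsilon> \<inter> M \<subseteq> X ` V"
    unfolding openin_contains_ball by blast
  moreover have "X ` V \<subseteq> sphere c (1 / (2 * \<bar>a\<bar>))" using on by (auto simp: V_def)
  ultimately show ?thesis by (intro exI[of _ \<epsilon>]) blast
qed

end

theorem theorem5: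
  fixes M :: "(real^3) set" and \<sigma> :: "(real^3) measure" and Q :: "real^3"
    and G :: "real^3 \<Rightarrow> real" and C :: real
  assumes "closed_analytic_surface M"
    and "area_measure M \<sigma>"
    and "Q \<in> M"
    and "green_function M \<sigma> Q G"
    and "\<And>P. P \<in> M \<Longrightarrow> P \<noteq> Q \<Longrightarrow> G P = - (1 / (2 * pi)) * ln (dist P Q) + C"
    and "S1_invariant M Q"
  shows "round_sphere M"
proof -
  have M: "analytic_surface M" using assms(1) by (simp add: closed_analytic_surface_def)
  \<comment> \<open>Here M itself is the clopen set, so the constant test function 1 yields a
    positive area and hence \<kappa> > 0.\<close>
  have V: "measure \<sigma> M > 0"
    by (rule clopen_subset_full_measure(1)[OF M assms(2,4) _ _ assms(3)]) auto
  obtain A U X u0 a \<delta> f f' \<theta> where "axial_patch M A Q U X u0 a \<delta> f f' \<theta>"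
    using axial_patch_exists[OF M assms(3,6)] .
  then interpret axial_patch M A Q U X u0 a \<delta> f f' \<theta> .
  have ode: "profile_ode (pi / measure \<sigma> M) \<delta> f f'"
    by (rule patch_profile_ode[OF M assms(2,4,5)])
  have a: "a \<noteq> 0" and ev: "eventually (\<lambda>t. t + (f t)\<^sup>2 = f t / a) (at_right 0)"
    using profile_ode_sphere[OF curve ode] V by auto
  define c where "c = Q + (1 / (2 * a)) *\<^sub>R (A *v axis 3 1)"
  define R where "R = 1 / (2 * \<bar>a\<bar>)"
  have R: "R > 0" using a by (simp add: R_def)
  have "\<exists>\<epsilon>>0. M \<inter> ball Q \<epsilon> \<subseteq> sphere c R"
    unfolding c_def R_def by (rule patch_locally_in_sphere[OF a ev])
  then have "{P \<in> M. \<exists>\<epsilon>>0. M \<inter> ball P \<epsilon> \<subseteq> sphere c R} = M"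
    by (intro clopen_subset_full_measure(2)[OF M assms(2,4) clopen_locally_in_sphere[OF M R]])
      (use assms(3) in blast)
  then have "M \<subseteq> sphere c R" by fastforce
  then have "M = sphere c R"
    by (intro closed_surface_in_sphere[OF assms(1)] R) (use assms(3) in auto)
  then show ?thesis unfolding round_sphere_def using R by blast
qed

end
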